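(* Let $M$ be either a local model (i.e. $M=L\subset\mathbb{R}^{2n+1}$ a Legendre submanifold) or a connected and simply connected quasi-Hessian manifold, and let $\mathcal{D}:M\times M\to\mathbb{R}$ be its canonical divergence. Let $S$ be a submanifold of $M$. (1) Let $c_m:[0,1]\to M$ be an $m$-curve with $q=c_m(1)\in S$ and put $p=c_m(0)\in M$. Then $c_m$ and $S$ are orthogonal at $q$ if and only if $q$ is a critical point of the function $F=\mathcal{D}(-,p):S\to\mathbb{R}$. (2) Likewise, let $c_e:[0,1]\to M$ be an $e$-curve with $q=c_e(1)\in S$ and put $p=c_e(0)\in M$. Then $c_e$ and $S$ are orthogonal at $q$ if and only if $q$ is a critical point of the function $F=\mathcal{D}(p,-):S\to\mathbb{R}$.
   Context: All manifolds and maps are $C^\infty$. $\mathbb{R}^{2n+1}$ has coordinates $(\boldsymbol{x},\boldsymbol{p},z)$ with $\boldsymbol{x},\boldsymbol{p}\in\mathbb{R}^n$ (column vectors), $z\in\mathbb{R}$, contact form $\theta=dz-\sum_i p_i\,dx_i$, and $z':=\boldsymbol{p}^T\boldsymbol{x}-z$. A Legendre submanifold is an $n$-dimensional submanifold $L$ with $\theta|_{TL}=0$. The $e$- and $m$-Lagrange maps of $L$ are $\pi^e_1:L\to\mathbb{R}^n$, $q\mapsto\boldsymbol{x}(q)$, and $\pi^m_1:L\to\mathbb{R}^n$, $q\mapsto\boldsymbol{p}(q)$. Affine Legendre equivalence: an affine map $\mathcal{L}_F(\boldsymbol{x},\boldsymbol{p},z)=(A\boldsymbol{x}+\boldsymbol{b},\,A'\boldsymbol{p}+\boldsymbol{b}',\,z+\boldsymbol{c}^T\boldsymbol{x}+d)$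 with $A\in GL_n(\mathbb{R})$, $A'=(A^T)^{-1}$, $\boldsymbol{b}'=A'\boldsymbol{c}$, $\boldsymbol{b},\boldsymbol{c}\in\mathbb{R}^n$, $d\in\mathbb{R}$; it preserves $\theta$. Coherent tangent bundles of $L$: $E=\{(q,w)\in L\times(\mathbb{R}^n_{\boldsymbol{x}}\times\mathbb{R}_z): dz(w)-\boldsymbol{p}(q)^Td\boldsymbol{x}(w)=0\}$ and $E'=\{(q,w)\in L\times(\mathbb{R}^n_{\boldsymbol{p}}\times\mathbb{R}_{z'}): dz'(w)-\boldsymbol{x}(q)^Td\boldsymbol{p}(w)=0\}$, with bundle maps $\Phi:TL\to E$, $\Phi':TL\to E'$ the differentials of $q\mapsto(\boldsymbol{x}(q),z(q))$ and $q\mapsto(\boldsymbol{p}(q),z'(q))$, and with the flat connections $\nabla^E,\nabla^{E'}$ for which the frames $s_i=\frac{\partial}{\partial x_i}+p_i\frac{\partial}{\partial z}$ of $E$ and $s_i^*=\frac{\partial}{\partial p_i}+x_i\frac{\partial}{\partial z'}$ of $E'$ are flat. Quasi-Hessian manifold: an $n$-dimensional Hausdorff manifold $M$ obtained by gluing countably many Legendre submanifolds $L_\alpha\subset\mathbb{R}^{2n+1}$ (local models) along open subsets $L_{\alpha\beta}\subset L_\alpha$ by diffeomorphisms $\mathcal{L}_\alpha^\beta:L_{\alpha\beta}\to L_{\beta\alpha}$ which on each connected component of $L_{\alpha\beta}$ are given by an affine Legendre equivalence of $\mathbb{R}^{2n+1}$ and which satisfy $\mathcal{L}_\alpha^\gamma=\mathcal{L}_\beta^\gamma\circ\mathcal{L}_\alpha^\beta$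 on $L_{\alpha\beta}\cap L_{\alpha\gamma}$ (the affine Legendre equivalences are part of the gluing data and the cocycle condition is understood for them). The data $(E,\nabla^E,\Phi)$, $(E',\nabla^{E'},\Phi')$ of the local models glue to data on $M$. Canonical divergence of a Legendre submanifold $L$: $\mathcal{D}_L(p,q)=z(p)+z'(q)-\boldsymbol{x}(p)^T\boldsymbol{p}(q)$, $p,q\in L$. It is invariant under affine Legendre equivalence. For a quasi-Hessian $M$, set $\mathcal{D}_M(p,q)=\mathcal{D}_{L_\alpha}(p,q)$ for $p,q$ in a common local model $L_\alpha$; this gives a function near the diagonal. If $M$ is connected and simply connected it extends to $M\times M$: continuing one local model along paths by means of the gluing affine Legendre equivalences yields a map $(\boldsymbol{x},\boldsymbol{p},z):M\to\mathbb{R}^{2n+1}$ which locally is a local model composed with an affine Legendre equivalence (unique up to a global affine Legendre equivalence), and $\mathcal{D}_M(p,q)=z(p)+z'(q)-\boldsymbol{x}(p)^T\boldsymbol{p}(q)$. $m$-curve: an immersed curve $c:I\to M$ ($I$ an interval, $\dot c(t)\neq0$) such that at every $t\in I$ the vectors $\Phi'\circ\dot c(t),\ \nabla^{E'}_{\dot c}(\Phi'\circ\dot c)(t),\ (\nabla^{E'}_{\dot c})^2(\Phi'\circ\dot c)(t),\dots$ of $E'_{c(t)}$ are not simultaneously zero and any two of them are linearly dependent. (In a local model these vectors correspond to the successive derivatives $\dot{\boldsymbol{p}}(t),\ddot{\boldsymbol{p}}(t),\dots$ of $\boldsymbol{p}(t)=\pi^m_1\circ c(t)$, and $\boldsymbol{p}(t)$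 moves on a straight line in $\mathbb{R}^n_{\boldsymbol{p}}$.) An $e$-curve is defined in the same way with $\Phi,E,\nabla^E$ (and $\boldsymbol{x}(t)=\pi^e_1\circ c(t)$). A curve on $[0,1]$ is an $e/m$-curve if it is the restriction of one defined on an open interval containing $[0,1]$. In a local model, $\boldsymbol{m}\neq0$ denotes a direction vector of the line containing the image of an $m$-curve $c_m$ under $\pi^m_1$, and $\boldsymbol{e}\neq0$ a direction vector of the line containing the image of an $e$-curve $c_e$ under $\pi^e_1$. Orthogonality: if $c_m$ meets $S$ at $q\in S$, then $c_m$ and $S$ are orthogonal at $q$ if $\boldsymbol{m}^Td\boldsymbol{x}(u)=0$ for all $u\in T_qS$, where $(\boldsymbol{x},\boldsymbol{p},z)$ are the coordinates of $\mathbb{R}^{2n+1}$ for a local model containing $q$. Similarly $c_e$ and $S$ are orthogonal at $q$ if $\boldsymbol{e}^Td\boldsymbol{p}(u)=0$ for all $u\in T_qS$. These conditions do not depend on the choices.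
   Formalization: Orthogonal implies critical is proved without restriction; the converse is false if the curve's ends share the same p-coordinate (part 1) or x-coordinate (part 2), e.g. L=(s,s²,s³/3), c_m(t)=L(2t−1), S=L, so the equivalence is stated only when those coordinates of p and q differ. *)

theory Defs
  imports "HOL-Analysis.Analysis"
begin

section \<open>Smooth maps and embedded submanifolds of Euclidean space\<close>

primrec Ck_on :: "nat \<Rightarrow> 'a::real_normed_vector set \<Rightarrow> ('a \<Rightarrow> 'b::real_normed_vector) \<Rightarrow> bool" where
  "Ck_on 0 U f \<longleftrightarrow> continuous_on U f"
| "Ck_on (Suc k) U f \<longleftrightarrow>
     (\<forall>x\<in>U. f differentiable (at x)) \<and> (\<forall>v. Ck_on k U (\<lambda>x. frechet_derivative f (at x) v))"

text \<open>Only meant for open \<open>U\<close>.\<close>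

definition smooth_on :: "'a::real_normed_vector set \<Rightarrow> ('a \<Rightarrow> 'b::real_normed_vector) \<Rightarrow> bool" where
  "smooth_on U f \<longleftrightarrow> (\<forall>k. Ck_on k U f)"

text \<open>Smoothness on an arbitrary subset: local smooth extensions exist.\<close>

definition smooth_map :: "'a::real_normed_vector set \<Rightarrow> ('a \<Rightarrow> 'b::real_normed_vector) \<Rightarrow> bool" where
  "smooth_map A f \<longleftrightarrow>
     (\<forall>x\<in>A. \<exists>U g. open U \<and> x \<in> U \<and> smooth_on U g \<and> (\<forall>y\<in>A \<inter> U. g y = f y))"

definition diffeomorphism :: "'a::real_normed_vector set \<Rightarrow> 'b::real_normed_vector set \<Rightarrow> ('a \<Rightarrow> 'b) \<Rightarrow> bool" where
  "diffeomorphism A B f \<longleftrightarrow> bij_betw f A B \<and> smooth_map A f \<and> smooth_map B (inv_into A f)"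

text \<open>Embedded (not necessarily closed) submanifolds, by charts that flatten \<open>A\<close>.\<close>

definition submanifold :: "nat \<Rightarrow> 'a::euclidean_space set \<Rightarrow> bool" where
  "submanifold k A \<longleftrightarrow>
     (\<forall>x\<in>A. \<exists>U (V :: 'a set) \<phi> \<psi> T.
        open U \<and> open V \<and> x \<in> U \<and> homeomorphism U V \<phi> \<psi> \<and> smooth_on U \<phi> \<and> smooth_on V \<psi> \<and>
        subspace T \<and> dim T = k \<and> \<phi> ` (A \<inter> U) = T \<inter> V)"

definition tangent_space :: "'a::euclidean_space set \<Rightarrow> 'a \<Rightarrow> 'a set" where
  "tangent_space A x =
     {v. \<exists>\<epsilon>>0. \<exists>\<gamma>. smooth_on {-\<epsilon><..<\<epsilon>} \<gamma> \<and> \<gamma> ` {-\<epsilon><..<\<epsilon>} \<subseteq> A \<and> \<gamma> 0 = x \<and>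
                  (\<gamma> has_vector_derivative v) (at (0::real))}"


section \<open>The contact space and its Legendre submanifolds\<close>

text \<open>Points of \<open>\<real>\<^sup>2\<^sup>n\<^sup>+\<^sup>1\<close> are triples \<open>(x, p, z)\<close>, where \<open>n = CARD('n)\<close>; the same type serves
  for tangent vectors, on which \<open>xc\<close>, \<open>pc\<close>, \<open>zc\<close> are the forms \<open>dx\<close>, \<open>dp\<close>, \<open>dz\<close>.\<close>

type_synonym 'n jet = "(real^'n) \<times> (real^'n) \<times> real"

definition xc :: "'n::finite jet \<Rightarrow> real^'n" where "xc q = fst q"
definition pc :: "'n::finite jet \<Rightarrow> real^'n" where "pc q = fst (snd q)"
definition zc :: "'n::finite jet \<Rightarrow> real" where "zc q = snd (snd q)"
definition zc' :: "'n::finite jet \<Rightarrow> real" where "zc' q = pc q \<bullet> xc q - zc q"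

definition contact_form :: "'n::finite jet \<Rightarrow> 'n jet \<Rightarrow> real" where
  "contact_form q v = zc v - pc q \<bullet> xc v"

definition legendre_submanifold :: "'n::finite jet set \<Rightarrow> bool" where
  "legendre_submanifold L \<longleftrightarrow>
     submanifold CARD('n) L \<and> (\<forall>q\<in>L. \<forall>v\<in>tangent_space L q. contact_form q v = 0)"

definition affine_legendre :: "('n::finite jet \<Rightarrow> 'n jet) \<Rightarrow> bool" where
  "affine_legendre F \<longleftrightarrow>
     (\<exists>(A::real^'n^'n) b c d. invertible A \<and>
        F = (\<lambda>(x, p, z). (A *v x + b,
                          matrix_inv (transpose A) *v p + matrix_inv (transpose A) *v c,
                          z + c \<bullet> x + d)))"

definition divergence :: "'n::finite jet \<Rightarrow> 'n jet \<Rightarrow> real" where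
  "divergence p q = zc p + zc' q - xc p \<bullet> pc q"


section \<open>The coherent tangent bundles\<close>

text \<open>Fibres over \<open>q\<close>, the bundle maps, and the frames declared to be flat;
  \<open>E\<close> lives in \<open>\<real>\<^sup>n\<^sub>x \<times> \<real>\<^sub>z\<close> and \<open>E'\<close> in \<open>\<real>\<^sup>n\<^sub>p \<times> \<real>\<^sub>z\<^sub>'\<close>.\<close>

definition fibre_E :: "'n::finite jet \<Rightarrow> ((real^'n) \<times> real) set" where
  "fibre_E q = {w. snd w - pc q \<bullet> fst w = 0}"

definition fibre_E' :: "'n::finite jet \<Rightarrow> ((real^'n) \<times> real) set" where
  "fibre_E' q = {w. snd w - xc q \<bullet> fst w = 0}"

definition Phi :: "'n::finite jet \<Rightarrow> 'n jet \<Rightarrow> (real^'n) \<times> real" where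
  "Phi q = frechet_derivative (\<lambda>q. (xc q, zc q)) (at q)"

definition Phi' :: "'n::finite jet \<Rightarrow> 'n jet \<Rightarrow> (real^'n) \<times> real" where
  "Phi' q = frechet_derivative (\<lambda>q. (pc q, zc' q)) (at q)"

definition frame_E :: "'n::finite \<Rightarrow> 'n jet \<Rightarrow> (real^'n) \<times> real" where
  "frame_E i q = (axis i 1, pc q $ i)"

definition frame_E' :: "'n::finite \<Rightarrow> 'n jet \<Rightarrow> (real^'n) \<times> real" where
  "frame_E' i q = (axis i 1, xc q $ i)"

lemma span_frame_aux:
  fixes a :: "real^'n::finite"
  shows "span (range (\<lambda>i. (axis i (1::real), a $ i))) = {w. snd w - a \<bullet> fst w = 0}" (is "span ?R = ?T")
proof
  have "subspace ?T"
    by (auto simp: subspace_def inner_add_right algebra_simps)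
  moreover have "?R \<subseteq> ?T" by (auto simp: inner_axis)
  ultimately show "span ?R \<subseteq> ?T" by (rule span_minimal[rotated])
next
  show "?T \<subseteq> span ?R"
  proof
    fix w :: "(real^'n) \<times> real" assume "w \<in> ?T"
    then have w: "snd w = a \<bullet> fst w" by simp
    have "w = (\<Sum>i\<in>UNIV. (fst w $ i) *\<^sub>R (axis i (1::real), a $ i))"
    proof (rule prod_eqI)
      show "fst w = fst (\<Sum>i\<in>UNIV. (fst w $ i) *\<^sub>R (axis i (1::real), a $ i))"
        by (simp add: fst_sum vec_eq_iff axis_def if_distrib cong: if_cong)
      show "snd w = snd (\<Sum>i\<in>UNIV. (fst w $ i) *\<^sub>R (axis i (1::real), a $ i))"
        using w by (simp add: snd_sum inner_vec_def mult.commute)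
    qed
    moreover have "\<dots> \<in> span ?R"
      by (intro span_sum span_scale span_base) auto
    ultimately show "w \<in> span ?R" by simp
  qed
qed

lemma span_frame_E: "span (range (\<lambda>i. frame_E i q)) = fibre_E q"
  unfolding frame_E_def fibre_E_def by (rule span_frame_aux)

lemma span_frame_E': "span (range (\<lambda>i. frame_E' i q)) = fibre_E' q"
  unfolding frame_E'_def fibre_E'_def by (rule span_frame_aux)

lemma Phi_eq: "Phi q v = (xc v, zc v)"
proof -
  have "((\<lambda>q. (xc q, zc q)) has_derivative (\<lambda>v. (xc v, zc v))) (at q)"
    unfolding xc_def zc_def by (auto intro!: derivative_eq_intros)
  from fun_cong[OF frechet_derivative_at[OF this], of v] show ?thesis unfolding Phi_def by (rule sym)
qed

lemma Phi'_eq: "Phi' q v = (pc v, pc v \<bullet> xc q + pc q \<bullet> xc v - zc v)"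
proof -
  have "((\<lambda>q. (pc q, zc' q)) has_derivative (\<lambda>v. (pc v, pc v \<bullet> xc q + pc q \<bullet> xc v - zc v))) (at q)"
    unfolding xc_def zc_def pc_def zc'_def
    by (rule derivative_eq_intros refl ext | simp add: inner_commute)+
  from fun_cong[OF frechet_derivative_at[OF this], of v] show ?thesis unfolding Phi'_def by (rule sym)
qed

lemma Phi_in_fibre: "contact_form q v = 0 \<Longrightarrow> Phi q v \<in> fibre_E q"
  by (simp add: Phi_eq fibre_E_def contact_form_def)

lemma Phi'_in_fibre: "contact_form q v = 0 \<Longrightarrow> Phi' q v \<in> fibre_E' q"
  by (simp add: Phi'_eq fibre_E'_def contact_form_def inner_commute)

text \<open>Covariant derivative of a section \<open>\<sigma>\<close> along \<open>\<gamma>\<close>, for the connection in which the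
  frame \<open>fr\<close> is flat: differentiate the components with respect to the frame.\<close>

definition frame_components :: "('n::finite \<Rightarrow> 'n jet \<Rightarrow> (real^'n) \<times> real) \<Rightarrow> 'n jet \<Rightarrow> (real^'n) \<times> real \<Rightarrow> real^'n" where
  "frame_components fr q w = (THE a. w = (\<Sum>i\<in>UNIV. (a $ i) *\<^sub>R fr i q))"

definition nabla :: "('n::finite \<Rightarrow> 'n jet \<Rightarrow> (real^'n) \<times> real) \<Rightarrow> (real \<Rightarrow> 'n jet) \<Rightarrow>
    (real \<Rightarrow> (real^'n) \<times> real) \<Rightarrow> real \<Rightarrow> (real^'n) \<times> real" where
  "nabla fr \<gamma> \<sigma> t =
     (\<Sum>i\<in>UNIV. (vector_derivative (\<lambda>s. frame_components fr (\<gamma> s) (\<sigma> s)) (at t) $ i) *\<^sub>R fr i (\<gamma> t))"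

text \<open>The condition at time \<open>t\<close> that makes an immersed curve \<open>\<gamma>\<close> in a local model an \<open>e\<close>-curve
  (for \<open>frame_E, Phi\<close>) or an \<open>m\<close>-curve (for \<open>frame_E', Phi'\<close>).\<close>

definition straight_at :: "('n::finite \<Rightarrow> 'n jet \<Rightarrow> (real^'n) \<times> real) \<Rightarrow> ('n jet \<Rightarrow> 'n jet \<Rightarrow> (real^'n) \<times> real) \<Rightarrow>
    (real \<Rightarrow> 'n jet) \<Rightarrow> real \<Rightarrow> bool" where
  "straight_at fr P \<gamma> t \<longleftrightarrow>
     (let V = (\<lambda>k. (nabla fr \<gamma> ^^ k) (\<lambda>s. P (\<gamma> s) (vector_derivative \<gamma> (at s))) t)
      in (\<exists>k. V k \<noteq> 0) \<and>
         (\<forall>j k. \<exists>a b. (a \<noteq> 0 \<or> b \<noteq> 0) \<and> a *\<^sub>R V j + b *\<^sub>R V k = 0))"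


section \<open>Quasi-Hessian manifolds\<close>

text \<open>Gluing data: local models \<open>mdl \<alpha>\<close>, open parts \<open>ovl \<alpha> \<beta>\<close> of \<open>mdl \<alpha>\<close>, and for each
  \<open>y\<close> in \<open>ovl \<alpha> \<beta>\<close> the affine Legendre equivalence \<open>equ \<alpha> \<beta> y\<close> attached to the connected
  component of \<open>y\<close>.\<close>

record ('i, 'n) gluing =
  idx :: "'i set"
  mdl :: "'i \<Rightarrow> ((real^'n) \<times> (real^'n) \<times> real) set"
  ovl :: "'i \<Rightarrow> 'i \<Rightarrow> ((real^'n) \<times> (real^'n) \<times> real) set"
  equ :: "'i \<Rightarrow> 'i \<Rightarrow> (real^'n) \<times> (real^'n) \<times> real \<Rightarrow>
            (real^'n) \<times> (real^'n) \<times> real \<Rightarrow> (real^'n) \<times> (real^'n) \<times> real"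

definition glue_map :: "('i, 'n::finite) gluing \<Rightarrow> 'i \<Rightarrow> 'i \<Rightarrow> 'n jet \<Rightarrow> 'n jet" where
  "glue_map G \<alpha> \<beta> y = equ G \<alpha> \<beta> y y"

definition glue_rel :: "('i, 'n::finite) gluing \<Rightarrow> (('i \<times> 'n jet) \<times> ('i \<times> 'n jet)) set" where
  "glue_rel G = {((\<alpha>, y), (\<beta>, y')). \<alpha> \<in> idx G \<and> \<beta> \<in> idx G \<and> y \<in> ovl G \<alpha> \<beta> \<and> y' = glue_map G \<alpha> \<beta> y}"

definition points :: "('i, 'n::finite) gluing \<Rightarrow> ('i \<times> 'n jet) set set" where
  "points G = Sigma (idx G) (mdl G) // glue_rel G"

definition pt :: "('i, 'n::finite) gluing \<Rightarrow> 'i \<Rightarrow> 'n jet \<Rightarrow> ('i \<times> 'n jet) set" where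
  "pt G \<alpha> y = glue_rel G `` {(\<alpha>, y)}"

text \<open>Quotient topology of the disjoint union of the local models.\<close>

definition glued_topology :: "('i, 'n::finite) gluing \<Rightarrow> ('i \<times> 'n jet) set topology" where
  "glued_topology G = topology (\<lambda>U. U \<subseteq> points G \<and>
     openin (sum_topology (\<lambda>\<alpha>. top_of_set (mdl G \<alpha>)) (idx G))
       {(\<alpha>, y). \<alpha> \<in> idx G \<and> y \<in> mdl G \<alpha> \<and> pt G \<alpha> y \<in> U})"

lemma openin_glued_topology:
  "openin (glued_topology G) U \<longleftrightarrow> U \<subseteq> points G \<and>
     (\<forall>\<alpha>\<in>idx G. openin (top_of_set (mdl G \<alpha>)) {y \<in> mdl G \<alpha>. pt G \<alpha> y \<in> U})"
proof -
  let ?P = "\<lambda>U. U \<subseteq> points G \<and>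
     openin (sum_topology (\<lambda>\<alpha>. top_of_set (mdl G \<alpha>)) (idx G))
       {(\<alpha>, y). \<alpha> \<in> idx G \<and> y \<in> mdl G \<alpha> \<and> pt G \<alpha> y \<in> U}"
  have eq: "?P U \<longleftrightarrow> U \<subseteq> points G \<and>
     (\<forall>\<alpha>\<in>idx G. openin (top_of_set (mdl G \<alpha>)) {y \<in> mdl G \<alpha>. pt G \<alpha> y \<in> U})" for U
    by (auto simp: openin_sum_topology intro!: arg_cong[where f="openin _"] cong: conj_cong)
  have "istopology (\<lambda>U. U \<subseteq> points G \<and>
     (\<forall>\<alpha>\<in>idx G. openin (top_of_set (mdl G \<alpha>)) {y \<in> mdl G \<alpha>. pt G \<alpha> y \<in> U}))"
    unfolding istopology_def
  proof (intro conjI allI impI ballI; (elim conjE)?)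
    fix S T \<alpha>
    assume "\<forall>\<alpha>\<in>idx G. openin (top_of_set (mdl G \<alpha>)) {y \<in> mdl G \<alpha>. pt G \<alpha> y \<in> S}"
      "\<forall>\<alpha>\<in>idx G. openin (top_of_set (mdl G \<alpha>)) {y \<in> mdl G \<alpha>. pt G \<alpha> y \<in> T}" "\<alpha> \<in> idx G"
    then have "openin (top_of_set (mdl G \<alpha>))
        ({y \<in> mdl G \<alpha>. pt G \<alpha> y \<in> S} \<inter> {y \<in> mdl G \<alpha>. pt G \<alpha> y \<in> T})" by blast
    then show "openin (top_of_set (mdl G \<alpha>)) {y \<in> mdl G \<alpha>. pt G \<alpha> y \<in> S \<inter> T}"
      by (rule back_subst[where P="openin _"]) auto
  next
    fix K \<alpha>
    assume "\<forall>U\<in>K. U \<subseteq> points G \<and>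
      (\<forall>\<alpha>\<in>idx G. openin (top_of_set (mdl G \<alpha>)) {y \<in> mdl G \<alpha>. pt G \<alpha> y \<in> U})" "\<alpha> \<in> idx G"
    then have "openin (top_of_set (mdl G \<alpha>)) (\<Union>U\<in>K. {y \<in> mdl G \<alpha>. pt G \<alpha> y \<in> U})" by blast
    then show "openin (top_of_set (mdl G \<alpha>)) {y \<in> mdl G \<alpha>. pt G \<alpha> y \<in> \<Union>K}"
      by (rule back_subst[where P="openin _"]) auto
  qed auto
  then show ?thesis
    unfolding glued_topology_def using eq by (simp add: topology_inverse')
qed

definition quasi_hessian :: "('i, 'n::finite) gluing \<Rightarrow> bool" where
  "quasi_hessian G \<longleftrightarrow>
     countable (idx G) \<and>
     (\<forall>\<alpha>\<in>idx G. legendre_submanifold (mdl G \<alpha>)) \<and>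
     (\<forall>\<alpha>\<in>idx G. ovl G \<alpha> \<alpha> = mdl G \<alpha> \<and> (\<forall>y\<in>mdl G \<alpha>. glue_map G \<alpha> \<alpha> y = y)) \<and>
     (\<forall>\<alpha>\<in>idx G. \<forall>\<beta>\<in>idx G.
        openin (top_of_set (mdl G \<alpha>)) (ovl G \<alpha> \<beta>) \<and>
        diffeomorphism (ovl G \<alpha> \<beta>) (ovl G \<beta> \<alpha>) (glue_map G \<alpha> \<beta>) \<and>
        (\<forall>y\<in>ovl G \<alpha> \<beta>. affine_legendre (equ G \<alpha> \<beta> y) \<and>
           (\<forall>y'\<in>connected_component_set (ovl G \<alpha> \<beta>) y. equ G \<alpha> \<beta> y' = equ G \<alpha> \<beta> y))) \<and>
     (\<forall>\<alpha>\<in>idx G. \<forall>\<beta>\<in>idx G. \<forall>\<gamma>\<in>idx G. \<forall>y\<in>ovl G \<alpha> \<beta> \<inter> ovl G \<alpha> \<gamma>.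
        glue_map G \<alpha> \<beta> y \<in> ovl G \<beta> \<gamma> \<and>
        equ G \<alpha> \<gamma> y = equ G \<beta> \<gamma> (glue_map G \<alpha> \<beta> y) \<circ> equ G \<alpha> \<beta> y) \<and>
     Hausdorff_space (glued_topology G)"

text \<open>A Legendre submanifold \<open>L\<close> regarded as a manifold glued from the single local model \<open>L\<close>.\<close>

definition local_model :: "'i \<Rightarrow> 'n::finite jet set \<Rightarrow> ('i, 'n) gluing" where
  "local_model \<alpha> L = \<lparr>idx = {\<alpha>}, mdl = (\<lambda>_. L), ovl = (\<lambda>_ _. L), equ = (\<lambda>_ _ _. id)\<rparr>"

text \<open>All loops are homotopic as loops, as in the library's \<open>simply_connected\<close>, which only
  covers subsets of a topological type.\<close>

definition simply_connected_space :: "'a topology \<Rightarrow> bool" where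
  "simply_connected_space T \<longleftrightarrow>
     (\<forall>g h. continuous_map (top_of_set {0..1::real}) T g \<and> g 1 = g 0 \<and>
            continuous_map (top_of_set {0..1}) T h \<and> h 1 = h 0 \<longrightarrow>
            homotopic_with (\<lambda>r. r 1 = r 0) (top_of_set {0..1}) T g h)"


section \<open>The canonical divergence\<close>

text \<open>\<open>f = (x, p, z) : M \<rightarrow> \<real>\<^sup>2\<^sup>n\<^sup>+\<^sup>1\<close> is obtained by continuing local models by means of the
  gluing equivalences: near \<open>y\<close> in \<open>mdl \<alpha>\<close> it is the local model followed by the affine
  Legendre equivalence \<open>B \<alpha> y\<close>.\<close>

definition is_development :: "('i, 'n::finite) gluing \<Rightarrow> (('i \<times> 'n jet) set \<Rightarrow> 'n jet) \<Rightarrow> bool" where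
  "is_development G f \<longleftrightarrow>
     (\<exists>B. (\<forall>\<alpha>\<in>idx G. \<forall>y\<in>mdl G \<alpha>.
             affine_legendre (B \<alpha> y) \<and> f (pt G \<alpha> y) = B \<alpha> y y \<and>
             (\<forall>y'\<in>connected_component_set (mdl G \<alpha>) y. B \<alpha> y' = B \<alpha> y)) \<and>
          (\<forall>\<alpha>\<in>idx G. \<forall>\<beta>\<in>idx G. \<forall>y\<in>ovl G \<alpha> \<beta>.
             B \<alpha> y = B \<beta> (glue_map G \<alpha> \<beta> y) \<circ> equ G \<alpha> \<beta> y))"

text \<open>On a connected, simply connected manifold a development exists and is unique up to a
  global affine Legendre equivalence, under which \<open>divergence\<close> is invariant.\<close>

definition development :: "('i, 'n::finite) gluing \<Rightarrow> ('i \<times> 'n jet) set \<Rightarrow> 'n jet" where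
  "development G = (SOME f. is_development G f)"

definition canonical_divergence ::
    "(('i \<times> 'n::finite jet) set \<Rightarrow> 'n jet) \<Rightarrow> ('i \<times> 'n jet) set \<Rightarrow> ('i \<times> 'n jet) set \<Rightarrow> real" where
  "canonical_divergence X p q = divergence (X p) (X q)"


section \<open>Submanifolds, curves and orthogonality\<close>

text \<open>The part of a subset of \<open>M\<close> that lies in a local model, in the coordinates of that model.\<close>

definition local_part :: "('i, 'n::finite) gluing \<Rightarrow> ('i \<times> 'n jet) set set \<Rightarrow> 'i \<Rightarrow> 'n jet set" where
  "local_part G S \<alpha> = {y \<in> mdl G \<alpha>. pt G \<alpha> y \<in> S}"

definition submanifold_of :: "('i, 'n::finite) gluing \<Rightarrow> ('i \<times> 'n jet) set set \<Rightarrow> bool" where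
  "submanifold_of G S \<longleftrightarrow> S \<subseteq> points G \<and> (\<exists>k. \<forall>\<alpha>\<in>idx G. submanifold k (local_part G S \<alpha>))"

definition represents :: "('i, 'n::finite) gluing \<Rightarrow> (real \<Rightarrow> ('i \<times> 'n jet) set) \<Rightarrow> real set \<Rightarrow>
    'i \<Rightarrow> (real \<Rightarrow> 'n jet) \<Rightarrow> bool" where
  "represents G c J \<alpha> \<gamma> \<longleftrightarrow> \<alpha> \<in> idx G \<and> (\<forall>s\<in>J. \<gamma> s \<in> mdl G \<alpha> \<and> c s = pt G \<alpha> (\<gamma> s))"

definition smooth_curve :: "('i, 'n::finite) gluing \<Rightarrow> real set \<Rightarrow> (real \<Rightarrow> ('i \<times> 'n jet) set) \<Rightarrow> bool" where
  "smooth_curve G J c \<longleftrightarrow>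
     (\<forall>t\<in>J. \<exists>\<epsilon>>0. \<exists>\<alpha> \<gamma>. represents G c {t-\<epsilon><..<t+\<epsilon>} \<alpha> \<gamma> \<and> smooth_on {t-\<epsilon><..<t+\<epsilon>} \<gamma>)"

text \<open>\<open>q\<close> is a critical point of \<open>F : S \<rightarrow> \<real>\<close>: the differential of \<open>F\<close>, which takes the velocity
  of a curve \<open>c\<close> in \<open>S\<close> through \<open>q\<close> to the derivative of \<open>F \<circ> c\<close>, vanishes at \<open>q\<close>.\<close>

definition critical_point :: "('i, 'n::finite) gluing \<Rightarrow> ('i \<times> 'n jet) set set \<Rightarrow>
    (('i \<times> 'n jet) set \<Rightarrow> real) \<Rightarrow> ('i \<times> 'n jet) set \<Rightarrow> bool" where
  "critical_point G S F q \<longleftrightarrow> q \<in> S \<and>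
     (\<forall>c. \<forall>\<epsilon>>0. smooth_curve G {-\<epsilon><..<\<epsilon>} c \<and> c ` {-\<epsilon><..<\<epsilon>} \<subseteq> S \<and> c 0 = q \<longrightarrow>
        ((\<lambda>t. F (c t)) has_real_derivative 0) (at 0))"

definition straight_curve :: "('n::finite \<Rightarrow> 'n jet \<Rightarrow> (real^'n) \<times> real) \<Rightarrow> ('n jet \<Rightarrow> 'n jet \<Rightarrow> (real^'n) \<times> real) \<Rightarrow>
    ('i, 'n) gluing \<Rightarrow> real set \<Rightarrow> (real \<Rightarrow> ('i \<times> 'n jet) set) \<Rightarrow> bool" where
  "straight_curve fr P G J c \<longleftrightarrow>
     (\<forall>t\<in>J. \<exists>\<epsilon>>0. \<exists>\<alpha> \<gamma>. represents G c {t-\<epsilon><..<t+\<epsilon>} \<alpha> \<gamma> \<and> smooth_on {t-\<epsilon><..<t+\<epsilon>} \<gamma> \<and>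
        vector_derivative \<gamma> (at t) \<noteq> 0 \<and> straight_at fr P \<gamma> t)"

text \<open>Curves on \<open>[0,1]\<close> are restrictions of curves on a larger open interval.\<close>

definition e_curve :: "('i, 'n::finite) gluing \<Rightarrow> (real \<Rightarrow> ('i \<times> 'n jet) set) \<Rightarrow> bool" where
  "e_curve G c \<longleftrightarrow> (\<exists>J c'. open J \<and> is_interval J \<and> {0..1} \<subseteq> J \<and>
     straight_curve frame_E Phi G J c' \<and> (\<forall>t\<in>{0..1}. c t = c' t))"

definition m_curve :: "('i, 'n::finite) gluing \<Rightarrow> (real \<Rightarrow> ('i \<times> 'n jet) set) \<Rightarrow> bool" where
  "m_curve G c \<longleftrightarrow> (\<exists>J c'. open J \<and> is_interval J \<and> {0..1} \<subseteq> J \<and>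
     straight_curve frame_E' Phi' G J c' \<and> (\<forall>t\<in>{0..1}. c t = c' t))"

text \<open>\<open>d \<noteq> 0\<close> is a direction vector of a line containing the image under \<open>f\<close> of \<open>\<gamma>\<close> on \<open>J\<close>.\<close>

definition line_direction :: "('n::finite jet \<Rightarrow> real^'n) \<Rightarrow> (real \<Rightarrow> 'n jet) \<Rightarrow> real set \<Rightarrow> real^'n \<Rightarrow> bool" where
  "line_direction f \<gamma> J d \<longleftrightarrow> d \<noteq> 0 \<and> (\<exists>a. \<forall>t\<in>J. \<exists>r. f (\<gamma> t) = a + r *\<^sub>R d)"

text \<open>Orthogonality at \<open>c \<tau>\<close> of a curve on \<open>[0,1]\<close>, using a local model containing \<open>c \<tau>\<close> and the
  arc of \<open>c\<close> near \<open>\<tau>\<close> inside it.\<close>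

definition orthogonal_m :: "('i, 'n::finite) gluing \<Rightarrow> (real \<Rightarrow> ('i \<times> 'n jet) set) \<Rightarrow> real \<Rightarrow>
    ('i \<times> 'n jet) set set \<Rightarrow> bool" where
  "orthogonal_m G c \<tau> S \<longleftrightarrow>
     (\<exists>\<epsilon>>0. \<exists>\<alpha> \<gamma> m. represents G c ({\<tau>-\<epsilon><..<\<tau>+\<epsilon>} \<inter> {0..1}) \<alpha> \<gamma> \<and>
        line_direction pc \<gamma> ({\<tau>-\<epsilon><..<\<tau>+\<epsilon>} \<inter> {0..1}) m \<and>
        (\<forall>u\<in>tangent_space (local_part G S \<alpha>) (\<gamma> \<tau>). m \<bullet> xc u = 0))"

definition orthogonal_e :: "('i, 'n::finite) gluing \<Rightarrow> (real \<Rightarrow> ('i \<times> 'n jet) set) \<Rightarrow> real \<Rightarrow>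
    ('i \<times> 'n jet) set set \<Rightarrow> bool" where
  "orthogonal_e G c \<tau> S \<longleftrightarrow>
     (\<exists>\<epsilon>>0. \<exists>\<alpha> \<gamma> e. represents G c ({\<tau>-\<epsilon><..<\<tau>+\<epsilon>} \<inter> {0..1}) \<alpha> \<gamma> \<and>
        line_direction xc \<gamma> ({\<tau>-\<epsilon><..<\<tau>+\<epsilon>} \<inter> {0..1}) e \<and>
        (\<forall>u\<in>tangent_space (local_part G S \<alpha>) (\<gamma> \<tau>). e \<bullet> pc u = 0))"

text \<open>Global coordinates \<open>(x, p, z)\<close> on \<open>M\<close>: those of \<open>\<real>\<^sup>2\<^sup>n\<^sup>+\<^sup>1\<close> if \<open>M\<close> is a local model, the
  development if \<open>M\<close> is connected and simply connected.\<close>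

definition with_coordinates :: "('i, 'n::finite) gluing \<Rightarrow> (('i \<times> 'n jet) set \<Rightarrow> 'n jet) \<Rightarrow> bool" where
  "with_coordinates M X \<longleftrightarrow>
     (\<exists>\<alpha> L. legendre_submanifold L \<and> M = local_model \<alpha> L \<and> (\<forall>y\<in>L. X (pt M \<alpha> y) = y)) \<or>
     (quasi_hessian M \<and> connected_space (glued_topology M) \<and>
      simply_connected_space (glued_topology M) \<and> X = development M)"

end

theory Submission
  imports Defs
begin

text \<open>
  The velocity \<open>u\<close> of a curve in a Legendre submanifold satisfies \<open>dz(u) = p \<bullet> dx(u)\<close>, so the
  differential of \<open>q \<mapsto> divergence q r\<close> on \<open>u\<close> is \<open>(p(q) - p(r)) \<bullet> dx(u)\<close>, and dually that of
  \<open>q \<mapsto> divergence r q\<close> is \<open>(x(q) - x(r)) \<bullet> dp(u)\<close>.  Along an \<open>m\<close>-curve the derivatives of \<open>p\<close> never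
  vanish simultaneously and are pairwise dependent; the first nonvanishing one spans a locally
  constant direction, so \<open>p\<close> moves on a line whose direction \<open>m\<close> is unique even on short arcs.  Hence
  \<open>p(q) - p(r)\<close> is a multiple of \<open>m\<close>, and being critical amounts to \<open>m \<bullet> dx\<close> vanishing on \<open>TS\<close>.

  On a simply connected quasi-Hessian manifold the global coordinates come from a monodromy
  argument: the affine Legendre equivalences form a locally constant cocycle, whose flat sections
  exist along squares by bisection and are therefore single-valued along null-homotopic loops.
\<close>

section \<open>Smooth curves and straight lines\<close>

text \<open>The converse directions assume that the end values of p (respectively x) differ, because
  an m-curve may have dp/dt = 0 at isolated times and turn back on its line. On the Legendre curve
  (t, t^2, t^3/3) with n = 1, the arc from t = -1 to t = 1 is an m-curve with equal end values of p;
  the function D(-,p) formed with its start has zero differential at its end, while m dx does not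
  vanish there. For the same reason no fixed order of derivative gives the direction along the whole
  curve. A second obstacle is that straightness is given time by time, each time in a possibly
  different local model, while the two ends must be compared. The coordinates \<open>X\<close>
  remove it: in each model \<open>X\<close> is locally an affine Legendre equivalence, which acts on
  x and on p by invertible affine maps, so the straightness conditions pass to the single curve of
  \<open>X\<close>-coordinates in \<real>^n. As \<open>development\<close> is a Hilbert choice,
  nothing is known about it until some development has been shown to exist.\<close>

lemma Ck_on_cong_open:
  assumes "open U" "\<And>x. x \<in> U \<Longrightarrow> f x = g x" "Ck_on k U f"
  shows "Ck_on k U g"
  using assms(2,3)
proof (induction k arbitrary: f g)
  case 0
  then show ?case by (simp cong: continuous_on_cong)
next
  case (Suc k)
  have d: "(g has_derivative frechet_derivative f (at x)) (at x)" if "x \<in> U" for x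
  proof -
    have "(f has_derivative frechet_derivative f (at x)) (at x)"
      using Suc.prems(2) that by (simp add: frechet_derivative_works)
    then show ?thesis
      by (rule has_derivative_transform_within_open[OF _ assms(1) that]) (use Suc.prems(1) in auto)
  qed
  then have eq: "frechet_derivative f (at x) = frechet_derivative g (at x)" if "x \<in> U" for x
    using that by (metis frechet_derivative_at)
  show ?case
    using Suc.IH[of "\<lambda>x. frechet_derivative f (at x) v" "\<lambda>x. frechet_derivative g (at x) v" for v]
      Suc.prems(2) d eq by (auto simp: differentiable_def)
qed

lemma Ck_on_subset: "Ck_on k U f \<Longrightarrow> V \<subseteq> U \<Longrightarrow> Ck_on k V f"
  by (induction k arbitrary: f) (auto intro: continuous_on_subset)

lemma smooth_on_subset: "smooth_on U f \<Longrightarrow> V \<subseteq> U \<Longrightarrow> smooth_on V f"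
  unfolding smooth_on_def by (blast intro: Ck_on_subset)

lemma Ck_on_affine:
  assumes "open U" "bounded_linear A" "Ck_on k U f"
  shows "Ck_on k U (\<lambda>x. A (f x) + b)"
  using assms(3)
proof (induction k arbitrary: f b)
  case 0
  then show ?case
    using continuous_on_add[OF bounded_linear.continuous_on[OF assms(2)] continuous_on_const] by simp
next
  case (Suc k)
  have d: "((\<lambda>x. A (f x) + b) has_derivative (\<lambda>v. A (frechet_derivative f (at x) v))) (at x)" if "x \<in> U" for x
  proof -
    have "(f has_derivative frechet_derivative f (at x)) (at x)"
      using Suc.prems that by (simp add: frechet_derivative_works)
    from has_derivative_add[OF bounded_linear.has_derivative[OF assms(2) this] has_derivative_const[of b]]
    show ?thesis by simp
  qed
  have "Ck_on k U (\<lambda>x. frechet_derivative (\<lambda>x. A (f x) + b) (at x) v)" for v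
  proof (rule Ck_on_cong_open[OF assms(1)])
    show "Ck_on k U (\<lambda>x. A (frechet_derivative f (at x) v) + 0)"
      using Suc.prems by (intro Suc.IH) auto
    show "A (frechet_derivative f (at x) v) + 0 = frechet_derivative (\<lambda>x. A (f x) + b) (at x) v"
      if "x \<in> U" for x
      using fun_cong[OF frechet_derivative_at[OF d[OF that]], of v] by simp
  qed
  then show ?case using d by (auto simp: differentiable_def)
qed

lemma smooth_on_affine:
  "open U \<Longrightarrow> bounded_linear A \<Longrightarrow> smooth_on U f \<Longrightarrow> smooth_on U (\<lambda>x. A (f x) + b)"
  unfolding smooth_on_def by (blast intro: Ck_on_affine)

lemma smooth_on_bounded_linear:
  "open U \<Longrightarrow> bounded_linear A \<Longrightarrow> smooth_on U f \<Longrightarrow> smooth_on U (\<lambda>x. A (f x))"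
  using smooth_on_affine[of U A f 0] by simp

lemma Ck_on_shift:
  fixes f :: "'a::real_normed_vector \<Rightarrow> 'b::real_normed_vector"
  assumes "open U" "Ck_on k U f" "open V" "\<And>x. x \<in> V \<Longrightarrow> x + a \<in> U"
  shows "Ck_on k V (\<lambda>x. f (x + a))"
  using assms(2)
proof (induction k arbitrary: f)
  case 0
  then show ?case
    using assms(4) by (auto intro!: continuous_on_compose2[of U f] continuous_intros)
next
  case (Suc k)
  have d: "((\<lambda>x. f (x + a)) has_derivative frechet_derivative f (at (x + a))) (at x)" if "x \<in> V" for x
  proof -
    have "(f has_derivative frechet_derivative f (at (x + a))) (at (x + a))"
      using Suc.prems assms(4)[OF that] by (simp add: frechet_derivative_works)
    moreover have "((\<lambda>x. x + a) has_derivative (\<lambda>v. v)) (at x)"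
      using has_derivative_add[OF has_derivative_ident has_derivative_const[of a]] by simp
    ultimately show ?thesis
      using has_derivative_compose by fastforce
  qed
  have "Ck_on k V (\<lambda>x. frechet_derivative (\<lambda>x. f (x + a)) (at x) v)" for v
  proof (rule Ck_on_cong_open[OF assms(3)])
    show "Ck_on k V (\<lambda>x. frechet_derivative f (at (x + a)) v)"
      using Suc.prems Suc.IH[of "\<lambda>x. frechet_derivative f (at x) v"] by auto
    show "frechet_derivative f (at (x + a)) v = frechet_derivative (\<lambda>x. f (x + a)) (at x) v"
      if "x \<in> V" for x
      using fun_cong[OF frechet_derivative_at[OF d[OF that]], of v] by simp
  qed
  then show ?case using d by (auto simp: differentiable_def)
qed

lemma smooth_on_shift:
  fixes f :: "'a::real_normed_vector \<Rightarrow> 'b::real_normed_vector"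
  shows "open U \<Longrightarrow> smooth_on U f \<Longrightarrow> open V \<Longrightarrow> (\<And>x. x \<in> V \<Longrightarrow> x + a \<in> U) \<Longrightarrow> smooth_on V (\<lambda>x. f (x + a))"
  unfolding smooth_on_def by (blast intro: Ck_on_shift)

lemma smooth_on_imp_continuous_on: "smooth_on U f \<Longrightarrow> continuous_on U f"
  unfolding smooth_on_def by (metis Ck_on.simps(1))

lemma smooth_map_imp_continuous_on:
  assumes "smooth_map A f" shows "continuous_on A f"
  unfolding continuous_on_eq_continuous_within
proof
  fix x assume x: "x \<in> A"
  then obtain U g where U: "open U" "x \<in> U" "smooth_on U g" "\<forall>y\<in>A \<inter> U. g y = f y"
    using assms unfolding smooth_map_def by blast
  have "continuous_on (A \<inter> U) f"
    using continuous_on_subset[OF smooth_on_imp_continuous_on[OF U(3)], of "A \<inter> U"]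
      continuous_on_cong[of "A \<inter> U" "A \<inter> U" g f] U(4) by simp
  then have "continuous (at x within A \<inter> U) f"
    using x U(2) by (simp add: continuous_on_eq_continuous_within)
  moreover have "at x within A \<inter> U = at x within A"
    using U(1,2) at_within_nhd[of x U "A \<inter> U" A] by auto
  ultimately show "continuous (at x within A) f" by (simp add: continuous_within)
qed

text \<open>Differentiation as an operator on curves, so that \<open>vder ^^ k\<close> can be
  matched with the iterates of \<open>nabla\<close>.\<close>

definition vder :: "(real \<Rightarrow> 'a::real_normed_vector) \<Rightarrow> real \<Rightarrow> 'a" where
  "vder h t = vector_derivative h (at t)"

lemma vder_has_vector_derivative: "h differentiable (at t) \<Longrightarrow> (h has_vector_derivative vder h t) (at t)"
  unfolding vder_def by (simp add: vector_derivative_works)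

lemma vder_eqI: "(h has_vector_derivative v) (at t) \<Longrightarrow> vder h t = v"
  unfolding vder_def by (rule vector_derivative_at)

lemma smooth_on_vder:
  fixes h :: "real \<Rightarrow> 'a::real_normed_vector"
  assumes "open I" "smooth_on I h"
  shows "smooth_on I (vder h)"
  unfolding smooth_on_def
proof
  fix k
  have "Ck_on (Suc k) I h" using assms(2) by (simp only: smooth_on_def)
  then have c: "Ck_on k I (\<lambda>x. frechet_derivative h (at x) 1)" and d: "\<And>x. x \<in> I \<Longrightarrow> h differentiable (at x)"
    by auto
  show "Ck_on k I (vder h)"
    by (rule Ck_on_cong_open[OF assms(1) _ c]) (simp add: vder_def frechet_derivative_eq_vector_derivative d)
qed

lemma smooth_on_differentiable: "smooth_on I h \<Longrightarrow> t \<in> I \<Longrightarrow> h differentiable (at t)"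
  unfolding smooth_on_def by (metis Ck_on.simps(2))

lemma smooth_on_vder_iter:
  fixes h :: "real \<Rightarrow> 'a::real_normed_vector"
  assumes "open I" "smooth_on I h" shows "smooth_on I ((vder ^^ k) h)"
  by (induction k) (auto intro: smooth_on_vder assms)

lemma vder_cong_open:
  assumes "open I" "t \<in> I" "\<And>s. s \<in> I \<Longrightarrow> g s = h s"
  shows "vder g t = vder h t"
  unfolding vder_def
  by (rule vector_derivative_cong_eq) (use assms in \<open>auto simp: eventually_nhds\<close>)

lemma vder_iter_cong_open:
  assumes "open I" "t \<in> I" "\<And>s. s \<in> I \<Longrightarrow> g s = h s"
  shows "(vder ^^ k) g t = (vder ^^ k) h t"
  using assms(2)
proof (induction k arbitrary: t)
  case (Suc k)
  then show ?case using vder_cong_open[OF assms(1), of t "(vder ^^ k) g"] by simp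
qed (simp add: assms)

lemma vder_affine:
  assumes "bounded_linear A" "h differentiable (at t)"
  shows "vder (\<lambda>s. A (h s) + b) t = A (vder h t)"
proof -
  have "((\<lambda>s. A (h s) + b) has_vector_derivative A (vder h t) + 0) (at t)"
    by (intro has_vector_derivative_add bounded_linear.has_vector_derivative[OF assms(1)]
        vder_has_vector_derivative assms(2) has_vector_derivative_const)
  then show ?thesis by (intro vder_eqI) simp
qed

lemma vder_iter_affine:
  fixes h :: "real \<Rightarrow> 'a::real_normed_vector"
  assumes "open I" "smooth_on I h" "bounded_linear A" "t \<in> I"
  shows "(vder ^^ k) (vder (\<lambda>s. A (h s) + b)) t = A ((vder ^^ k) (vder h) t)"
  using assms(4)
proof (induction k arbitrary: t)
  case 0
  then show ?case using vder_affine[OF assms(3) smooth_on_differentiable[OF assms(2)]] by simp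
next
  case (Suc k)
  have "(vder ^^ Suc k) (vder (\<lambda>s. A (h s) + b)) t = vder (\<lambda>s. A ((vder ^^ k) (vder h) s) + 0) t"
    using vder_cong_open[OF assms(1) Suc.prems, of "(vder ^^ k) (vder (\<lambda>s. A (h s) + b))"] Suc.IH by simp
  also have "\<dots> = A ((vder ^^ Suc k) (vder h) t)"
    using vder_affine[OF assms(3) smooth_on_differentiable[OF smooth_on_vder_iter[OF assms(1)
      smooth_on_vder[OF assms(1,2)]] Suc.prems], of k 0] by simp
  finally show ?case .
qed

lemma vder_iter_const: "(vder ^^ k) (vder (\<lambda>_. c)) t = 0"
proof -
  have z: "vder (\<lambda>_. c') = (\<lambda>_. 0)" for c' :: 'a
    by (rule ext, rule vder_eqI) (rule has_vector_derivative_const)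
  have "(vder ^^ k) (\<lambda>_. 0) = (\<lambda>_. 0 :: 'a)" by (induction k) (auto simp: z)
  then show ?thesis by (simp add: z)
qed

text \<open>Curves in the glued space come with a separate representation near each time, so
  smoothness of their coordinates is only known near each time.\<close>

definition smooth_at :: "(real \<Rightarrow> 'a::real_normed_vector) \<Rightarrow> real \<Rightarrow> bool" where
  "smooth_at h t \<longleftrightarrow> (\<exists>I. open I \<and> t \<in> I \<and> smooth_on I h)"

lemma smooth_at_vder_iter: "smooth_at h t \<Longrightarrow> smooth_at ((vder ^^ k) h) t"
  unfolding smooth_at_def by (blast intro: smooth_on_vder_iter)

lemma smooth_at_differentiable: "smooth_at h t \<Longrightarrow> h differentiable (at t)"
  unfolding smooth_at_def by (blast intro: smooth_on_differentiable)

section \<open>Curves whose successive derivatives stay on one line\<close>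

definition dependent_pair :: "'a::real_vector \<Rightarrow> 'a \<Rightarrow> bool" where
  "dependent_pair v w \<longleftrightarrow> (\<exists>a b. (a \<noteq> 0 \<or> b \<noteq> 0) \<and> a *\<^sub>R v + b *\<^sub>R w = 0)"

lemma dependent_pair_span:
  assumes "dependent_pair v w" "w \<noteq> 0" shows "v \<in> span {w}"
proof -
  obtain a b where ab: "a \<noteq> 0 \<or> b \<noteq> 0" "a *\<^sub>R v + b *\<^sub>R w = 0"
    using assms(1) unfolding dependent_pair_def by blast
  with assms(2) have "a \<noteq> 0" by auto
  have "a *\<^sub>R v = - b *\<^sub>R w" using ab(2) by (simp add: eq_neg_iff_add_eq_0)
  then have "(1 / a) *\<^sub>R a *\<^sub>R v = (1 / a) *\<^sub>R - b *\<^sub>R w" by simp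
  then have "v = (1 / a) *\<^sub>R - b *\<^sub>R w" using \<open>a \<noteq> 0\<close> by simp
  moreover have "(1 / a) *\<^sub>R - b *\<^sub>R w \<in> span {w}" by (intro span_scale span_base) simp
  ultimately show ?thesis by simp
qed

lemma span_singleton_eq:
  assumes "v \<in> span {w}" "v \<noteq> 0" shows "span {v} = span {w}"
proof -
  obtain r where r: "v = r *\<^sub>R w" using assms(1) by (auto simp: span_singleton)
  then have "r \<noteq> 0" using assms(2) by auto
  then have "w = (1/r) *\<^sub>R v" using r by simp
  moreover have "(1/r) *\<^sub>R v \<in> span {v}" by (simp add: span_base span_scale)
  ultimately have "w \<in> span {v}" by simp
  then show ?thesis using assms(1) by (simp add: span_eq)
qed

text \<open>Dividing \<open>W\<close> by its component along \<open>W t0\<close> cancels the factor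
  \<open>l\<close>: the quotient has zero derivative. An integrating factor would require regularity
  of \<open>l\<close>, which is only chosen pointwise.\<close>

lemma direction_locally_constant:
  fixes W :: "real \<Rightarrow> 'a::real_inner"
  assumes "open I" "is_interval I" "t0 \<in> I"
    and d: "\<And>t. t \<in> I \<Longrightarrow> (W has_vector_derivative l t *\<^sub>R W t) (at t)"
    and pos: "\<And>t. t \<in> I \<Longrightarrow> W t \<bullet> W t0 \<noteq> 0"
    and t: "t \<in> I"
  shows "W t \<in> span {W t0}"
proof -
  let ?Q = "\<lambda>t. (1 / (W t \<bullet> W t0)) *\<^sub>R W t"
  have "(?Q has_vector_derivative 0) (at t within I)" if t: "t \<in> I" for t
  proof -
    have "((\<lambda>t. W t \<bullet> W t0) has_vector_derivative (l t *\<^sub>R W t) \<bullet> W t0) (at t)"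
      by (rule bounded_linear.has_vector_derivative[OF bounded_linear_inner_left d[OF t]])
    then have r: "((\<lambda>t. 1 / (W t \<bullet> W t0)) has_real_derivative - (l t / (W t \<bullet> W t0))) (at t)"
    proof -
      assume "((\<lambda>t. W t \<bullet> W t0) has_vector_derivative (l t *\<^sub>R W t) \<bullet> W t0) (at t)"
      then have "((\<lambda>t. W t \<bullet> W t0) has_real_derivative (l t *\<^sub>R W t) \<bullet> W t0) (at t)"
        by (simp only: has_real_derivative_iff_has_vector_derivative)
      from DERIV_inverse_fun[OF this pos[OF t]]
      have "((\<lambda>t. inverse (W t \<bullet> W t0)) has_real_derivative - (l t / (W t \<bullet> W t0))) (at t)"
        by (rule DERIV_cong) (use pos[OF t] in \<open>simp add: field_simps power2_eq_square\<close>)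
      then show ?thesis by (simp add: inverse_eq_divide)
    qed
    have "(?Q has_vector_derivative (1 / (W t \<bullet> W t0)) *\<^sub>R (l t *\<^sub>R W t)
        + (- (l t / (W t \<bullet> W t0))) *\<^sub>R W t) (at t)"
      by (rule has_vector_derivative_scaleR[OF r d[OF t]])
    then show ?thesis
      by (simp add: has_vector_derivative_at_within)
  qed
  then obtain c where c: "\<And>t. t \<in> I \<Longrightarrow> ?Q t = c"
    using has_vector_derivative_zero_constant[OF is_interval_convex[OF assms(2)], of ?Q] by blast
  have "(W t \<bullet> W t0) *\<^sub>R ?Q t = (W t \<bullet> W t0) *\<^sub>R ?Q t0"
    using c[OF t] c[OF assms(3)] by simp
  then have "W t = (W t \<bullet> W t0) *\<^sub>R ?Q t0" using pos[OF t] by simp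
  also have "\<dots> \<in> span {W t0}" by (intro span_scale span_base) simp
  finally show ?thesis .
qed

text \<open>Near each time some order k has a nonvanishing derivative, but k may change from place
  to place. The claim therefore speaks of all derivatives at once; where two candidate lines meet at
  a common time, a nonzero derivative there identifies them, and connectedness of \<open>J\<close>
  does the rest.\<close>

lemma dependent_derivatives_direction:
  fixes W :: "real \<Rightarrow> 'a::real_inner"
  assumes J: "open J" "is_interval J"
    and smooth: "\<And>t. t \<in> J \<Longrightarrow> smooth_at W t"
    and nz: "\<And>t. t \<in> J \<Longrightarrow> \<exists>k. (vder ^^ k) W t \<noteq> 0"
    and dep: "\<And>t j k. t \<in> J \<Longrightarrow> dependent_pair ((vder ^^ j) W t) ((vder ^^ k) W t)"
    and t0: "t0 \<in> J"
  obtains d where "d \<noteq> 0" "\<And>t k. t \<in> J \<Longrightarrow> (vder ^^ k) W t \<in> span {d}"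
proof -
  have loc: "\<exists>I e. open I \<and> t1 \<in> I \<and> I \<subseteq> J \<and> e \<noteq> 0 \<and> (\<forall>t\<in>I. \<forall>j. (vder ^^ j) W t \<in> span {e})"
    if t1: "t1 \<in> J" for t1
  proof -
    obtain k where k: "(vder ^^ k) W t1 \<noteq> 0" using nz[OF t1] by blast
    let ?V = "(vder ^^ k) W"
    have der: "(?V has_vector_derivative (vder ^^ Suc k) W t) (at t)" if "t \<in> J" for t
      using vder_has_vector_derivative[OF smooth_at_differentiable[OF smooth_at_vder_iter[OF smooth[OF that]]]]
      by simp
    \<comment> \<open>A nonzero inner product with the value at \<open>t1\<close> keeps
      \<open>?V\<close> away from zero and is also the normalising factor that
      \<open>direction_locally_constant\<close> needs.\<close>
    have "continuous (at t1) (\<lambda>t. ?V t \<bullet> ?V t1)"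
      using has_vector_derivative_continuous[OF der[OF t1]] by (intro continuous_intros)
    then obtain e where e: "e > 0" "\<And>y. dist t1 y < e \<Longrightarrow> ?V y \<bullet> ?V t1 \<noteq> 0"
      using continuous_at_avoid[of t1 "\<lambda>t. ?V t \<bullet> ?V t1" 0] k by auto
    obtain e' where e': "e' > 0" "ball t1 e' \<subseteq> J"
      using J(1) t1 open_contains_ball by blast
    define I where "I = ball t1 (min e e')"
    have I: "open I" "t1 \<in> I" "I \<subseteq> J" "is_interval I"
      using e e' by (auto simp: I_def is_interval_convex_1)
    have nzI: "?V t \<bullet> ?V t1 \<noteq> 0" if "t \<in> I" for t using e(2) that by (simp add: I_def)
    then have nzI': "?V t \<noteq> 0" if "t \<in> I" for t using that by force
    \<comment> \<open>Dependence of the orders k and k + 1 at every time of \<open>I\<close> is the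
      differential equation V' = l V.\<close>
    have "\<exists>l. (vder ^^ Suc k) W t = l *\<^sub>R ?V t" if "t \<in> I" for t
      using dependent_pair_span[OF dep nzI'[OF that], of "Suc k"] that I(3) by (auto simp: span_singleton)
    then obtain l where l: "\<And>t. t \<in> I \<Longrightarrow> (vder ^^ Suc k) W t = l t *\<^sub>R ?V t" by metis
    have Vt: "?V t \<in> span {?V t1}" if t: "t \<in> I" for t
    proof (rule direction_locally_constant[where W = ?V and l = l, OF I(1,4,2)])
      show "(?V has_vector_derivative l s *\<^sub>R ?V s) (at s)" if "s \<in> I" for s
        using der[of s] l[OF that] that I(3) by (auto simp del: funpow.simps)
    qed (use nzI t in auto)
    have "(vder ^^ j) W t \<in> span {?V t1}" if t: "t \<in> I" for t j
      using dependent_pair_span[OF dep nzI'[OF t], of j] span_singleton_eq[OF Vt nzI', OF t t] t I(3) by auto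
    then show ?thesis using I k by blast
  qed
  obtain d where d: "d \<noteq> 0" "\<And>j. (vder ^^ j) W t0 \<in> span {d}" using loc[OF t0] by blast
  have "\<forall>j. (vder ^^ j) W t \<in> span {d}" if "t \<in> J" for t
  proof (rule connected_induction_simple[where P = "\<lambda>t. \<forall>j. (vder ^^ j) W t \<in> span {d}"])
    show "connected J" using J(2) is_interval_connected by blast
    show "t0 \<in> J" "t \<in> J" by fact+
    show "\<forall>j. (vder ^^ j) W t0 \<in> span {d}" using d by blast
    fix a assume a: "a \<in> J"
    then obtain I e where I: "open I" "a \<in> I" "I \<subseteq> J" "e \<noteq> 0" "\<forall>t\<in>I. \<forall>j. (vder ^^ j) W t \<in> span {e}"
      using loc[OF a] by blast
    have "\<forall>j. (vder ^^ j) W y \<in> span {d}"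
      if x: "x \<in> I" "\<forall>j. (vder ^^ j) W x \<in> span {d}" and y: "y \<in> I" for x y
    proof -
      obtain k where "(vder ^^ k) W x \<noteq> 0" using nz x(1) I(3) by blast
      then have "span {d} = span {e}"
        using span_singleton_eq[of "(vder ^^ k) W x" d] span_singleton_eq[of "(vder ^^ k) W x" e] x I(5) by simp
      then show ?thesis using y I(5) by blast
    qed
    then show "\<exists>T. openin (top_of_set J) T \<and> a \<in> T \<and>
        (\<forall>x\<in>T. \<forall>y\<in>T. (\<forall>j. (vder ^^ j) W x \<in> span {d}) \<longrightarrow> (\<forall>j. (vder ^^ j) W y \<in> span {d}))"
      using I(2) open_subset[OF I(3,1)] by blast
  qed
  then show thesis using that d by blast
qed

text \<open>After orthogonal projection along \<open>d\<close> onto its complement, the curve has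
  zero derivative and is constant.\<close>

lemma derivative_in_span_imp_diff_in_span:
  fixes h :: "real \<Rightarrow> 'a::real_inner"
  assumes J: "is_interval J" and d: "d \<noteq> 0"
    and der: "\<And>t. t \<in> J \<Longrightarrow> (h has_vector_derivative v t) (at t)" "\<And>t. t \<in> J \<Longrightarrow> v t \<in> span {d}"
    and st: "s \<in> J" "t \<in> J"
  shows "h s - h t \<in> span {d}"
proof -
  define \<pi> where "\<pi> w = w - ((w \<bullet> d) / (d \<bullet> d)) *\<^sub>R d" for w
  have bl: "bounded_linear \<pi>"
    unfolding \<pi>_def divide_inverse
    by (rule bounded_linear_sub[OF bounded_linear_ident
        bounded_linear_scaleR_const[OF bounded_linear_mult_const[OF bounded_linear_inner_left]]])
  have "\<pi> (v t) = 0" if "t \<in> J" for t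
    using der(2)[OF that] d by (auto simp: span_singleton \<pi>_def)
  then have "((\<lambda>t. \<pi> (h t)) has_vector_derivative 0) (at t within J)" if "t \<in> J" for t
    using bounded_linear.has_vector_derivative[OF bl has_vector_derivative_at_within[OF der(1)[OF that]]] that
    by simp
  then obtain c where "\<And>t. t \<in> J \<Longrightarrow> \<pi> (h t) = c"
    using has_vector_derivative_zero_constant[OF is_interval_convex[OF J]] by blast
  then have "\<pi> (h s - h t) = 0"
    using st by (simp add: linear_diff[OF bounded_linear.linear[OF bl]])
  then have "h s - h t = (((h s - h t) \<bullet> d) / (d \<bullet> d)) *\<^sub>R d" by (simp add: \<pi>_def)
  also have "\<dots> \<in> span {d}" by (intro span_scale span_base) simp
  finally show ?thesis .
qed

section \<open>Local systems on simply connected spaces\<close>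

lemma pathin_join:
  assumes "pathin T g" "pathin T h" "g 1 = h 0"
  shows "pathin T (\<lambda>t. if t \<le> 1/2 then g (2 * t) else h (2 * t - 1))"
proof -
  let ?I = "top_of_set {0..1::real}"
  have "continuous_map ?I T (\<lambda>t. if t \<le> 1/2 then (g \<circ> (\<lambda>t. 2 * t)) t else (h \<circ> (\<lambda>t. 2 * t - 1)) t)"
  proof (rule continuous_map_cases_le)
    have "continuous_map (subtopology ?I {t \<in> topspace ?I. t \<le> 1/2}) ?I (\<lambda>t. 2 * t)"
      by (auto simp: subtopology_subtopology intro!: continuous_intros)
    then show "continuous_map (subtopology ?I {t \<in> topspace ?I. t \<le> 1/2}) T (g \<circ> (\<lambda>t. 2 * t))"
      using assms(1) continuous_map_compose unfolding pathin_def by blast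
    have "continuous_map (subtopology ?I {t \<in> topspace ?I. 1/2 \<le> t}) ?I (\<lambda>t. 2 * t - 1)"
      by (auto simp: subtopology_subtopology intro!: continuous_intros)
    then show "continuous_map (subtopology ?I {t \<in> topspace ?I. 1/2 \<le> t}) T (h \<circ> (\<lambda>t. 2 * t - 1))"
      using assms(2) continuous_map_compose unfolding pathin_def by blast
    show "(g \<circ> (\<lambda>t. 2 * t)) t = (h \<circ> (\<lambda>t. 2 * t - 1)) t" if "t = 1/2" for t
      unfolding that using assms(3) by simp
  qed auto
  then show ?thesis by (simp only: pathin_def o_def)
qed

lemma pathin_reverse:
  assumes "pathin T g" shows "pathin T (\<lambda>t. g (1 - t))"
proof -
  have "continuous_map (top_of_set {0..1}) (top_of_set {0..1::real}) (\<lambda>t. 1 - t)"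
    by (auto intro!: continuous_intros)
  then show ?thesis
    using assms continuous_map_compose[of "top_of_set {0..1}" "top_of_set {0..1}" "\<lambda>t. 1 - t" T g]
    by (simp add: pathin_def o_def)
qed

text \<open>\<open>U\<close> covers the space by patches and \<open>\<tau> k l\<close> is the locally constant transition from patch \<open>k\<close> to
  patch \<open>l\<close>, with values in the group \<open>Grp\<close> of transformations of \<open>'v\<close>.\<close>

locale local_system =
  fixes T :: "'a topology" and K :: "'k set" and U :: "'k \<Rightarrow> 'a set"
    and \<tau> :: "'k \<Rightarrow> 'k \<Rightarrow> 'a \<Rightarrow> 'v \<Rightarrow> 'v" and Grp :: "('v \<Rightarrow> 'v) set"
  assumes cover: "\<And>x. x \<in> topspace T \<Longrightarrow> \<exists>k\<in>K. x \<in> U k"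
    and transition_locally_constant:
      "\<And>k l x. k \<in> K \<Longrightarrow> l \<in> K \<Longrightarrow> x \<in> U k \<Longrightarrow> x \<in> U l \<Longrightarrow>
        \<exists>N. openin T N \<and> x \<in> N \<and> N \<subseteq> U k \<inter> U l \<and> (\<forall>y\<in>N. \<tau> k l y = \<tau> k l x)"
    and transition_refl: "\<And>k x. k \<in> K \<Longrightarrow> x \<in> U k \<Longrightarrow> \<tau> k k x = id"
    and cocycle: "\<And>k l m x. k \<in> K \<Longrightarrow> l \<in> K \<Longrightarrow> m \<in> K \<Longrightarrow> x \<in> U k \<Longrightarrow> x \<in> U l \<Longrightarrow> x \<in> U m \<Longrightarrow>
        \<tau> k m x = \<tau> l m x \<circ> \<tau> k l x"
    and transition_in: "\<And>k l x. k \<in> K \<Longrightarrow> l \<in> K \<Longrightarrow> x \<in> U k \<Longrightarrow> x \<in> U l \<Longrightarrow> \<tau> k l x \<in> Grp"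
    and id_in: "id \<in> Grp"
    and comp_in: "\<And>g h. g \<in> Grp \<Longrightarrow> h \<in> Grp \<Longrightarrow> g \<circ> h \<in> Grp"
    and inverse_in: "\<And>g. g \<in> Grp \<Longrightarrow> \<exists>h\<in>Grp. h \<circ> g = id \<and> g \<circ> h = id"
begin

lemma Grp_left_cancel:
  assumes "g \<in> Grp" "g \<circ> a = g \<circ> b" shows "a = b"
proof -
  obtain h where "h \<circ> g = id" using inverse_in[OF assms(1)] by blast
  moreover have "h \<circ> g \<circ> a = h \<circ> g \<circ> b" using assms(2) by (simp add: comp_assoc)
  ultimately show ?thesis by simp
qed

text \<open>Flat sections of the pullback of the system along \<open>H\<close>: \<open>\<sigma> k z\<close> is the value at \<open>z\<close> in the
  trivialisation over \<open>U k\<close> and is meaningful only if \<open>H z \<in> U k\<close>.\<close>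

definition flat :: "'z::topological_space set \<Rightarrow> ('z \<Rightarrow> 'a) \<Rightarrow> ('k \<Rightarrow> 'z \<Rightarrow> 'v \<Rightarrow> 'v) \<Rightarrow> bool" where
  "flat Z H \<sigma> \<longleftrightarrow>
     (\<forall>k\<in>K. \<forall>z\<in>Z. H z \<in> U k \<longrightarrow> \<sigma> k z \<in> Grp \<and>
        (\<exists>N. open N \<and> z \<in> N \<and> (\<forall>w\<in>N \<inter> Z. H w \<in> U k \<longrightarrow> \<sigma> k w = \<sigma> k z))) \<and>
     (\<forall>k\<in>K. \<forall>l\<in>K. \<forall>z\<in>Z. H z \<in> U k \<inter> U l \<longrightarrow> \<sigma> k z = \<sigma> l z \<circ> \<tau> k l (H z))"

lemma flatI:
  assumes "\<And>k z. k \<in> K \<Longrightarrow> z \<in> Z \<Longrightarrow> H z \<in> U k \<Longrightarrow> \<sigma> k z \<in> Grp"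
    and "\<And>k z. k \<in> K \<Longrightarrow> z \<in> Z \<Longrightarrow> H z \<in> U k \<Longrightarrow>
      \<exists>N. open N \<and> z \<in> N \<and> (\<forall>w\<in>N \<inter> Z. H w \<in> U k \<longrightarrow> \<sigma> k w = \<sigma> k z)"
    and "\<And>k l z. k \<in> K \<Longrightarrow> l \<in> K \<Longrightarrow> z \<in> Z \<Longrightarrow> H z \<in> U k \<Longrightarrow> H z \<in> U l \<Longrightarrow> \<sigma> k z = \<sigma> l z \<circ> \<tau> k l (H z)"
  shows "flat Z H \<sigma>"
  unfolding flat_def
  by (intro conjI ballI impI; (elim IntE)?; (rule assms; assumption))

lemma flat_in: "flat Z H \<sigma> \<Longrightarrow> k \<in> K \<Longrightarrow> z \<in> Z \<Longrightarrow> H z \<in> U k \<Longrightarrow> \<sigma> k z \<in> Grp"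
  unfolding flat_def by blast

lemma flat_const:
  assumes "flat Z H \<sigma>" "k \<in> K" "z \<in> Z" "H z \<in> U k"
  obtains N where "open N" "z \<in> N" "\<And>w. w \<in> N \<Longrightarrow> w \<in> Z \<Longrightarrow> H w \<in> U k \<Longrightarrow> \<sigma> k w = \<sigma> k z"
  using assms unfolding flat_def by blast

lemma flat_transition:
  "flat Z H \<sigma> \<Longrightarrow> k \<in> K \<Longrightarrow> l \<in> K \<Longrightarrow> z \<in> Z \<Longrightarrow> H z \<in> U k \<Longrightarrow> H z \<in> U l \<Longrightarrow> \<sigma> k z = \<sigma> l z \<circ> \<tau> k l (H z)"
  unfolding flat_def by blast

section \<open>Restriction, pullback and translation of flat sections\<close>

lemma flat_subset:
  assumes "flat Z H \<sigma>" "Z' \<subseteq> Z" shows "flat Z' H \<sigma>"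
proof (rule flatI)
  fix k z assume z: "k \<in> K" "z \<in> Z'" "H z \<in> U k"
  then obtain N where "open N" "z \<in> N" "\<And>w. w \<in> N \<Longrightarrow> w \<in> Z \<Longrightarrow> H w \<in> U k \<Longrightarrow> \<sigma> k w = \<sigma> k z"
    using flat_const[OF assms(1), of k z] assms(2) by blast
  then show "\<exists>N. open N \<and> z \<in> N \<and> (\<forall>w\<in>N \<inter> Z'. H w \<in> U k \<longrightarrow> \<sigma> k w = \<sigma> k z)"
    using assms(2) by blast
next
  fix k z assume "k \<in> K" "z \<in> Z'" "H z \<in> U k"
  then show "\<sigma> k z \<in> Grp" using flat_in[OF assms(1), of k z] assms(2) by blast
next
  fix k l z assume "k \<in> K" "l \<in> K" "z \<in> Z'" "H z \<in> U k" "H z \<in> U l"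
  then show "\<sigma> k z = \<sigma> l z \<circ> \<tau> k l (H z)" using flat_transition[OF assms(1), of k l z] assms(2) by blast
qed

text \<open>Pullback of a flat section along a map of parameter spaces. It restricts sections on a
  square to its edges and reparametrises the halves of a joined path.\<close>

lemma flat_compose:
  assumes "flat Z H \<sigma>" "continuous_on W \<phi>" "\<And>w. w \<in> W \<Longrightarrow> \<phi> w \<in> Z" "\<And>w. w \<in> W \<Longrightarrow> H (\<phi> w) = h w"
  shows "flat W h (\<lambda>k w. \<sigma> k (\<phi> w))"
proof (rule flatI)
  fix k z assume z: "k \<in> K" "z \<in> W" "h z \<in> U k"
  then have z': "\<phi> z \<in> Z" "H (\<phi> z) \<in> U k" using assms(3,4) by auto
  then obtain N where N: "open N" "\<phi> z \<in> N" "\<And>w. w \<in> N \<Longrightarrow> w \<in> Z \<Longrightarrow> H w \<in> U k \<Longrightarrow> \<sigma> k w = \<sigma> k (\<phi> z)"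
    using flat_const[OF assms(1) z(1)] by blast
  then obtain A where "open A" "z \<in> A" "\<And>y. y \<in> W \<Longrightarrow> y \<in> A \<Longrightarrow> \<phi> y \<in> N"
    using assms(2) z(2) unfolding continuous_on_topological by metis
  then show "\<exists>N. open N \<and> z \<in> N \<and> (\<forall>w\<in>N \<inter> W. h w \<in> U k \<longrightarrow> \<sigma> k (\<phi> w) = \<sigma> k (\<phi> z))"
    using N(3) assms(3,4) by (intro exI[of _ A]) auto
  show "\<sigma> k (\<phi> z) \<in> Grp" using flat_in[OF assms(1) z(1) z'] .
next
  fix k l z assume "k \<in> K" "l \<in> K" "z \<in> W" "h z \<in> U k" "h z \<in> U l"
  then show "\<sigma> k (\<phi> z) = \<sigma> l (\<phi> z) \<circ> \<tau> k l (h z)"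
    using flat_transition[OF assms(1), of k l "\<phi> z"] assms(3,4) by auto
qed

text \<open>Transitions act by composition on the right, so composing on the left with a fixed group
  element preserves flatness. This is the freedom to prescribe a value at one point.\<close>

lemma flat_translate:
  assumes "flat Z H \<sigma>" "g \<in> Grp"
  shows "flat Z H (\<lambda>k z. g \<circ> \<sigma> k z)"
proof (rule flatI)
  fix k z assume z: "k \<in> K" "z \<in> Z" "H z \<in> U k"
  then obtain N where "open N" "z \<in> N" "\<And>w. w \<in> N \<Longrightarrow> w \<in> Z \<Longrightarrow> H w \<in> U k \<Longrightarrow> \<sigma> k w = \<sigma> k z"
    using flat_const[OF assms(1)] by metis
  then show "\<exists>N. open N \<and> z \<in> N \<and> (\<forall>w\<in>N \<inter> Z. H w \<in> U k \<longrightarrow> g \<circ> \<sigma> k w = g \<circ> \<sigma> k z)"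
    by (intro exI[of _ N]) auto
  show "g \<circ> \<sigma> k z \<in> Grp" using comp_in[OF assms(2) flat_in[OF assms(1) z]] .
next
  fix k l z assume "k \<in> K" "l \<in> K" "z \<in> Z" "H z \<in> U k" "H z \<in> U l"
  then show "g \<circ> \<sigma> k z = g \<circ> \<sigma> l z \<circ> \<tau> k l (H z)"
    using flat_transition[OF assms(1), of k l z] by (simp add: comp_assoc)
qed

section \<open>Uniqueness and gluing of flat sections\<close>

lemma preimage_open:
  assumes "continuous_map (top_of_set Z) T H" "openin T N" "z \<in> Z" "H z \<in> N"
  obtains M where "open M" "z \<in> M" "\<And>w. w \<in> M \<Longrightarrow> w \<in> Z \<Longrightarrow> H w \<in> N"
proof -
  have "openin (top_of_set Z) {w \<in> Z. H w \<in> N}"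
    using openin_continuous_map_preimage[OF assms(1,2)] by simp
  then obtain M where "open M" "{w \<in> Z. H w \<in> N} = Z \<inter> M"
    unfolding openin_open by blast
  then show thesis using assms(3,4) that[of M] by blast
qed

text \<open>The constant section with value \<open>g\<close> in the trivialisation over
  \<open>U k\<close>, rewritten for every other patch by the transition to \<open>k\<close>.\<close>

lemma flat_in_patch:
  assumes H: "continuous_map (top_of_set Z) T H" and k: "k \<in> K" "\<And>z. z \<in> Z \<Longrightarrow> H z \<in> U k" and g: "g \<in> Grp"
  shows "flat Z H (\<lambda>l z. g \<circ> \<tau> l k (H z))"
proof (rule flatI)
  fix l z assume l: "l \<in> K" "z \<in> Z" "H z \<in> U l"
  then show "g \<circ> \<tau> l k (H z) \<in> Grp" using comp_in[OF g transition_in] k by blast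
  obtain N where N: "openin T N" "H z \<in> N" "\<forall>y\<in>N. \<tau> l k y = \<tau> l k (H z)"
    using transition_locally_constant[OF l(1) k(1) l(3) k(2)[OF l(2)]] by blast
  obtain M where "open M" "z \<in> M" "\<And>w. w \<in> M \<Longrightarrow> w \<in> Z \<Longrightarrow> H w \<in> N"
    using preimage_open[OF H N(1) l(2) N(2)] by blast
  then show "\<exists>N. open N \<and> z \<in> N \<and> (\<forall>w\<in>N \<inter> Z. H w \<in> U l \<longrightarrow> g \<circ> \<tau> l k (H w) = g \<circ> \<tau> l k (H z))"
    using N(3) by (intro exI[of _ M]) auto
next
  fix l m z assume "l \<in> K" "m \<in> K" "z \<in> Z" "H z \<in> U l" "H z \<in> U m"
  then show "g \<circ> \<tau> l k (H z) = g \<circ> \<tau> m k (H z) \<circ> \<tau> l m (H z)"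
    using cocycle[of l m k "H z"] k by (simp add: comp_assoc)
qed

text \<open>The transition rule spreads agreement in one patch at a point to all patches there, and
  local constancy in one patch spreads it to nearby points. Both sections are thus compared in all
  patches at once, by connectedness of \<open>Z\<close>.\<close>

lemma flat_unique:
  assumes Z: "connected Z" and H: "continuous_map (top_of_set Z) T H"
    and \<sigma>: "flat Z H \<sigma>" "flat Z H \<rho>"
    and z0: "z0 \<in> Z" "k \<in> K" "H z0 \<in> U k" "\<sigma> k z0 = \<rho> k z0"
    and z: "z \<in> Z" "l \<in> K" "H z \<in> U l"
  shows "\<sigma> l z = \<rho> l z"
proof -
  let ?P = "\<lambda>z. \<forall>l\<in>K. H z \<in> U l \<longrightarrow> \<sigma> l z = \<rho> l z"
  have P: "?P w" if w: "w \<in> Z" "j \<in> K" "H w \<in> U j" "\<sigma> j w = \<rho> j w" for w j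
  proof (intro ballI impI)
    fix l assume l: "l \<in> K" "H w \<in> U l"
    show "\<sigma> l w = \<rho> l w"
      using flat_transition[OF \<sigma>(1) l(1) w(2,1) l(2) w(3)] flat_transition[OF \<sigma>(2) l(1) w(2,1) l(2) w(3)]
        w(4) by simp
  qed
  have "?P z"
  proof (rule connected_induction_simple[where P = ?P, OF Z z0(1) z(1) P[OF z0]])
    fix a assume a: "a \<in> Z"
    then have "H a \<in> topspace T" using H by (auto simp: continuous_map_def)
    then obtain j where j: "j \<in> K" "H a \<in> U j" using cover by blast
    obtain N where N: "openin T N" "H a \<in> N" "N \<subseteq> U j"
      using transition_locally_constant[OF j(1,1,2,2)] by blast
    obtain M where M: "open M" "a \<in> M" "\<And>w. w \<in> M \<Longrightarrow> w \<in> Z \<Longrightarrow> H w \<in> N"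
      using preimage_open[OF H N(1) a N(2)] by blast
    obtain A where A: "open A" "a \<in> A" "\<And>w. w \<in> A \<Longrightarrow> w \<in> Z \<Longrightarrow> H w \<in> U j \<Longrightarrow> \<sigma> j w = \<sigma> j a"
      using flat_const[OF \<sigma>(1) j(1) a j(2)] by blast
    obtain B where B: "open B" "a \<in> B" "\<And>w. w \<in> B \<Longrightarrow> w \<in> Z \<Longrightarrow> H w \<in> U j \<Longrightarrow> \<rho> j w = \<rho> j a"
      using flat_const[OF \<sigma>(2) j(1) a j(2)] by blast
    let ?T = "Z \<inter> (M \<inter> A \<inter> B)"
    have "?P y" if x: "x \<in> ?T" "?P x" and y: "y \<in> ?T" for x y
    proof (rule P[OF _ j(1)])
      have "H x \<in> U j" "H y \<in> U j" using x y M(3) N(3) by blast+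
      then show "\<sigma> j y = \<rho> j y" "H y \<in> U j"
        using A(3)[of x] A(3)[of y] B(3)[of x] B(3)[of y] x y j(1) by auto
    qed (use y in blast)
    moreover have "openin (top_of_set Z) ?T"
      using M(1) A(1) B(1) by (intro openin_open_Int open_Int)
    ultimately show "\<exists>T. openin (top_of_set Z) T \<and> a \<in> T \<and> (\<forall>x\<in>T. \<forall>y\<in>T. ?P x \<longrightarrow> ?P y)"
      using a M(2) A(2) B(2) by (intro exI[of _ ?T] conjI) blast+
  qed
  then show ?thesis using z by blast
qed

text \<open>Comparison with the constant section of \<open>flat_in_patch\<close> that has the same
  value at \<open>z\<close>.\<close>

lemma flat_constant_in_patch:
  assumes Z: "connected Z" and H: "continuous_map (top_of_set Z) T H" and \<sigma>: "flat Z H \<sigma>"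
    and k: "k \<in> K" "\<And>z. z \<in> Z \<Longrightarrow> H z \<in> U k" and z: "z \<in> Z" "w \<in> Z"
  shows "\<sigma> k w = \<sigma> k z"
proof -
  have g: "\<sigma> k z \<in> Grp" using flat_in[OF \<sigma> k(1) z(1)] k z by blast
  have "\<sigma> k w = \<sigma> k z \<circ> \<tau> k k (H w)"
    by (rule flat_unique[OF Z H \<sigma> flat_in_patch[OF H k g], of z k])
      (use z k transition_refl[OF k(1)] in auto)
  then show ?thesis using transition_refl[OF k(1)] k z by simp
qed

lemma flat_normalise:
  assumes "flat Z H \<sigma>" "k \<in> K" "z \<in> Z" "H z \<in> U k" "g \<in> Grp"
  obtains \<rho> where "flat Z H \<rho>" "\<rho> k z = g"
proof -
  obtain h where h: "h \<in> Grp" "h \<circ> \<sigma> k z = id" using inverse_in[OF flat_in[OF assms(1-4)]] by blast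
  show thesis
    using that[OF flat_translate[OF assms(1) comp_in[OF assms(5) h(1)]]] h(2) by (simp add: comp_assoc)
qed

text \<open>A left translation makes the second section agree with the first at \<open>z0\<close>;
  uniqueness on the connected intersection makes them agree on all of it. Closedness of the pieces
  gives local constancy at points of only one piece.\<close>

lemma flat_union:
  assumes Z: "closed Z1" "closed Z2" "connected (Z1 \<inter> Z2)" "z0 \<in> Z1 \<inter> Z2"
    and H: "continuous_map (top_of_set (Z1 \<inter> Z2)) T H"
    and \<sigma>: "flat Z1 H \<sigma>1" "flat Z2 H \<sigma>2"
  shows "\<exists>\<sigma>. flat (Z1 \<union> Z2) H \<sigma>"
proof -
  have "H z0 \<in> topspace T" using H Z(4) by (auto simp: continuous_map_def)
  then obtain k where k: "k \<in> K" "H z0 \<in> U k" using cover by blast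
  then obtain \<rho> where \<rho>: "flat Z2 H \<rho>" "\<rho> k z0 = \<sigma>1 k z0"
    using flat_normalise[OF \<sigma>(2) k(1) _ k(2)] flat_in[OF \<sigma>(1) k(1) _ k(2)] Z(4) by blast
  have eq: "\<sigma>1 l z = \<rho> l z" if "z \<in> Z1 \<inter> Z2" "l \<in> K" "H z \<in> U l" for l z
    by (rule flat_unique[OF Z(3) H flat_subset[OF \<sigma>(1)] flat_subset[OF \<rho>(1)] Z(4) k \<rho>(2)[symmetric] that]) auto
  define \<sigma> where "\<sigma> k z = (if z \<in> Z1 then \<sigma>1 k z else \<rho> k z)" for k z
  \<comment> \<open>Agreement on the overlap is available only in patches that contain
    \<open>H z\<close>; outside them the values are meaningless.\<close>
  have \<sigma>_2: "\<sigma> l z = \<rho> l z" if "z \<in> Z2" "l \<in> K" "H z \<in> U l" for l z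
    using eq that by (auto simp: \<sigma>_def)
  have \<sigma>_1: "\<sigma> l z = \<sigma>1 l z" if "z \<in> Z1" for l z
    using that by (simp add: \<sigma>_def)
  have "flat (Z1 \<union> Z2) H \<sigma>"
  proof (rule flatI)
    fix l z assume l: "l \<in> K" "z \<in> Z1 \<union> Z2" "H z \<in> U l"
    show "\<sigma> l z \<in> Grp"
      using flat_in[OF \<sigma>(1) l(1) _ l(3)] flat_in[OF \<rho>(1) l(1) _ l(3)] l(2) by (auto simp: \<sigma>_def)
    have "\<exists>N. open N \<and> z \<in> N \<and> (\<forall>w\<in>N \<inter> Z1. H w \<in> U l \<longrightarrow> \<sigma> l w = \<sigma> l z)"
    proof (cases "z \<in> Z1")
      case True
      then show ?thesis using flat_const[OF \<sigma>(1) l(1) True l(3)] \<sigma>_1 by (metis IntE)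
    next
      case False
      \<comment> \<open>The complement of \<open>Z1\<close> is a neighbourhood of \<open>z\<close>
        on which nothing is required of \<open>w\<close> in \<open>Z1\<close>.\<close>
      then show ?thesis using Z(1) by (intro exI[of _ "- Z1"]) auto
    qed
    then obtain A where A: "open A" "z \<in> A" "\<forall>w\<in>A \<inter> Z1. H w \<in> U l \<longrightarrow> \<sigma> l w = \<sigma> l z" by blast
    have "\<exists>N. open N \<and> z \<in> N \<and> (\<forall>w\<in>N \<inter> Z2. H w \<in> U l \<longrightarrow> \<sigma> l w = \<sigma> l z)"
    proof (cases "z \<in> Z2")
      case True
      then show ?thesis using flat_const[OF \<rho>(1) l(1) True l(3)] \<sigma>_2 l by (metis IntE)
    next
      case False
      then show ?thesis using Z(2) by (intro exI[of _ "- Z2"]) auto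
    qed
    then obtain B where B: "open B" "z \<in> B" "\<forall>w\<in>B \<inter> Z2. H w \<in> U l \<longrightarrow> \<sigma> l w = \<sigma> l z" by blast
    show "\<exists>N. open N \<and> z \<in> N \<and> (\<forall>w\<in>N \<inter> (Z1 \<union> Z2). H w \<in> U l \<longrightarrow> \<sigma> l w = \<sigma> l z)"
      using A B by (intro exI[of _ "A \<inter> B"]) auto
  next
    fix l m z assume "l \<in> K" "m \<in> K" "z \<in> Z1 \<union> Z2" "H z \<in> U l" "H z \<in> U m"
    then show "\<sigma> l z = \<sigma> m z \<circ> \<tau> l m (H z)"
      using flat_transition[OF \<sigma>(1), of l m z] flat_transition[OF \<rho>(1), of l m z] by (auto simp: \<sigma>_def)
  qed
  then show ?thesis by blast
qed

section \<open>Existence of flat sections on squares and paths\<close>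

lemma flat_exists_locally:
  assumes H: "continuous_map (top_of_set Z) T H" and z: "z \<in> Z"
  obtains N where "open N" "z \<in> N" "\<And>Z'. Z' \<subseteq> N \<Longrightarrow> Z' \<subseteq> Z \<Longrightarrow> \<exists>\<sigma>. flat Z' H \<sigma>"
proof -
  have "H z \<in> topspace T" using H z by (auto simp: continuous_map_def)
  then obtain k where k: "k \<in> K" "H z \<in> U k" using cover by blast
  obtain N where N: "openin T N" "H z \<in> N" "N \<subseteq> U k"
    using transition_locally_constant[OF k(1,1,2,2)] by blast
  obtain M where M: "open M" "z \<in> M" "\<And>w. w \<in> M \<Longrightarrow> w \<in> Z \<Longrightarrow> H w \<in> N"
    using preimage_open[OF H N(1) z N(2)] by blast
  have "\<exists>\<sigma>. flat Z' H \<sigma>" if "Z' \<subseteq> M" "Z' \<subseteq> Z" for Z'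
    using flat_in_patch[OF continuous_map_from_subtopology_mono[OF H that(2)] k(1) _ id_in] M(3) N(3) that
    by blast
  then show thesis using that M by blast
qed

text \<open>A tube argument around the vertical segment over \<open>x\<close>: bisection in the
  second coordinate, with the admissible strip width part of the claim. Stacking two strips along
  their common horizontal edge costs only the minimum of the two widths.\<close>

lemma flat_exists_strip:
  fixes H :: "real \<times> real \<Rightarrow> 'a"
  assumes H: "continuous_map (top_of_set ({a..b} \<times> {c..d})) T H" and x: "a \<le> x" "x \<le> b" and cd: "c \<le> d"
  shows "\<exists>\<delta>>0. \<forall>a' b'. a \<le> a' \<and> a' \<le> x \<and> x \<le> b' \<and> b' \<le> b \<and> b' - a' < \<delta> \<longrightarrow> (\<exists>\<sigma>. flat ({a'..b'} \<times> {c..d}) H \<sigma>)"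
proof -
  \<comment> \<open>The bounds by \<open>c\<close> and \<open>d\<close> sit inside the predicate
    because the local step of \<open>Bolzano\<close> also asks about short intervals that leave the
    segment.\<close>
  let ?P = "\<lambda>y1 y2. c \<le> y1 \<longrightarrow> y2 \<le> d \<longrightarrow> (\<exists>\<delta>>0. \<forall>a' b'. a \<le> a' \<and> a' \<le> x \<and> x \<le> b' \<and> b' \<le> b \<and> b' - a' < \<delta> \<longrightarrow>
    (\<exists>\<sigma>. flat ({a'..b'} \<times> {y1..y2}) H \<sigma>))"
  have "?P c d"
  proof (rule Bolzano[where P = ?P, OF cd])
    fix y1 y2 y3 assume P: "?P y1 y2" "?P y2 y3" and y: "y1 \<le> y2" "y2 \<le> y3"
    show "?P y1 y3"
    proof (intro impI)
      assume cd': "c \<le> y1" "y3 \<le> d"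
      obtain \<delta>1 where \<delta>1: "\<delta>1 > 0" "\<And>a' b'. a \<le> a' \<and> a' \<le> x \<and> x \<le> b' \<and> b' \<le> b \<and> b' - a' < \<delta>1 \<Longrightarrow>
          (\<exists>\<sigma>. flat ({a'..b'} \<times> {y1..y2}) H \<sigma>)" using P(1) cd' y by auto
      obtain \<delta>2 where \<delta>2: "\<delta>2 > 0" "\<And>a' b'. a \<le> a' \<and> a' \<le> x \<and> x \<le> b' \<and> b' \<le> b \<and> b' - a' < \<delta>2 \<Longrightarrow>
          (\<exists>\<sigma>. flat ({a'..b'} \<times> {y2..y3}) H \<sigma>)" using P(2) cd' y by auto
      have "\<exists>\<sigma>. flat ({a'..b'} \<times> {y1..y3}) H \<sigma>"
        if ab: "a \<le> a'" "a' \<le> x" "x \<le> b'" "b' \<le> b" "b' - a' < min \<delta>1 \<delta>2" for a' b'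
      proof -
        obtain \<sigma>1 \<sigma>2 where \<sigma>: "flat ({a'..b'} \<times> {y1..y2}) H \<sigma>1" "flat ({a'..b'} \<times> {y2..y3}) H \<sigma>2"
          using \<delta>1(2)[of a' b'] \<delta>2(2)[of a' b'] ab by auto
        have i: "{a'..b'} \<times> {y1..y2} \<inter> {a'..b'} \<times> {y2..y3} = {a'..b'} \<times> {y2}" using y by auto
        have u: "{a'..b'} \<times> {y1..y2} \<union> {a'..b'} \<times> {y2..y3} = {a'..b'} \<times> {y1..y3}" using y by auto
        have H': "continuous_map (top_of_set ({a'..b'} \<times> {y2})) T H"
          by (rule continuous_map_from_subtopology_mono[OF H]) (use ab y cd' in auto)
        show ?thesis
          using flat_union[OF _ _ _ _ _ \<sigma>, of "(x, y2)"] H' ab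
          unfolding i u by (auto simp: closed_Times connected_Times)
      qed
      then show "\<exists>\<delta>>0. \<forall>a' b'. a \<le> a' \<and> a' \<le> x \<and> x \<le> b' \<and> b' \<le> b \<and> b' - a' < \<delta> \<longrightarrow>
          (\<exists>\<sigma>. flat ({a'..b'} \<times> {y1..y3}) H \<sigma>)"
        using \<delta>1(1) \<delta>2(1) by (intro exI[of _ "min \<delta>1 \<delta>2"]) auto
    qed
  next
    fix y assume y: "c \<le> y" "y \<le> d"
    obtain N where N: "open N" "(x, y) \<in> N" "\<And>Z'. Z' \<subseteq> N \<Longrightarrow> Z' \<subseteq> {a..b} \<times> {c..d} \<Longrightarrow> \<exists>\<sigma>. flat Z' H \<sigma>"
      by (rule flat_exists_locally[OF H, of "(x, y)"]) (use x y in auto)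
    obtain A B where AB: "open A" "open B" "(x, y) \<in> A \<times> B" "A \<times> B \<subseteq> N"
      using open_prod_elim[OF N(1,2)] by metis
    obtain \<delta> where \<delta>: "\<delta> > 0" "ball x \<delta> \<subseteq> A" using AB(1,3) open_contains_ball by (metis mem_Sigma_iff)
    obtain \<epsilon> where \<epsilon>: "\<epsilon> > 0" "ball y \<epsilon> \<subseteq> B" using AB(2,3) open_contains_ball by (metis mem_Sigma_iff)
    have "\<exists>\<sigma>. flat ({a'..b'} \<times> {y1..y2}) H \<sigma>"
      if "y1 \<le> y" "y \<le> y2" "y2 - y1 < \<epsilon>" "c \<le> y1" "y2 \<le> d" "a \<le> a'" "a' \<le> x" "x \<le> b'" "b' \<le> b" "b' - a' < \<delta>"
      for y1 y2 a' b'
    proof (rule N(3))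
      have "{a'..b'} \<subseteq> ball x \<delta>" "{y1..y2} \<subseteq> ball y \<epsilon>" using that by (auto simp: dist_real_def)
      then show "{a'..b'} \<times> {y1..y2} \<subseteq> N" using \<delta>(2) \<epsilon>(2) AB(4) by blast
    qed (use that in auto)
    then show "\<exists>\<epsilon>>0. \<forall>y1 y2. y1 \<le> y \<and> y \<le> y2 \<and> y2 - y1 < \<epsilon> \<longrightarrow> ?P y1 y2"
      using \<delta>(1) \<epsilon>(1) by (intro exI[of _ \<epsilon>]) auto
  qed
  then show ?thesis by simp
qed

text \<open>A second bisection, now in the first coordinate: full-height strips are joined along
  vertical segments, which are connected as \<open>flat_union\<close> requires.\<close>

lemma flat_exists_box:
  fixes H :: "real \<times> real \<Rightarrow> 'a"
  assumes H: "continuous_map (top_of_set ({a..b} \<times> {c..d})) T H" and "a \<le> b" and cd: "c \<le> d"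
  shows "\<exists>\<sigma>. flat ({a..b} \<times> {c..d}) H \<sigma>"
proof -
  let ?P = "\<lambda>x1 x2. a \<le> x1 \<longrightarrow> x2 \<le> b \<longrightarrow> (\<exists>\<sigma>. flat ({x1..x2} \<times> {c..d}) H \<sigma>)"
  have "?P a b"
  proof (rule Bolzano[where P = ?P, OF \<open>a \<le> b\<close>])
    fix x1 x2 x3 assume P: "?P x1 x2" "?P x2 x3" and x: "x1 \<le> x2" "x2 \<le> x3"
    show "?P x1 x3"
    proof (intro impI)
      assume ab: "a \<le> x1" "x3 \<le> b"
      then obtain \<sigma>1 \<sigma>2 where \<sigma>: "flat ({x1..x2} \<times> {c..d}) H \<sigma>1" "flat ({x2..x3} \<times> {c..d}) H \<sigma>2"
        using P x by auto
      have i: "{x1..x2} \<times> {c..d} \<inter> {x2..x3} \<times> {c..d} = {x2} \<times> {c..d}" using x by auto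
      have u: "{x1..x2} \<times> {c..d} \<union> {x2..x3} \<times> {c..d} = {x1..x3} \<times> {c..d}" using x by auto
      have H': "continuous_map (top_of_set ({x2} \<times> {c..d})) T H"
        by (rule continuous_map_from_subtopology_mono[OF H]) (use ab x in auto)
      show "\<exists>\<sigma>. flat ({x1..x3} \<times> {c..d}) H \<sigma>"
        using flat_union[OF _ _ _ _ _ \<sigma>, of "(x2, c)"] H' cd
        unfolding i u by (auto simp: closed_Times connected_Times)
    qed
  next
    fix x assume x: "a \<le> x" "x \<le> b"
    then obtain \<delta> where \<delta>: "\<delta> > 0" "\<forall>a' b'. a \<le> a' \<and> a' \<le> x \<and> x \<le> b' \<and> b' \<le> b \<and> b' - a' < \<delta> \<longrightarrow> (\<exists>\<sigma>. flat ({a'..b'} \<times> {c..d}) H \<sigma>)"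
      using flat_exists_strip[OF H x cd] by blast
    then show "\<exists>\<delta>>0. \<forall>a' b'. a' \<le> x \<and> x \<le> b' \<and> b' - a' < \<delta> \<longrightarrow> ?P a' b'"
      by (intro exI[of _ \<delta>]) blast
  qed
  then show ?thesis by simp
qed

text \<open>A path is a map of the square that ignores the first coordinate, so the result for boxes
  applies.\<close>

lemma flat_exists_path:
  assumes "pathin T g"
  shows "\<exists>\<sigma>. flat {0..1} g \<sigma>"
proof -
  have "continuous_map (top_of_set ({0..1::real} \<times> {0..1::real})) (top_of_set {0..1::real}) snd"
    by (auto intro: continuous_intros)
  then have "continuous_map (top_of_set ({0..1::real} \<times> {0..1})) T (g \<circ> snd)"
    using assms continuous_map_compose unfolding pathin_def by blast
  then obtain \<sigma> where "flat ({0..1::real} \<times> {0..1}) (g \<circ> snd) \<sigma>"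
    using flat_exists_box[of 0 1 0 1 "g \<circ> snd"] by auto
  then have "flat {0..1} g (\<lambda>k t. \<sigma> k (0, t))"
    by (rule flat_compose) (auto intro!: continuous_intros)
  then show ?thesis by blast
qed

text \<open>A contraction of the loop is a square whose right edge is constant and whose top and bottom
  edges are the same path, so a flat section on it takes equal values at the ends of the left edge.\<close>

lemma flat_closed_loop:
  assumes sc: "simply_connected_space T" and r: "pathin T r" "r 1 = r 0"
    and \<sigma>: "flat {0..1} r \<sigma>" and k: "k \<in> K" "r 0 \<in> U k"
  shows "\<sigma> k 1 = \<sigma> k 0"
proof -
  let ?I = "{0..1::real}"
  have r0: "r 0 \<in> topspace T" using r(1) by (auto simp: pathin_def continuous_map_def)
  have "homotopic_with (\<lambda>r. r 1 = r 0) (top_of_set ?I) T r (\<lambda>_. r 0)"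
    using sc r r0 unfolding simply_connected_space_def pathin_def by auto
  then obtain H where H: "continuous_map (prod_topology (top_of_set ?I) (top_of_set ?I)) T H"
    "\<And>x. H (0, x) = r x" "\<And>x. H (1, x) = r 0" "\<And>t. t \<in> ?I \<Longrightarrow> H (t, 1) = H (t, 0)"
    unfolding homotopic_with_def by blast
  have "prod_topology (top_of_set ?I) (top_of_set ?I) = top_of_set (?I \<times> ?I)"
    by (simp add: subtopology_Times flip: euclidean_product_topology)
  then have cH: "continuous_map (top_of_set (?I \<times> ?I)) T H" using H(1) by simp
  then obtain \<rho> where \<rho>: "flat (?I \<times> ?I) H \<rho>"
    using flat_exists_box[of 0 1 0 1 H] by auto
  have right: "flat ?I (\<lambda>_. r 0) (\<lambda>k s. \<rho> k (1, s))"
    by (rule flat_compose[OF \<rho>]) (auto intro!: continuous_intros simp: H(3))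
  have left: "flat ?I r (\<lambda>k s. \<rho> k (0, s))"
    by (rule flat_compose[OF \<rho>]) (auto intro!: continuous_intros simp: H(2))
  have bottom: "flat ?I (\<lambda>t. H (t, 0)) (\<lambda>k t. \<rho> k (t, 0))"
    by (rule flat_compose[OF \<rho>]) (auto intro!: continuous_intros)
  have top: "flat ?I (\<lambda>t. H (t, 0)) (\<lambda>k t. \<rho> k (t, 1))"
    by (rule flat_compose[OF \<rho>]) (auto intro!: continuous_intros simp: H(4))
  have "continuous_map (top_of_set ?I) (top_of_set (?I \<times> ?I)) (\<lambda>t. (t, 0))"
    by (auto intro!: continuous_intros)
  from continuous_map_compose[OF this cH]
  have c: "continuous_map (top_of_set ?I) T (\<lambda>t. H (t, 0))" by (simp add: o_def)
  have "\<rho> k (1, 1) = \<rho> k (1, 0)"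
    by (rule flat_constant_in_patch[OF connected_Icc _ right k(1)]) (use k(2) r0 in auto)
  \<comment> \<open>The top and bottom sections live over the same path and agree at its end on the
    right edge; uniqueness carries this back to the left edge.\<close>
  then have e: "\<rho> k (0, 1) = \<rho> k (0, 0)"
    by (intro flat_unique[OF connected_Icc c top bottom, of 1 k 0 k]) (use k H(2,3) in auto)
  \<comment> \<open>\<open>\<sigma>\<close> and the left edge of \<open>\<rho>\<close> are flat
    along the same loop, hence differ by one left translation \<open>g\<close>, which cancels from
    the comparison of end values.\<close>
  obtain g where g: "g \<in> Grp" "g \<circ> \<sigma> k 0 = \<rho> k (0, 0)"
    using flat_in[OF \<sigma> k(1) _ k(2)] flat_in[OF left k(1) _ k(2)] inverse_in comp_in
    by (metis atLeastAtMost_iff comp_assoc comp_id le_numeral_extra(3) zero_le_one)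
  have "g \<circ> \<sigma> k 1 = \<rho> k (0, 1)"
    by (rule flat_unique[OF connected_Icc _ flat_translate[OF \<sigma> g(1)] left, of 0 k])
      (use r k g(2) in \<open>auto simp: pathin_def\<close>)
  then show ?thesis using Grp_left_cancel[OF g(1), of "\<sigma> k 1" "\<sigma> k 0"] e g(2) by simp
qed

section \<open>Transport from a base point and the global flat section\<close>

definition transport :: "'k \<Rightarrow> 'a \<Rightarrow> 'k \<Rightarrow> 'a \<Rightarrow> ('v \<Rightarrow> 'v) \<Rightarrow> bool" where
  "transport k0 x0 k x v \<longleftrightarrow>
     (\<exists>g \<sigma>. pathin T g \<and> g 0 = x0 \<and> g 1 = x \<and> flat {0..1} g \<sigma> \<and> \<sigma> k0 0 = id \<and> \<sigma> k 1 = v)"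

lemma transport_along:
  assumes g: "pathin T g" "g 0 = x0" "k0 \<in> K" "x0 \<in> U k0"
  obtains \<sigma> where "flat {0..1} g \<sigma>" "\<sigma> k0 0 = id"
proof -
  obtain \<sigma> where "flat {0..1} g \<sigma>" using flat_exists_path[OF g(1)] by blast
  then show thesis using flat_normalise[OF _ g(3) _ _ id_in, of "{0..1}" g \<sigma> 0] g(2,4) that by auto
qed

text \<open>The first half of the joined path, run at half speed in the parameter of
  \<open>\<rho>\<close>, is \<open>g\<close> itself, so uniqueness along \<open>g\<close>
  applies.\<close>

lemma flat_first_half:
  assumes \<rho>: "flat {0..1} (\<lambda>t. if t \<le> 1/2 then g (2 * t) else h (2 * t - 1)) \<rho>" "\<rho> k0 0 = \<sigma> k0 0"
    and g: "pathin T g" "flat {0..1} g \<sigma>" and k: "k0 \<in> K" "g 0 \<in> U k0" "k \<in> K" "g 1 \<in> U k"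
  shows "\<rho> k (1/2) = \<sigma> k 1"
proof -
  have f: "flat {0..1} g (\<lambda>k t. \<rho> k (t / 2))"
    by (rule flat_compose[OF \<rho>(1)]) (auto intro!: continuous_intros)
  show ?thesis
    by (rule flat_unique[OF connected_Icc _ f g(2), of 0 k0 1 k, simplified])
      (use g(1) \<rho>(2) k in \<open>auto simp: pathin_def\<close>)
qed

text \<open>Two paths to \<open>x\<close> form a loop, out along \<open>g\<close> and back along
  \<open>h\<close>. A flat section along the loop returns to the identity at \<open>x0\<close>; its
  value at half time is the end value of transport along either path.\<close>

lemma transport_unique:
  assumes sc: "simply_connected_space T" and k: "k0 \<in> K" "x0 \<in> U k0" "k \<in> K" "x \<in> U k"
    and v: "transport k0 x0 k x v" "transport k0 x0 k x w"
  shows "v = w"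
proof -
  obtain g \<sigma> where g: "pathin T g" "g 0 = x0" "g 1 = x" "flat {0..1} g \<sigma>" "\<sigma> k0 0 = id" "\<sigma> k 1 = v"
    using v(1) unfolding transport_def by blast
  obtain h \<sigma>' where h: "pathin T h" "h 0 = x0" "h 1 = x" "flat {0..1} h \<sigma>'" "\<sigma>' k0 0 = id" "\<sigma>' k 1 = w"
    using v(2) unfolding transport_def by blast
  define r where "r = (\<lambda>t. if t \<le> 1/2 then g (2 * t) else h (1 - (2 * t - 1)))"
  have r: "pathin T r" unfolding r_def
    by (rule pathin_join[OF g(1) pathin_reverse[OF h(1)]]) (use g h in auto)
  have r01: "r 0 = x0" "r 1 = r 0" using g h by (auto simp: r_def)
  obtain \<rho> where \<rho>: "flat {0..1} r \<rho>" "\<rho> k0 0 = id"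
    using transport_along[OF r r01(1) k(1,2)] by blast
  have "\<rho> k (1/2) = \<sigma> k 1"
    by (rule flat_first_half[where h = "\<lambda>t. h (1 - t)" and g = g and ?k0.0 = k0])
      (use \<rho> g k in \<open>auto simp: r_def\<close>)
  \<comment> \<open>The second half of the loop, run backwards from its end, is transport along
    \<open>h\<close> starting at \<open>x0\<close>.\<close>
  moreover have f: "flat {0..1} h (\<lambda>k t. \<rho> k (1 - t / 2))"
    by (rule flat_compose[OF \<rho>(1)]) (use g(3) h(3) in \<open>auto simp: r_def intro!: continuous_intros\<close>)
  have "\<rho> k0 1 = id" using flat_closed_loop[OF sc r r01(2) \<rho>(1) k(1)] r01 k \<rho>(2) by simp
  then have "\<rho> k (1 - 1/2) = \<sigma>' k 1"
    by (intro flat_unique[OF connected_Icc _ f h(4), of 0 k0 1 k]) (use h k in \<open>auto simp: pathin_def\<close>)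
  ultimately show ?thesis using g(6) h(6) by simp
qed

text \<open>The notion of simple connectedness used here compares any two loops freely, constant
  ones included. A homotopy between two constant loops traces a path between their points.\<close>

lemma path_exists:
  assumes sc: "simply_connected_space T" and x: "x \<in> topspace T" "y \<in> topspace T"
  obtains g where "pathin T g" "g 0 = x" "g 1 = y"
proof -
  let ?I = "{0..1::real}"
  have "homotopic_with (\<lambda>r. r 1 = r 0) (top_of_set ?I) T (\<lambda>_. x) (\<lambda>_. y)"
    using sc x unfolding simply_connected_space_def by auto
  then obtain H where H: "continuous_map (prod_topology (top_of_set ?I) (top_of_set ?I)) T H"
    "\<And>s. H (0, s) = x" "\<And>s. H (1, s) = y"
    unfolding homotopic_with_def by blast
  have "continuous_map (top_of_set ?I) (prod_topology (top_of_set ?I) (top_of_set ?I)) (\<lambda>t. (t, 0))"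
    by (auto simp: continuous_map_paired intro: continuous_intros)
  from continuous_map_compose[OF this H(1)] show thesis
    using that[of "\<lambda>t. H (t, 0)"] H(2,3) by (simp add: pathin_def o_def)
qed

text \<open>Local constancy is recorded as constancy along paths inside one patch. This suffices for
  local models, whose connected components are path components.\<close>

theorem global_flat_section:
  assumes sc: "simply_connected_space T"
  obtains b where
    "\<And>k x. k \<in> K \<Longrightarrow> x \<in> topspace T \<Longrightarrow> x \<in> U k \<Longrightarrow> b k x \<in> Grp"
    "\<And>k l x. k \<in> K \<Longrightarrow> l \<in> K \<Longrightarrow> x \<in> topspace T \<Longrightarrow> x \<in> U k \<Longrightarrow> x \<in> U l \<Longrightarrow> b k x = b l x \<circ> \<tau> k l x"
    "\<And>k \<gamma>. k \<in> K \<Longrightarrow> pathin T \<gamma> \<Longrightarrow> \<gamma> ` {0..1} \<subseteq> U k \<Longrightarrow> b k (\<gamma> 1) = b k (\<gamma> 0)"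
proof (cases "topspace T = {}")
  case True
  have "\<gamma> 0 \<in> topspace T" if "pathin T \<gamma>" for \<gamma>
    using that by (auto simp: pathin_def continuous_map_def)
  then have "\<not> pathin T \<gamma>" for \<gamma> using True by blast
  then show thesis using True by (intro that[of "\<lambda>_ _. id"]) auto
next
  case False
  then obtain x0 k0 where x0: "x0 \<in> topspace T" "k0 \<in> K" "x0 \<in> U k0" using cover by blast
  let ?tr = "transport k0 x0"
  define b where "b k x = (THE v. ?tr k x v)" for k x
  have b: "b k x = v" if "k \<in> K" "x \<in> U k" "?tr k x v" for k x v
    unfolding b_def using transport_unique[OF sc x0(2,3) that(1,2)] that(3) by blast
  have path: "\<exists>g \<sigma>. pathin T g \<and> g 0 = x0 \<and> g 1 = x \<and> flat {0..1} g \<sigma> \<and> \<sigma> k0 0 = id"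
    if x: "x \<in> topspace T" for x
  proof -
    obtain g where g: "pathin T g" "g 0 = x0" "g 1 = x"
      using path_exists[OF sc x0(1) x] by blast
    then show ?thesis using transport_along[OF g(1,2) x0(2,3)] by blast
  qed
  have at: "b k x = \<sigma> k 1"
    if "pathin T g" "g 0 = x0" "g 1 = x" "flat {0..1} g \<sigma>" "\<sigma> k0 0 = id" "k \<in> K" "x \<in> U k" for k x g \<sigma>
    using b[OF that(6,7)] that unfolding transport_def by blast
  show thesis
  proof (rule that)
    fix k x assume k: "k \<in> K" "x \<in> topspace T" "x \<in> U k"
    obtain g \<sigma> where g: "pathin T g" "g 0 = x0" "g 1 = x" "flat {0..1} g \<sigma>" "\<sigma> k0 0 = id"
      using path[OF k(2)] by blast
    show "b k x \<in> Grp"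
      using at[OF g k(1,3)] flat_in[OF g(4) k(1), of 1] g(3) k(3) by simp
  next
    fix k l x assume k: "k \<in> K" "l \<in> K" "x \<in> topspace T" "x \<in> U k" "x \<in> U l"
    obtain g \<sigma> where g: "pathin T g" "g 0 = x0" "g 1 = x" "flat {0..1} g \<sigma>" "\<sigma> k0 0 = id"
      using path[OF k(3)] by blast
    show "b k x = b l x \<circ> \<tau> k l x"
      using at[OF g k(1,4)] at[OF g k(2,5)] flat_transition[OF g(4) k(1,2), of 1] g(3) k by (simp add: o_def)
  next
    fix k \<gamma> assume k: "k \<in> K" and \<gamma>: "pathin T \<gamma>" "\<gamma> ` {0..1} \<subseteq> U k"
    have "\<gamma> 0 \<in> topspace T" using \<gamma>(1) by (auto simp: pathin_def continuous_map_def)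
    then obtain g \<sigma> where g: "pathin T g" "g 0 = x0" "g 1 = \<gamma> 0" "flat {0..1} g \<sigma>" "\<sigma> k0 0 = id"
      using path by blast
    \<comment> \<open>Prolonging a path to \<open>\<gamma> 0\<close> by \<open>\<gamma>\<close>
      computes both values of \<open>b\<close> from a single flat section, which is constant in
      patch \<open>k\<close> on the second half.\<close>
    define r where "r = (\<lambda>t. if t \<le> 1/2 then g (2 * t) else \<gamma> (2 * t - 1))"
    have r: "pathin T r" unfolding r_def by (rule pathin_join[OF g(1) \<gamma>(1) g(3)])
    have r01: "r 0 = x0" "r 1 = \<gamma> 1" using g by (auto simp: r_def)
    obtain \<rho> where \<rho>: "flat {0..1} r \<rho>" "\<rho> k0 0 = id"
      using transport_along[OF r r01(1) x0(2,3)] by blast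
    have U: "\<gamma> t \<in> U k" if "0 \<le> t" "t \<le> 1" for t using \<gamma>(2) that by (auto simp: image_subset_iff)
    have "\<rho> k (1/2) = \<sigma> k 1"
      by (rule flat_first_half[where h = \<gamma> and g = g and ?k0.0 = k0])
        (use \<rho> g k x0 U[of 0] in \<open>auto simp: r_def\<close>)
    moreover have f: "flat {0..1} \<gamma> (\<lambda>k t. \<rho> k (1/2 + t / 2))"
      by (rule flat_compose[OF \<rho>(1)]) (use g(3) in \<open>auto simp: r_def field_simps intro!: continuous_intros\<close>)
    moreover have "\<rho> k (1/2 + 1/2) = \<rho> k (1/2 + 0/2)"
      by (rule flat_constant_in_patch[OF connected_Icc _ f k, of 0 1])
        (use U \<gamma>(1) in \<open>auto simp: pathin_def\<close>)
    ultimately show "b k (\<gamma> 1) = b k (\<gamma> 0)"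
      using at[OF r r01 \<rho> k] at[OF g k] U[of 0] U[of 1] by simp
  qed
qed

end

section \<open>Affine Legendre equivalences and developments\<close>

text \<open>A flattening chart maps a piece of the submanifold onto an open part of a linear
  subspace. Consequently components of open parts are open, and components coincide with path
  components, which links the componentwise gluing data to paths.\<close>

lemma submanifold_locally_path_connected:
  fixes A :: "'a::euclidean_space set"
  assumes "submanifold k A" shows "locally path_connected A"
proof (rule locally_path_connected_1)
  fix v x assume v: "openin (top_of_set A) v" "x \<in> v"
  then have "x \<in> A" using openin_imp_subset by blast
  then obtain U V :: "'a set" and \<phi> \<psi> T where U: "open U" "open V" "x \<in> U" "homeomorphism U V \<phi> \<psi>"
    "subspace T" "\<phi> ` (A \<inter> U) = T \<inter> V"
    using assms unfolding submanifold_def by metis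
  have "locally path_connected (T \<inter> V)"
    by (rule locally_open_subset[OF convex_imp_locally_path_connected[OF subspace_imp_convex[OF U(5)]]])
      (rule openin_open_Int[OF U(2)])
  moreover have "(A \<inter> U) homeomorphic (T \<inter> V)"
    unfolding homeomorphic_def
    using homeomorphism_of_subsets[OF U(4), of "A \<inter> U" "T \<inter> V"] U(6) by blast
  ultimately have lpc: "locally path_connected (A \<inter> U)"
    using homeomorphic_locally[of "A \<inter> U" "T \<inter> V" path_connected path_connected] homeomorphic_path_connectedness
    by blast
  have "v \<inter> U = (A \<inter> U) \<inter> v" using openin_imp_subset[OF v(1)] by blast
  moreover obtain W where "open W" "v = A \<inter> W" using v(1) openin_open by metis
  ultimately have "openin (top_of_set (A \<inter> U)) (v \<inter> U)"
    by (auto simp: openin_open intro!: exI[of _ W])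
  then obtain u where u: "openin (top_of_set (A \<inter> U)) u" "path_connected u" "x \<in> u" "u \<subseteq> v \<inter> U"
    using lpc v(2) U(3) unfolding locally_path_connected by (metis IntI)
  have "openin (top_of_set A) (A \<inter> U)" using U(1) by (rule openin_open_Int)
  then have "openin (top_of_set A) u" using u(1) openin_trans by blast
  then show "\<exists>u. openin (top_of_set A) u \<and> path_connected u \<and> x \<in> u \<and> u \<subseteq> v" using u by blast
qed

section \<open>The group of affine Legendre equivalences\<close>

lemma matrix_inv_unique:
  fixes A :: "real^'n^'n"
  assumes "A ** B = mat 1" shows "matrix_inv A = B"
proof -
  have BA: "B ** A = mat 1" using assms matrix_left_right_inverse by blast
  have "A ** matrix_inv A = mat 1 \<and> matrix_inv A ** A = mat 1"
    unfolding matrix_inv_def by (rule someI[of _ B]) (use assms BA in simp)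
  then have "matrix_inv A ** A ** B = B" by simp
  then show ?thesis using assms by (simp flip: matrix_mul_assoc)
qed

text \<open>The pair A and (A^T)^{-1} is replaced by two linear maps tied by preservation of the
  pairing. This form involves no matrix inverse and is symmetric, so x and p can later exchange
  roles.\<close>

lemma affine_legendreE:
  assumes "affine_legendre F"
  obtains A B :: "real^'n::finite \<Rightarrow> real^'n" and b c d where "linear A" "linear B" "\<And>v w. A v \<bullet> B w = v \<bullet> w"
    "F = (\<lambda>(x, p, z). (A x + b, B (p + c), z + c \<bullet> x + d))"
proof -
  obtain A :: "real^'n^'n" and b c d where A: "invertible A"
    "F = (\<lambda>(x, p, z). (A *v x + b, matrix_inv (transpose A) *v p + matrix_inv (transpose A) *v c, z + c \<bullet> x + d))"
    using assms unfolding affine_legendre_def by blast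
  obtain C where "C ** A = mat 1" using A(1) unfolding invertible_def by blast
  then have B: "transpose A ** transpose C = mat 1" by (metis matrix_transpose_mul transpose_mat)
  define B where "B = transpose C"
  note B = B[folded B_def]
  have "(A *v v) \<bullet> (B *v w) = v \<bullet> w" for v w
  proof -
    have "(A *v v) \<bullet> (B *v w) = ((B *v w) v* A) \<bullet> v"
      by (simp only: dot_lmul_matrix) (rule inner_commute)
    also have "(B *v w) v* A = (transpose A ** B) *v w"
      by (simp flip: matrix_vector_mul_assoc)
    finally show ?thesis using B by (simp add: inner_commute)
  qed
  then show thesis
    using that[of "(*v) A" "(*v) B" b c d] A(2) matrix_inv_unique[OF B]
    by (simp add: matrix_vector_right_distrib)
qed

lemma affine_legendreI:
  fixes A B :: "real^'n::finite \<Rightarrow> real^'n"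
  assumes "linear A" "linear B" "\<And>v w. A v \<bullet> B w = v \<bullet> w"
    "F = (\<lambda>(x, p, z). (A x + b, B (p + c), z + c \<bullet> x + d))"
  shows "affine_legendre F"
proof -
  define A' B' where "A' = matrix A" and "B' = matrix B"
  have A: "A = (*v) A'" and B: "B = (*v) B'"
    using assms(1,2) by (auto simp: matrix_works A'_def B'_def)
  have "(transpose A' ** B') *v w = mat 1 *v w" for w
  proof -
    have "(B w v* A') \<bullet> v = w \<bullet> v" for v
      unfolding dot_lmul_matrix using assms(3)[of v w] A by (simp add: inner_commute)
    then have "B w v* A' = w" using vector_eq_rdot by blast
    then show ?thesis using B by (simp flip: matrix_vector_mul_assoc)
  qed
  then have AB: "transpose A' ** B' = mat 1" by (simp add: matrix_eq)
  then have "transpose B' ** A' = mat 1" by (metis matrix_transpose_mul transpose_mat transpose_transpose)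
  then have "invertible A'" using matrix_left_right_inverse unfolding invertible_def by blast
  moreover have "F = (\<lambda>(x, p, z). (A' *v x + b,
      matrix_inv (transpose A') *v p + matrix_inv (transpose A') *v c, z + c \<bullet> x + d))"
    using assms(4) A B matrix_inv_unique[OF AB] by (simp add: fun_eq_iff matrix_vector_right_distrib)
  ultimately show ?thesis unfolding affine_legendre_def by blast
qed

lemma affine_legendre_id: "affine_legendre id"
  by (rule affine_legendreI[of "\<lambda>x. x" "\<lambda>x. x" _ 0 0 0]) (auto simp: linear_iff)

text \<open>\<open>A v\<close> determines every \<open>v \<bullet> u\<close> through the pairing, so
  \<open>A\<close> is injective; finite dimension does the rest.\<close>

lemma dual_linear_bij:
  fixes A B :: "'a::euclidean_space \<Rightarrow> 'a"
  assumes "linear A" "\<And>v w. A v \<bullet> B w = v \<bullet> w" shows "bij A"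
proof -
  have "inj A"
  proof (rule injI)
    fix v w assume "A v = A w"
    then have "v \<bullet> u = w \<bullet> u" for u using assms(2) by metis
    then show "v = w" by (metis vector_eq_rdot)
  qed
  then show ?thesis using assms(1) eucl.linear_inj_imp_surj by (simp add: bij_def linear_injective_imp_surjective)
qed

lemma affine_legendre_comp:
  assumes "affine_legendre F" "affine_legendre F'" shows "affine_legendre (F' \<circ> F :: 'n::finite jet \<Rightarrow> 'n jet)"
proof -
  obtain A B :: "real^'n \<Rightarrow> real^'n" and b c d where F: "linear A" "linear B" "\<And>v w. A v \<bullet> B w = v \<bullet> w"
    "F = (\<lambda>(x, p, z). (A x + b, B (p + c), z + c \<bullet> x + d))"
    using affine_legendreE[OF assms(1)] by blast
  obtain A' B' :: "real^'n \<Rightarrow> real^'n" and b' c' d' where F': "linear A'" "linear B'" "\<And>v w. A' v \<bullet> B' w = v \<bullet> w"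
    "F' = (\<lambda>(x, p, z). (A' x + b', B' (p + c'), z + c' \<bullet> x + d'))"
    using affine_legendreE[OF assms(2)] by blast
  \<comment> \<open>\<open>e\<close> is the covector \<open>c'\<close> pulled back through
    \<open>A\<close>: it lets B'(B(p + c) + c') be written as B'B(p + (c + e)).\<close>
  obtain e where e: "B e = c'"
    using dual_linear_bij[OF F(2), of A] F(3) by (metis bij_def inner_commute surjD)
  have "c' \<bullet> A x = e \<bullet> x" for x using F(3)[of x e] e by (simp add: inner_commute)
  then show ?thesis
    by (intro affine_legendreI[of "A' \<circ> A" "B' \<circ> B" _ "A' b + b'" "c + e" "d + d' + c' \<bullet> b"])
      (use F F' e in \<open>auto simp: linear_compose fun_eq_iff linear_add algebra_simps inner_add_right inner_add_left\<close>)
qed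

lemma affine_legendre_inverse:
  fixes F :: "'n::finite jet \<Rightarrow> 'n jet"
  assumes "affine_legendre F" obtains F' where "affine_legendre F'" "F' \<circ> F = id" "F \<circ> F' = id"
proof -
  obtain A B :: "real^'n \<Rightarrow> real^'n" and b c d where F: "linear A" "linear B" "\<And>v w. A v \<bullet> B w = v \<bullet> w"
    "F = (\<lambda>(x, p, z). (A x + b, B (p + c), z + c \<bullet> x + d))"
    using affine_legendreE[OF assms(1)] by blast
  have bij: "bij A" "bij B" using dual_linear_bij[OF F(1), of B] dual_linear_bij[OF F(2), of A] F(3)
    by (auto simp: inner_commute)
  define A' B' where "A' = inv A" and "B' = inv B"
  have i: "A (A' v) = v" "A' (A v) = v" "B (B' v) = v" "B' (B v) = v" for v
    using bij by (auto simp: A'_def B'_def bij_def surj_f_inv_f)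
  have lin: "linear A'" "linear B'"
    using F(1,2) bij by (auto simp: A'_def B'_def bij_def intro: inj_linear_imp_inv_linear)
  have d: "A' v \<bullet> B' w = v \<bullet> w" for v w using F(3)[of "A' v" "B' w"] i by simp
  \<comment> \<open>The three components solved for the old coordinates; the covector of the inverse
    is \<open>- B c\<close>, since c . A' x = B c . x.\<close>
  define F' where "F' = (\<lambda>(x, p, z). (A' x - A' b, B' (p - B c), z - B c \<bullet> x + (c \<bullet> A' b - d)))"
  have cA: "B c \<bullet> x = c \<bullet> A' x" for x using F(3)[of "A' x" c] i by (simp add: inner_commute)
  have "affine_legendre F'"
    by (rule affine_legendreI[OF lin d, of _ "- A' b" "- B c"]) (auto simp: F'_def)
  moreover have "F' \<circ> F = id" "F \<circ> F' = id"
    by (auto simp: F'_def F(4) fun_eq_iff i cA linear_add[OF F(1)] linear_diff[OF F(1)] linear_add[OF F(2)]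
        linear_diff[OF F(2)] linear_add[OF lin(1)] linear_diff[OF lin(1)] linear_add[OF lin(2)] linear_diff[OF lin(2)]
        inner_add_right inner_diff_right)
  ultimately show thesis using that by blast
qed

text \<open>\<open>L\<close> is the differential of \<open>F\<close>. The contact form is preserved
  because the term c . dx added to dz is cancelled by the c in B(p + c), once the pairing with A dx
  is simplified.\<close>

lemma affine_legendre_differential:
  fixes F :: "'n::finite jet \<Rightarrow> 'n jet"
  assumes "affine_legendre F"
  obtains A B :: "real^'n \<Rightarrow> real^'n" and L k where "linear A" "linear B" "\<And>v w. A v \<bullet> B w = v \<bullet> w"
    "bounded_linear L" "\<And>q. F q = L q + k" "\<And>u. xc (L u) = A (xc u)" "\<And>u. pc (L u) = B (pc u)"
    "\<And>q u. contact_form (F q) (L u) = contact_form q u"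
proof -
  obtain A B :: "real^'n \<Rightarrow> real^'n" and b c d where F: "linear A" "linear B" "\<And>v w. A v \<bullet> B w = v \<bullet> w"
    "F = (\<lambda>(x, p, z). (A x + b, B (p + c), z + c \<bullet> x + d))"
    using affine_legendreE[OF assms(1)] by blast
  define L where "L = (\<lambda>(x, p, z::real). (A x, B p, z + c \<bullet> x))"
  have "linear L"
    by (rule linearI) (auto simp: L_def linear_add[OF F(1)] linear_add[OF F(2)] linear_cmul[OF F(1)]
        linear_cmul[OF F(2)] inner_add_right algebra_simps)
  then have "bounded_linear L" by (simp add: linear_conv_bounded_linear)
  moreover have "F q = L q + (b, B c, d)" for q
    by (cases q) (simp add: F(4) L_def linear_add[OF F(2)])
  moreover have "xc (L u) = A (xc u)" "pc (L u) = B (pc u)" for u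
    by (cases u, simp add: L_def xc_def pc_def)+
  moreover have "contact_form (F q) (L u) = contact_form q u" for q u
    using F(3)[of "xc u" "pc q + c"]
    by (cases q, cases u) (simp add: F(4) L_def contact_form_def xc_def pc_def zc_def inner_commute inner_add_left inner_add_right)
  ultimately show thesis using that F(1-3) by blast
qed

text \<open>The interface through which a single local model and a quasi-Hessian manifold are
  treated alike.\<close>

locale glued =
  fixes G :: "('i, 'n::finite) gluing"
  assumes legendre: "\<And>\<alpha>. \<alpha> \<in> idx G \<Longrightarrow> legendre_submanifold (mdl G \<alpha>)"
    and ovl_refl: "\<And>\<alpha>. \<alpha> \<in> idx G \<Longrightarrow> ovl G \<alpha> \<alpha> = mdl G \<alpha>"
    and glue_refl: "\<And>\<alpha> y. \<alpha> \<in> idx G \<Longrightarrow> y \<in> mdl G \<alpha> \<Longrightarrow> glue_map G \<alpha> \<alpha> y = y"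
    and ovl_open: "\<And>\<alpha> \<beta>. \<alpha> \<in> idx G \<Longrightarrow> \<beta> \<in> idx G \<Longrightarrow> openin (top_of_set (mdl G \<alpha>)) (ovl G \<alpha> \<beta>)"
    and glue_continuous: "\<And>\<alpha> \<beta>. \<alpha> \<in> idx G \<Longrightarrow> \<beta> \<in> idx G \<Longrightarrow> continuous_on (ovl G \<alpha> \<beta>) (glue_map G \<alpha> \<beta>)"
    and glue_in: "\<And>\<alpha> \<beta> y. \<alpha> \<in> idx G \<Longrightarrow> \<beta> \<in> idx G \<Longrightarrow> y \<in> ovl G \<alpha> \<beta> \<Longrightarrow> glue_map G \<alpha> \<beta> y \<in> ovl G \<beta> \<alpha>"
    and equ_affine: "\<And>\<alpha> \<beta> y. \<alpha> \<in> idx G \<Longrightarrow> \<beta> \<in> idx G \<Longrightarrow> y \<in> ovl G \<alpha> \<beta> \<Longrightarrow> affine_legendre (equ G \<alpha> \<beta> y)"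
    and equ_const: "\<And>\<alpha> \<beta> y y'. \<alpha> \<in> idx G \<Longrightarrow> \<beta> \<in> idx G \<Longrightarrow> y \<in> ovl G \<alpha> \<beta> \<Longrightarrow>
      y' \<in> connected_component_set (ovl G \<alpha> \<beta>) y \<Longrightarrow> equ G \<alpha> \<beta> y' = equ G \<alpha> \<beta> y"
    and cocycle: "\<And>\<alpha> \<beta> \<gamma> y. \<alpha> \<in> idx G \<Longrightarrow> \<beta> \<in> idx G \<Longrightarrow> \<gamma> \<in> idx G \<Longrightarrow> y \<in> ovl G \<alpha> \<beta> \<Longrightarrow> y \<in> ovl G \<alpha> \<gamma> \<Longrightarrow>
      glue_map G \<alpha> \<beta> y \<in> ovl G \<beta> \<gamma> \<and>
      equ G \<alpha> \<gamma> y = equ G \<beta> \<gamma> (glue_map G \<alpha> \<beta> y) \<circ> equ G \<alpha> \<beta> y"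

lemma quasi_hessian_glued:
  assumes "quasi_hessian G" shows "glued G"
proof
  fix \<alpha> \<beta> assume i: "\<alpha> \<in> idx G" "\<beta> \<in> idx G"
  then have d: "diffeomorphism (ovl G \<alpha> \<beta>) (ovl G \<beta> \<alpha>) (glue_map G \<alpha> \<beta>)"
    using assms unfolding quasi_hessian_def by blast
  then show "continuous_on (ovl G \<alpha> \<beta>) (glue_map G \<alpha> \<beta>)"
    unfolding diffeomorphism_def by (blast intro: smooth_map_imp_continuous_on)
  show "glue_map G \<alpha> \<beta> y \<in> ovl G \<beta> \<alpha>" if "y \<in> ovl G \<alpha> \<beta>" for y
    using d that unfolding diffeomorphism_def by (blast dest: bij_betwE)
qed (use assms in \<open>unfold quasi_hessian_def, blast\<close>)+

lemma local_model_glued: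
  assumes "legendre_submanifold L" shows "glued (local_model \<alpha> L)"
proof -
  have "glue_map (local_model \<alpha> L) \<beta> \<gamma> = id" for \<beta> \<gamma>
    by (simp add: fun_eq_iff glue_map_def local_model_def)
  then show ?thesis
    by unfold_locales (simp_all add: local_model_def assms affine_legendre_id)
qed

section \<open>The glued space and the existence of a development\<close>

context glued
begin

lemma ovl_subset: "\<alpha> \<in> idx G \<Longrightarrow> \<beta> \<in> idx G \<Longrightarrow> ovl G \<alpha> \<beta> \<subseteq> mdl G \<alpha>"
  using ovl_open openin_imp_subset by blast

lemma locally_path_connected_mdl: "\<alpha> \<in> idx G \<Longrightarrow> locally path_connected (mdl G \<alpha>)"
  using legendre submanifold_locally_path_connected unfolding legendre_submanifold_def by blast

text \<open>The gluing data only say that the self-gluing fixes each point. The cocycle condition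
  makes the attached equivalence idempotent, and an invertible idempotent is the identity.\<close>

lemma equ_refl:
  assumes "\<alpha> \<in> idx G" "y \<in> mdl G \<alpha>" shows "equ G \<alpha> \<alpha> y = id"
proof -
  have y: "y \<in> ovl G \<alpha> \<alpha>" using assms ovl_refl by simp
  have e: "equ G \<alpha> \<alpha> y = equ G \<alpha> \<alpha> y \<circ> equ G \<alpha> \<alpha> y"
    using cocycle[OF assms(1,1,1) y y] glue_refl[OF assms] by simp
  obtain F where F: "F \<circ> equ G \<alpha> \<alpha> y = id"
    using affine_legendre_inverse[OF equ_affine[OF assms(1,1) y]] by blast
  have "F \<circ> equ G \<alpha> \<alpha> y = (F \<circ> equ G \<alpha> \<alpha> y) \<circ> equ G \<alpha> \<alpha> y"
    by (subst e) (simp only: comp_assoc)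
  then show ?thesis using F by simp
qed

lemma glue_glue:
  assumes "\<alpha> \<in> idx G" "\<beta> \<in> idx G" "y \<in> ovl G \<alpha> \<beta>"
  shows "glue_map G \<beta> \<alpha> (glue_map G \<alpha> \<beta> y) = y"
proof -
  have y: "y \<in> mdl G \<alpha>" using ovl_subset assms by blast
  then have "equ G \<alpha> \<alpha> y = equ G \<beta> \<alpha> (glue_map G \<alpha> \<beta> y) \<circ> equ G \<alpha> \<beta> y"
    using cocycle[OF assms(1,2,1) assms(3)] ovl_refl[OF assms(1)] by blast
  from fun_cong[OF this, of y] show ?thesis by (simp add: glue_map_def equ_refl[OF assms(1) y])
qed

lemma glue_trans:
  assumes "\<alpha> \<in> idx G" "\<beta> \<in> idx G" "\<gamma> \<in> idx G" "y \<in> ovl G \<alpha> \<beta>" "glue_map G \<alpha> \<beta> y \<in> ovl G \<beta> \<gamma>"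
  shows "y \<in> ovl G \<alpha> \<gamma> \<and> glue_map G \<alpha> \<gamma> y = glue_map G \<beta> \<gamma> (glue_map G \<alpha> \<beta> y)"
proof -
  \<comment> \<open>The cocycle condition is applied at the glued point with \<beta>, \<alpha>,
    \<gamma> in this order, so that gluing back to \<alpha> puts \<open>y\<close> into the third
    overlap.\<close>
  have y: "y \<in> ovl G \<alpha> \<gamma>"
    using cocycle[OF assms(2,1,3) glue_in[OF assms(1,2,4)] assms(5)] glue_glue[OF assms(1,2,4)] by simp
  then have "equ G \<alpha> \<gamma> y = equ G \<beta> \<gamma> (glue_map G \<alpha> \<beta> y) \<circ> equ G \<alpha> \<beta> y"
    using cocycle[OF assms(1-4)] by blast
  from fun_cong[OF this, of y] show ?thesis using y by (simp add: glue_map_def)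
qed

lemma equiv_glue_rel: "equiv (Sigma (idx G) (mdl G)) (glue_rel G)"
proof (rule equivI)
  show "glue_rel G \<subseteq> Sigma (idx G) (mdl G) \<times> Sigma (idx G) (mdl G)"
    using ovl_subset glue_in unfolding glue_rel_def by blast
  show "refl_on (Sigma (idx G) (mdl G)) (glue_rel G)"
    using ovl_refl glue_refl by (auto simp: refl_on_def glue_rel_def)
  show "sym (glue_rel G)"
    by (rule symI) (auto simp: glue_rel_def glue_in glue_glue)
  show "trans (glue_rel G)"
  proof (rule transI)
    fix u v w assume uv: "(u, v) \<in> glue_rel G" and vw: "(v, w) \<in> glue_rel G"
    obtain \<alpha> y \<beta> \<gamma> where *: "u = (\<alpha>, y)" "\<alpha> \<in> idx G" "\<beta> \<in> idx G" "\<gamma> \<in> idx G" "y \<in> ovl G \<alpha> \<beta>"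
      "glue_map G \<alpha> \<beta> y \<in> ovl G \<beta> \<gamma>" "w = (\<gamma>, glue_map G \<beta> \<gamma> (glue_map G \<alpha> \<beta> y))"
      using uv vw unfolding glue_rel_def by blast
    then show "(u, w) \<in> glue_rel G"
      using glue_trans[OF *(2-6)] by (simp add: glue_rel_def)
  qed
qed

lemma pt_eq_iff:
  assumes "\<alpha> \<in> idx G" "\<beta> \<in> idx G" "y \<in> mdl G \<alpha>" "y' \<in> mdl G \<beta>"
  shows "pt G \<alpha> y = pt G \<beta> y' \<longleftrightarrow> y \<in> ovl G \<alpha> \<beta> \<and> y' = glue_map G \<alpha> \<beta> y"
  unfolding pt_def using eq_equiv_class_iff[OF equiv_glue_rel, of "(\<alpha>, y)" "(\<beta>, y')"] assms
  by (auto simp: glue_rel_def)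

lemma pt_inj: "\<alpha> \<in> idx G \<Longrightarrow> y \<in> mdl G \<alpha> \<Longrightarrow> y' \<in> mdl G \<alpha> \<Longrightarrow> pt G \<alpha> y = pt G \<alpha> y' \<longleftrightarrow> y = y'"
  using pt_eq_iff[of \<alpha> \<alpha> y y'] glue_refl ovl_refl by auto

lemma pt_in: "\<alpha> \<in> idx G \<Longrightarrow> y \<in> mdl G \<alpha> \<Longrightarrow> pt G \<alpha> y \<in> points G"
  unfolding points_def pt_def by (rule quotientI) simp

lemma points_cases:
  assumes "x \<in> points G" obtains \<alpha> y where "\<alpha> \<in> idx G" "y \<in> mdl G \<alpha>" "x = pt G \<alpha> y"
  using assms unfolding points_def pt_def by (auto elim!: quotientE)

lemma topspace_glued: "topspace (glued_topology G) = points G"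
proof
  show "topspace (glued_topology G) \<subseteq> points G"
    using openin_glued_topology[of G "topspace (glued_topology G)"] by simp
  have "{y \<in> mdl G \<alpha>. pt G \<alpha> y \<in> points G} = mdl G \<alpha>" if "\<alpha> \<in> idx G" for \<alpha>
    using pt_in[OF that] by blast
  then have "openin (glued_topology G) (points G)"
    by (simp add: openin_glued_topology)
  then show "points G \<subseteq> topspace (glued_topology G)" by (rule openin_subset)
qed

lemma pt_continuous: "\<alpha> \<in> idx G \<Longrightarrow> continuous_map (top_of_set (mdl G \<alpha>)) (glued_topology G) (pt G \<alpha>)"
  by (auto simp: continuous_map_def topspace_glued pt_in openin_glued_topology)

text \<open>Local models sit in the quotient as open patches: seen from another model, the
  saturation of \<open>Q\<close> is the preimage of \<open>Q\<close> under the gluing map, open in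
  an overlap that is itself open.\<close>

lemma pt_open:
  assumes \<alpha>: "\<alpha> \<in> idx G" and Q: "openin (top_of_set (mdl G \<alpha>)) Q"
  shows "openin (glued_topology G) (pt G \<alpha> ` Q)"
  unfolding openin_glued_topology
proof (intro conjI ballI)
  have OM: "Q \<subseteq> mdl G \<alpha>" using Q openin_imp_subset by blast
  then show "pt G \<alpha> ` Q \<subseteq> points G" using pt_in \<alpha> by blast
  fix \<beta> assume \<beta>: "\<beta> \<in> idx G"
  have "{y \<in> mdl G \<beta>. pt G \<beta> y \<in> pt G \<alpha> ` Q} = {y \<in> ovl G \<beta> \<alpha>. glue_map G \<beta> \<alpha> y \<in> Q}"
  proof (intro set_eqI iffI)
    fix y assume "y \<in> {y \<in> mdl G \<beta>. pt G \<beta> y \<in> pt G \<alpha> ` Q}"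
    then obtain y' where "y \<in> mdl G \<beta>" "y' \<in> Q" "pt G \<beta> y = pt G \<alpha> y'" by blast
    then show "y \<in> {y \<in> ovl G \<beta> \<alpha>. glue_map G \<beta> \<alpha> y \<in> Q}"
      using pt_eq_iff[OF \<beta> \<alpha>, of y y'] OM by auto
  next
    fix y assume y: "y \<in> {y \<in> ovl G \<beta> \<alpha>. glue_map G \<beta> \<alpha> y \<in> Q}"
    then have "y \<in> mdl G \<beta>" using ovl_subset[OF \<beta> \<alpha>] by blast
    then show "y \<in> {y \<in> mdl G \<beta>. pt G \<beta> y \<in> pt G \<alpha> ` Q}"
      using pt_eq_iff[OF \<beta> \<alpha>, of y "glue_map G \<beta> \<alpha> y"] y OM by auto
  qed
  moreover have "openin (top_of_set (ovl G \<beta> \<alpha>)) {y \<in> ovl G \<beta> \<alpha>. glue_map G \<beta> \<alpha> y \<in> Q}"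
    using openin_continuous_map_preimage[of "top_of_set (ovl G \<beta> \<alpha>)" "top_of_set (mdl G \<alpha>)" "glue_map G \<beta> \<alpha>" Q]
      glue_continuous[OF \<beta> \<alpha>] glue_in[OF \<beta> \<alpha>] ovl_subset[OF \<alpha> \<beta>] Q by fastforce
  ultimately show "openin (top_of_set (mdl G \<beta>)) {y \<in> mdl G \<beta>. pt G \<beta> y \<in> pt G \<alpha> ` Q}"
    using openin_trans[OF _ ovl_open[OF \<beta> \<alpha>]] by simp
qed

text \<open>The component of \<open>y\<close> in the overlap serves as \<open>Q\<close>; it is open
  because local models are locally connected.\<close>

lemma equ_locally_constant:
  assumes "\<alpha> \<in> idx G" "\<beta> \<in> idx G" "y \<in> ovl G \<alpha> \<beta>"
  obtains Q where "openin (top_of_set (mdl G \<alpha>)) Q" "y \<in> Q" "Q \<subseteq> ovl G \<alpha> \<beta>"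
    "\<And>y'. y' \<in> Q \<Longrightarrow> equ G \<alpha> \<beta> y' = equ G \<alpha> \<beta> y"
proof
  show "openin (top_of_set (mdl G \<alpha>)) (connected_component_set (ovl G \<alpha> \<beta>) y)"
    using locally_connected_2[OF locally_path_connected_imp_locally_connected[OF locally_path_connected_mdl]]
      ovl_open assms by blast
  show "y \<in> connected_component_set (ovl G \<alpha> \<beta>) y" using assms(3) by simp
  show "connected_component_set (ovl G \<alpha> \<beta>) y \<subseteq> ovl G \<alpha> \<beta>" by (rule connected_component_subset)
  show "equ G \<alpha> \<beta> y' = equ G \<alpha> \<beta> y" if "y' \<in> connected_component_set (ovl G \<alpha> \<beta>) y" for y'
    using equ_const[OF assms that] .
qed

text \<open>Near time \<open>t\<close> the curve stays where the gluing equivalence does not change,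
  so it is moved to model \<alpha> by one affine map of the ambient space and remains
  smooth.\<close>

lemma change_model:
  fixes t \<epsilon> :: real
  assumes \<alpha>\<beta>: "\<alpha> \<in> idx G" "\<beta> \<in> idx G" and \<gamma>: "\<epsilon> > 0" "smooth_on {t-\<epsilon><..<t+\<epsilon>} \<gamma>"
    and mdl: "\<And>s. s \<in> {t-\<epsilon><..<t+\<epsilon>} \<Longrightarrow> \<gamma> s \<in> mdl G \<beta>" and y: "y \<in> mdl G \<alpha>" "pt G \<alpha> y = pt G \<beta> (\<gamma> t)"
  obtains \<delta> \<gamma>' where "\<delta> > 0" "\<delta> \<le> \<epsilon>" "smooth_on {t-\<delta><..<t+\<delta>} \<gamma>'"
    "\<And>s. s \<in> {t-\<delta><..<t+\<delta>} \<Longrightarrow> \<gamma>' s \<in> mdl G \<alpha> \<and> pt G \<alpha> (\<gamma>' s) = pt G \<beta> (\<gamma> s)"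
proof -
  let ?I = "{t-\<epsilon><..<t+\<epsilon>}"
  have t: "t \<in> ?I" using \<gamma>(1) by simp
  have "\<gamma> t \<in> ovl G \<beta> \<alpha>" using pt_eq_iff[OF \<alpha>\<beta>(2,1) mdl[OF t] y(1)] y(2) by simp
  then obtain Q where Q: "openin (top_of_set (mdl G \<beta>)) Q" "\<gamma> t \<in> Q" "Q \<subseteq> ovl G \<beta> \<alpha>"
    "\<And>y'. y' \<in> Q \<Longrightarrow> equ G \<beta> \<alpha> y' = equ G \<beta> \<alpha> (\<gamma> t)"
    using equ_locally_constant[OF \<alpha>\<beta>(2,1)] by blast
  obtain W where W: "open W" "Q = mdl G \<beta> \<inter> W" using Q(1) openin_open by metis
  have "open (?I \<inter> \<gamma> -` W)"
    using continuous_open_preimage[OF smooth_on_imp_continuous_on[OF \<gamma>(2)] _ W(1)] by simp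
  moreover have "t \<in> ?I \<inter> \<gamma> -` W" using t Q(2) W(2) by blast
  ultimately obtain e where e: "e > 0" "ball t e \<subseteq> ?I \<inter> \<gamma> -` W"
    using open_contains_ball by blast
  define \<delta> where "\<delta> = min e \<epsilon>"
  have \<delta>: "\<delta> > 0" "\<delta> \<le> \<epsilon>" "{t-\<delta><..<t+\<delta>} \<subseteq> ball t e" "{t-\<delta><..<t+\<delta>} \<subseteq> ?I"
    using e \<gamma>(1) by (auto simp: \<delta>_def dist_real_def)
  let ?F = "equ G \<beta> \<alpha> (\<gamma> t)"
  have in_Q: "\<gamma> s \<in> Q" if "s \<in> {t-\<delta><..<t+\<delta>}" for s
    using that \<delta>(3,4) e(2) mdl W(2) by blast
  have glue: "?F (\<gamma> s) = glue_map G \<beta> \<alpha> (\<gamma> s)" if "s \<in> {t-\<delta><..<t+\<delta>}" for s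
    using Q(4)[OF in_Q[OF that]] by (simp add: glue_map_def)
  obtain L k where L: "bounded_linear L" "\<And>q. ?F q = L q + k"
    using affine_legendre_differential[OF equ_affine[OF \<alpha>\<beta>(2,1)]] Q(2,3) by (metis subsetD)
  have "smooth_on {t-\<delta><..<t+\<delta>} (\<lambda>s. ?F (\<gamma> s))"
    unfolding L(2) using smooth_on_affine[OF _ L(1) smooth_on_subset[OF \<gamma>(2) \<delta>(4)]] by simp
  moreover have "?F (\<gamma> s) \<in> mdl G \<alpha> \<and> pt G \<alpha> (?F (\<gamma> s)) = pt G \<beta> (\<gamma> s)"
    if s: "s \<in> {t-\<delta><..<t+\<delta>}" for s
  proof -
    have o: "\<gamma> s \<in> ovl G \<beta> \<alpha>" using in_Q[OF s] Q(3) by blast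
    have m: "?F (\<gamma> s) \<in> mdl G \<alpha>"
      using subsetD[OF ovl_subset[OF \<alpha>\<beta>] glue_in[OF \<alpha>\<beta>(2,1) o]] glue[OF s] by simp
    have "pt G \<beta> (\<gamma> s) = pt G \<alpha> (?F (\<gamma> s))"
      using pt_eq_iff[OF \<alpha>\<beta>(2,1) mdl[OF subsetD[OF \<delta>(4) s]] m] o glue[OF s] by blast
    then show ?thesis using m by simp
  qed
  ultimately show thesis using that \<delta>(1,2) by blast
qed

definition coordinate :: "'i \<Rightarrow> ('i \<times> 'n jet) set \<Rightarrow> 'n jet" where
  "coordinate \<alpha> = the_inv_into (mdl G \<alpha>) (pt G \<alpha>)"

lemma coordinate_pt: "\<alpha> \<in> idx G \<Longrightarrow> y \<in> mdl G \<alpha> \<Longrightarrow> coordinate \<alpha> (pt G \<alpha> y) = y"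
  unfolding coordinate_def by (rule the_inv_into_f_f) (auto simp: inj_on_def pt_inj)

text \<open>Patches are the images of the local models and the group consists of the affine Legendre
  equivalences. A global flat section of this system supplies the family of maps that
  \<open>is_development\<close> demands.\<close>

lemma local_system_equ:
  "local_system (glued_topology G) (idx G) (\<lambda>\<alpha>. pt G \<alpha> ` mdl G \<alpha>)
     (\<lambda>\<alpha> \<beta> x. equ G \<alpha> \<beta> (coordinate \<alpha> x)) (Collect affine_legendre)"
proof
  have U: "\<exists>y. y \<in> mdl G \<alpha> \<and> x = pt G \<alpha> y" if "x \<in> pt G \<alpha> ` mdl G \<alpha>" for x \<alpha> using that by blast
  have ovl: "y \<in> ovl G \<alpha> \<beta>"
    if "\<alpha> \<in> idx G" "\<beta> \<in> idx G" "y \<in> mdl G \<alpha>" "pt G \<alpha> y \<in> pt G \<beta> ` mdl G \<beta>" for \<alpha> \<beta> y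
    using that pt_eq_iff[OF that(1,2,3)] by blast
  show "\<exists>\<alpha>\<in>idx G. x \<in> pt G \<alpha> ` mdl G \<alpha>" if "x \<in> topspace (glued_topology G)" for x
    using that points_cases unfolding topspace_glued by (metis imageI)
  show "equ G \<alpha> \<alpha> (coordinate \<alpha> x) = id" if "\<alpha> \<in> idx G" "x \<in> pt G \<alpha> ` mdl G \<alpha>" for \<alpha> x
    using U[OF that(2)] that(1) by (auto simp: coordinate_pt equ_refl)
  show "id \<in> Collect affine_legendre" by (simp add: affine_legendre_id)
  show "g \<circ> h \<in> Collect affine_legendre" if "g \<in> Collect affine_legendre" "h \<in> Collect affine_legendre"
    for g h :: "'n jet \<Rightarrow> 'n jet"
    using that affine_legendre_comp by simp
  show "\<exists>h\<in>Collect affine_legendre. h \<circ> g = id \<and> g \<circ> h = id" if "g \<in> Collect affine_legendre"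
    for g :: "'n jet \<Rightarrow> 'n jet"
    using that affine_legendre_inverse by (metis mem_Collect_eq)
  fix \<alpha> \<beta> x assume i: "\<alpha> \<in> idx G" "\<beta> \<in> idx G" and x: "x \<in> pt G \<alpha> ` mdl G \<alpha>" "x \<in> pt G \<beta> ` mdl G \<beta>"
  obtain y where y: "y \<in> mdl G \<alpha>" "x = pt G \<alpha> y" using U[OF x(1)] by blast
  have y\<beta>: "y \<in> ovl G \<alpha> \<beta>" using ovl[OF i y(1)] x(2) y(2) by simp
  show "equ G \<alpha> \<beta> (coordinate \<alpha> x) \<in> Collect affine_legendre"
    using equ_affine[OF i y\<beta>] y coordinate_pt[OF i(1)] by simp
  obtain Q where Q: "openin (top_of_set (mdl G \<alpha>)) Q" "y \<in> Q" "Q \<subseteq> ovl G \<alpha> \<beta>"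
    "\<And>y'. y' \<in> Q \<Longrightarrow> equ G \<alpha> \<beta> y' = equ G \<alpha> \<beta> y"
    using equ_locally_constant[OF i y\<beta>] by blast
  have Q': "pt G \<alpha> y' \<in> pt G \<beta> ` mdl G \<beta>" if "y' \<in> Q" for y'
  proof -
    have "y' \<in> ovl G \<alpha> \<beta>" using Q(3) that by blast
    then have "pt G \<alpha> y' = pt G \<beta> (glue_map G \<alpha> \<beta> y')" "glue_map G \<alpha> \<beta> y' \<in> mdl G \<beta>"
      using pt_eq_iff[OF i, of y' "glue_map G \<alpha> \<beta> y'"] glue_in[OF i] ovl_subset[OF i] ovl_subset[OF i(2,1)]
      by blast+
    then show ?thesis by blast
  qed
  show "\<exists>N. openin (glued_topology G) N \<and> x \<in> N \<and> N \<subseteq> pt G \<alpha> ` mdl G \<alpha> \<inter> pt G \<beta> ` mdl G \<beta> \<and>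
      (\<forall>x'\<in>N. equ G \<alpha> \<beta> (coordinate \<alpha> x') = equ G \<alpha> \<beta> (coordinate \<alpha> x))"
  proof (intro exI conjI ballI)
    show "openin (glued_topology G) (pt G \<alpha> ` Q)" by (rule pt_open[OF i(1) Q(1)])
    have QM: "Q \<subseteq> mdl G \<alpha>" using Q(1) openin_imp_subset by blast
    show "x \<in> pt G \<alpha> ` Q" "pt G \<alpha> ` Q \<subseteq> pt G \<alpha> ` mdl G \<alpha> \<inter> pt G \<beta> ` mdl G \<beta>"
      using y(2) Q(2) Q' QM by auto
    show "equ G \<alpha> \<beta> (coordinate \<alpha> x') = equ G \<alpha> \<beta> (coordinate \<alpha> x)" if "x' \<in> pt G \<alpha> ` Q" for x'
      using that QM Q(4) y by (auto simp: coordinate_pt[OF i(1)] subset_iff)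
  qed
  fix \<gamma> assume \<gamma>: "\<gamma> \<in> idx G" "x \<in> pt G \<gamma> ` mdl G \<gamma>"
  have y\<gamma>: "y \<in> ovl G \<alpha> \<gamma>" using ovl[OF i(1) \<gamma>(1) y(1)] \<gamma>(2) y(2) by simp
  have g: "glue_map G \<alpha> \<beta> y \<in> mdl G \<beta>" using glue_in[OF i y\<beta>] ovl_subset[OF i(2,1)] by blast
  then have "x = pt G \<beta> (glue_map G \<alpha> \<beta> y)" using pt_eq_iff[OF i y(1) g] y\<beta> y(2) by simp
  then have "coordinate \<beta> x = glue_map G \<alpha> \<beta> y" using coordinate_pt[OF i(2) g] by simp
  then show "equ G \<alpha> \<gamma> (coordinate \<alpha> x) = equ G \<beta> \<gamma> (coordinate \<beta> x) \<circ> equ G \<alpha> \<beta> (coordinate \<alpha> x)"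
    using cocycle[OF i \<gamma>(1) y\<beta> y\<gamma>] coordinate_pt[OF i(1) y(1)] y(2) by simp
qed

theorem development_exists:
  assumes "simply_connected_space (glued_topology G)"
  shows "\<exists>f. is_development G f"
proof -
  interpret local_system "glued_topology G" "idx G" "\<lambda>\<alpha>. pt G \<alpha> ` mdl G \<alpha>"
    "\<lambda>\<alpha> \<beta> x. equ G \<alpha> \<beta> (coordinate \<alpha> x)" "Collect affine_legendre"
    by (rule local_system_equ)
  obtain b where b:
    "\<And>\<alpha> x. \<alpha> \<in> idx G \<Longrightarrow> x \<in> topspace (glued_topology G) \<Longrightarrow> x \<in> pt G \<alpha> ` mdl G \<alpha> \<Longrightarrow> b \<alpha> x \<in> Collect affine_legendre"
    "\<And>\<alpha> \<beta> x. \<alpha> \<in> idx G \<Longrightarrow> \<beta> \<in> idx G \<Longrightarrow> x \<in> topspace (glued_topology G) \<Longrightarrow> x \<in> pt G \<alpha> ` mdl G \<alpha> \<Longrightarrow>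
       x \<in> pt G \<beta> ` mdl G \<beta> \<Longrightarrow> b \<alpha> x = b \<beta> x \<circ> equ G \<alpha> \<beta> (coordinate \<alpha> x)"
    "\<And>\<alpha> \<gamma>. \<alpha> \<in> idx G \<Longrightarrow> pathin (glued_topology G) \<gamma> \<Longrightarrow> \<gamma> ` {0..1} \<subseteq> pt G \<alpha> ` mdl G \<alpha> \<Longrightarrow> b \<alpha> (\<gamma> 1) = b \<alpha> (\<gamma> 0)"
    using global_flat_section[OF assms] by blast
  define B where "B \<alpha> y = b \<alpha> (pt G \<alpha> y)" for \<alpha> y
  have B_equ: "B \<alpha> y = B \<beta> (glue_map G \<alpha> \<beta> y) \<circ> equ G \<alpha> \<beta> y"
    if i: "\<alpha> \<in> idx G" "\<beta> \<in> idx G" and y: "y \<in> ovl G \<alpha> \<beta>" for \<alpha> \<beta> y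
  proof -
    have m: "y \<in> mdl G \<alpha>" "glue_map G \<alpha> \<beta> y \<in> mdl G \<beta>"
      using y ovl_subset[OF i] ovl_subset[OF i(2,1)] glue_in[OF i y] by blast+
    then have e: "pt G \<alpha> y = pt G \<beta> (glue_map G \<alpha> \<beta> y)" using pt_eq_iff[OF i m] y by simp
    have "b \<alpha> (pt G \<alpha> y) = b \<beta> (pt G \<alpha> y) \<circ> equ G \<alpha> \<beta> (coordinate \<alpha> (pt G \<alpha> y))"
    proof (rule b(2)[OF i])
      show "pt G \<alpha> y \<in> topspace (glued_topology G)" using pt_in[OF i(1) m(1)] by (simp add: topspace_glued)
      show "pt G \<alpha> y \<in> pt G \<alpha> ` mdl G \<alpha>" using m(1) by blast
      show "pt G \<alpha> y \<in> pt G \<beta> ` mdl G \<beta>" unfolding e using m(2) by blast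
    qed
    then show ?thesis unfolding B_def coordinate_pt[OF i(1) m(1)] using e by simp
  qed
  \<comment> \<open>The choice of representative is harmless: \<open>B_equ\<close> evaluated at
    \<open>y\<close> turns the value in \<alpha> into the value in \<beta> at the glued
    point.\<close>
  define f where "f x = (case SOME (\<alpha>, y). \<alpha> \<in> idx G \<and> y \<in> mdl G \<alpha> \<and> x = pt G \<alpha> y of (\<alpha>, y) \<Rightarrow> B \<alpha> y y)" for x
  have f: "f (pt G \<alpha> y) = B \<alpha> y y" if \<alpha>: "\<alpha> \<in> idx G" "y \<in> mdl G \<alpha>" for \<alpha> y
  proof -
    let ?P = "\<lambda>(\<beta>, y'). \<beta> \<in> idx G \<and> y' \<in> mdl G \<beta> \<and> pt G \<alpha> y = pt G \<beta> y'"
    obtain \<beta> y' where \<beta>: "(SOME p. ?P p) = (\<beta>, y')" using surj_pair[of "SOME p. ?P p"] by blast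
    have "?P (SOME p. ?P p)" by (rule someI[of ?P "(\<alpha>, y)"]) (use \<alpha> in simp)
    then have p: "\<beta> \<in> idx G" "y' \<in> mdl G \<beta>" "pt G \<alpha> y = pt G \<beta> y'" unfolding \<beta> by auto
    then have "y \<in> ovl G \<alpha> \<beta>" "y' = glue_map G \<alpha> \<beta> y" using pt_eq_iff[OF \<alpha>(1) p(1) \<alpha>(2) p(2)] by auto
    then have "B \<alpha> y y = B \<beta> y' y'" using B_equ[OF \<alpha>(1) p(1)] by (simp add: glue_map_def)
    then show ?thesis unfolding f_def \<beta> by simp
  qed
  have "B \<alpha> y' = B \<alpha> y"
    if \<alpha>: "\<alpha> \<in> idx G" and y: "y' \<in> connected_component_set (mdl G \<alpha>) y" for \<alpha> y y'
  proof -
    \<comment> \<open>Passing from component to path component makes constancy of \<open>b\<close>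
      along paths inside a patch applicable.\<close>
    have "y' \<in> path_component_set (mdl G \<alpha>) y"
      using y path_component_eq_connected_component_set[OF locally_path_connected_mdl[OF \<alpha>]] by simp
    then obtain g where g: "path g" "path_image g \<subseteq> mdl G \<alpha>" "g 0 = y" "g 1 = y'"
      unfolding path_component_def by (auto simp: pathstart_def pathfinish_def)
    then have "pathin (top_of_set (mdl G \<alpha>)) g" by (simp add: pathin_canon_iff path_image_def image_subset_iff_funcset)
    then have "pathin (glued_topology G) (pt G \<alpha> \<circ> g)" using pathin_compose pt_continuous[OF \<alpha>] by blast
    moreover have "(pt G \<alpha> \<circ> g) ` {0..1} \<subseteq> pt G \<alpha> ` mdl G \<alpha>" using g(2) by (auto simp: path_image_def)
    ultimately show ?thesis using b(3)[OF \<alpha>, of "pt G \<alpha> \<circ> g"] g(3,4) by (simp add: B_def)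
  qed
  moreover have "affine_legendre (B \<alpha> y)" if "\<alpha> \<in> idx G" "y \<in> mdl G \<alpha>" for \<alpha> y
    using b(1)[OF that(1), of "pt G \<alpha> y"] that pt_in by (simp add: B_def topspace_glued)
  ultimately have "is_development G f"
    unfolding is_development_def using f B_equ by (intro exI[of _ B]) blast
  then show ?thesis by blast
qed

end

text \<open>Removes the case distinction. For a local model the identity serves as the family of
  equivalences; otherwise the choice in \<open>development\<close> is justified by
  existence.\<close>

lemma with_coordinates_glued_development:
  assumes "with_coordinates M X"
  shows "glued M" "is_development M X"
proof -
  have "glued M \<and> is_development M X"
    using assms unfolding with_coordinates_def
  proof (elim disjE exE conjE)
    fix \<alpha> L assume L: "legendre_submanifold L" "M = local_model \<alpha> L" "\<forall>y\<in>L. X (pt M \<alpha> y) = y"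
    have "is_development M X"
      unfolding is_development_def
      by (rule exI[of _ "\<lambda>_ _. id"]) (use L(2,3) in \<open>auto simp: local_model_def affine_legendre_id\<close>)
    then show ?thesis using local_model_glued[OF L(1)] L(2) by simp
  next
    assume M: "quasi_hessian M" "simply_connected_space (glued_topology M)" "X = development M"
    interpret glued M by (rule quasi_hessian_glued[OF M(1)])
    show ?thesis
      using someI_ex[OF development_exists[OF M(2)]] glued_axioms M(3) by (simp add: development_def)
  qed
  then show "glued M" "is_development M X" by auto
qed

section \<open>Orthogonality and critical points\<close>

text \<open>Tangent vectors are defined by curves at time 0, hence the shift of the parameter by
  \<open>s\<close>.\<close>

lemma velocity_in_tangent_space:
  fixes \<gamma> :: "real \<Rightarrow> 'a::euclidean_space"
  assumes I: "open I" "smooth_on I \<gamma>" "\<gamma> ` I \<subseteq> A" "s \<in> I"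
  shows "vder \<gamma> s \<in> tangent_space A (\<gamma> s)"
proof -
  obtain e where e: "e > 0" "ball s e \<subseteq> I" using I(1,4) open_contains_ball by blast
  have sh: "x + s \<in> I" if "x \<in> {-e<..<e}" for x
    using that e(2) by (auto simp: subset_iff dist_real_def)
  have "smooth_on {-e<..<e} (\<lambda>x. \<gamma> (x + s))"
    by (rule smooth_on_shift[OF I(1,2)]) (use sh in auto)
  moreover have "((\<lambda>x. \<gamma> (x + s)) has_vector_derivative vder \<gamma> s) (at 0)"
    using vder_has_vector_derivative[OF smooth_on_differentiable[OF I(2,4)]]
    by (simp add: has_vector_derivative_def has_derivative_at field_has_derivative_at add.commute)
  moreover have "(\<lambda>x. \<gamma> (x + s)) ` {-e<..<e} \<subseteq> A" using sh I(3) by blast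
  ultimately show ?thesis unfolding tangent_space_def using e(1) by (auto intro!: exI[of _ e] exI[of _ "\<lambda>x. \<gamma> (x + s)"])
qed

text \<open>The pair \<open>(f, g)\<close> is \<open>(p, x)\<close> for \<open>m\<close>-curves and \<open>(x, p)\<close> for \<open>e\<close>-curves; \<open>W r q\<close> is the
  divergence with the argument \<open>r\<close> held fixed.\<close>

locale dual_coordinates =
  fixes f g :: "'n::finite jet \<Rightarrow> real^'n" and fr :: "'n \<Rightarrow> 'n jet \<Rightarrow> (real^'n) \<times> real"
    and P :: "'n jet \<Rightarrow> 'n jet \<Rightarrow> (real^'n) \<times> real" and W :: "'n jet \<Rightarrow> 'n jet \<Rightarrow> real"
  assumes frame: "\<And>i q. fr i q = (axis i 1, g q $ i)"
    and bundle_map: "\<And>q v. contact_form q v = 0 \<Longrightarrow> P q v = (f v, g q \<bullet> f v)"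
    and bounded_linear_f: "bounded_linear f"
    and affine_legendre_dual: "\<And>F. affine_legendre F \<Longrightarrow> \<exists>A B L k. linear A \<and> linear B \<and> (\<forall>v w. A v \<bullet> B w = v \<bullet> w) \<and>
      bounded_linear L \<and> (\<forall>q. F q = L q + k) \<and> (\<forall>u. f (L u) = A (f u)) \<and> (\<forall>u. g (L u) = B (g u)) \<and>
      (\<forall>q u. contact_form (F q) (L u) = contact_form q u)"
    and W_derivative: "\<And>\<gamma> u t r. (\<gamma> has_vector_derivative u) (at t) \<Longrightarrow> contact_form (\<gamma> t) u = 0 \<Longrightarrow>
      ((\<lambda>s. W r (\<gamma> s)) has_real_derivative (f (\<gamma> t) - f r) \<bullet> g u) (at t)"
begin

lemma frame_sum: "(\<Sum>i\<in>UNIV. (a $ i) *\<^sub>R fr i q) = (a, g q \<bullet> a)"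
  by (rule prod_eqI)
    (simp_all add: frame fst_sum snd_sum vec_eq_iff axis_def inner_vec_def mult.commute if_distrib cong: if_cong)

lemma frame_components: "frame_components fr q (a, g q \<bullet> a) = a"
  unfolding frame_components_def frame_sum by auto

lemma nabla_frame:
  "nabla fr \<gamma> \<sigma> s = (vder (\<lambda>s. frame_components fr (\<gamma> s) (\<sigma> s)) s,
     g (\<gamma> s) \<bullet> vder (\<lambda>s. frame_components fr (\<gamma> s) (\<sigma> s)) s)"
  unfolding nabla_def frame_sum vder_def ..

text \<open>For vectors in the kernel of the contact form, the bundle map has components
  \<open>f v\<close> in the flat frame, and covariant differentiation differentiates components. The
  identity is proved at all times of the open set \<open>I\<close>, so that it can be differentiated
  again.\<close>

lemma nabla_iter:
  assumes I: "open I" "smooth_on I \<gamma>" and contact: "\<And>s. s \<in> I \<Longrightarrow> contact_form (\<gamma> s) (vder \<gamma> s) = 0"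
    and s: "s \<in> I"
  shows "(nabla fr \<gamma> ^^ k) (\<lambda>s. P (\<gamma> s) (vector_derivative \<gamma> (at s))) s =
    ((vder ^^ k) (vder (\<lambda>s. f (\<gamma> s))) s, g (\<gamma> s) \<bullet> (vder ^^ k) (vder (\<lambda>s. f (\<gamma> s))) s)"
  using s
proof (induction k arbitrary: s)
  case 0
  then show ?case
    using bundle_map[OF contact[OF 0]] vder_affine[OF bounded_linear_f smooth_on_differentiable[OF I(2) 0], of 0]
    by (simp add: vder_def)
next
  case (Suc k)
  let ?\<sigma> = "(nabla fr \<gamma> ^^ k) (\<lambda>s. P (\<gamma> s) (vector_derivative \<gamma> (at s)))"
  have "vder (\<lambda>s. frame_components fr (\<gamma> s) (?\<sigma> s)) s = vder ((vder ^^ k) (vder (\<lambda>s. f (\<gamma> s)))) s"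
    by (rule vder_cong_open[OF I(1) Suc.prems]) (simp add: Suc.IH frame_components)
  then show ?case unfolding funpow.simps o_apply nabla_frame by simp
qed

lemma straight_at_derivatives:
  assumes I: "open I" "smooth_on I \<gamma>" and contact: "\<And>s. s \<in> I \<Longrightarrow> contact_form (\<gamma> s) (vder \<gamma> s) = 0"
    and t: "t \<in> I" and straight: "straight_at fr P \<gamma> t"
  shows "\<exists>k. (vder ^^ k) (vder (\<lambda>s. f (\<gamma> s))) t \<noteq> 0"
    and "dependent_pair ((vder ^^ j) (vder (\<lambda>s. f (\<gamma> s))) t) ((vder ^^ k) (vder (\<lambda>s. f (\<gamma> s))) t)"
proof -
  let ?V = "\<lambda>k. (nabla fr \<gamma> ^^ k) (\<lambda>s. P (\<gamma> s) (vector_derivative \<gamma> (at s))) t"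
  have V: "\<exists>k. ?V k \<noteq> 0" "\<And>j k. \<exists>a b. (a \<noteq> 0 \<or> b \<noteq> 0) \<and> a *\<^sub>R ?V j + b *\<^sub>R ?V k = 0"
    using straight unfolding straight_at_def Let_def by blast+
  have eq: "?V k = ((vder ^^ k) (vder (\<lambda>s. f (\<gamma> s))) t, g (\<gamma> t) \<bullet> (vder ^^ k) (vder (\<lambda>s. f (\<gamma> s))) t)" for k
    by (rule nabla_iter[OF I contact t])
  show "\<exists>k. (vder ^^ k) (vder (\<lambda>s. f (\<gamma> s))) t \<noteq> 0"
  proof -
    obtain k where "?V k \<noteq> 0" using V(1) by blast
    then have "(vder ^^ k) (vder (\<lambda>s. f (\<gamma> s))) t \<noteq> 0" unfolding eq by (auto simp: zero_prod_def)
    then show ?thesis by blast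
  qed
  obtain a b where "a \<noteq> 0 \<or> b \<noteq> 0" "a *\<^sub>R ?V j + b *\<^sub>R ?V k = 0" using V(2) by blast
  then show "dependent_pair ((vder ^^ j) (vder (\<lambda>s. f (\<gamma> s))) t) ((vder ^^ k) (vder (\<lambda>s. f (\<gamma> s))) t)"
    unfolding eq dependent_pair_def by (auto simp: zero_prod_def)
qed

end

text \<open>\<open>D \<alpha> y\<close> is the affine Legendre equivalence that a development
  attaches to the component of \<open>y\<close>.\<close>

locale developed_dual = glued G + dual_coordinates f g fr P W
  for G :: "('i, 'n::finite) gluing" and f g :: "'n jet \<Rightarrow> real^'n" and fr P W +
  fixes X :: "('i \<times> 'n jet) set \<Rightarrow> 'n jet" and D :: "'i \<Rightarrow> 'n jet \<Rightarrow> 'n jet \<Rightarrow> 'n jet"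
  assumes D_affine: "\<And>\<alpha> y. \<alpha> \<in> idx G \<Longrightarrow> y \<in> mdl G \<alpha> \<Longrightarrow> affine_legendre (D \<alpha> y)"
    and X_pt: "\<And>\<alpha> y. \<alpha> \<in> idx G \<Longrightarrow> y \<in> mdl G \<alpha> \<Longrightarrow> X (pt G \<alpha> y) = D \<alpha> y y"
    and D_const: "\<And>\<alpha> y y'. \<alpha> \<in> idx G \<Longrightarrow> y \<in> mdl G \<alpha> \<Longrightarrow> y' \<in> connected_component_set (mdl G \<alpha>) y \<Longrightarrow> D \<alpha> y' = D \<alpha> y"
begin

text \<open>The image of a connected time set lies in one component of the model, so a single affine
  map gives the global coordinates along the curve.\<close>

lemma X_along:
  assumes \<alpha>: "\<alpha> \<in> idx G" and I: "connected I" "smooth_on I \<gamma>" "\<gamma> ` I \<subseteq> mdl G \<alpha>" "s \<in> I" "t \<in> I"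
  shows "X (pt G \<alpha> (\<gamma> s)) = D \<alpha> (\<gamma> t) (\<gamma> s)"
proof -
  have "connected (\<gamma> ` I)" using connected_continuous_image[OF smooth_on_imp_continuous_on[OF I(2)] I(1)] .
  then have "\<gamma> s \<in> connected_component_set (mdl G \<alpha>) (\<gamma> t)"
    using I(3-5) by (auto simp: connected_component_def)
  then have "D \<alpha> (\<gamma> s) = D \<alpha> (\<gamma> t)" using D_const[OF \<alpha>, of "\<gamma> t" "\<gamma> s"] I by blast
  then show ?thesis using X_pt[OF \<alpha>, of "\<gamma> s"] I by auto
qed

lemma contact_along:
  assumes \<alpha>: "\<alpha> \<in> idx G" and I: "open I" "smooth_on I \<gamma>" "\<gamma> ` I \<subseteq> mdl G \<alpha>" "s \<in> I"
  shows "contact_form (\<gamma> s) (vder \<gamma> s) = 0"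
  using velocity_in_tangent_space[OF I] legendre[OF \<alpha>] I(3,4) unfolding legendre_submanifold_def by blast

lemma W_derivative_along:
  assumes \<alpha>: "\<alpha> \<in> idx G" and I: "open I" "connected I" "smooth_on I \<gamma>" "\<gamma> ` I \<subseteq> mdl G \<alpha>" "t \<in> I"
    and L: "bounded_linear L" "\<And>q. D \<alpha> (\<gamma> t) q = L q + k"
      "\<And>q u. contact_form (D \<alpha> (\<gamma> t) q) (L u) = contact_form q u"
  shows "((\<lambda>s. W r (X (pt G \<alpha> (\<gamma> s)))) has_real_derivative
    (f (X (pt G \<alpha> (\<gamma> t))) - f r) \<bullet> g (L (vder \<gamma> t))) (at t)"
proof -
  let ?F = "D \<alpha> (\<gamma> t)"
  have X: "X (pt G \<alpha> (\<gamma> s)) = ?F (\<gamma> s)" if "s \<in> I" for s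
    using X_along[OF \<alpha> I(2,3,4) that I(5)] .
  have "((\<lambda>s. ?F (\<gamma> s)) has_vector_derivative L (vder \<gamma> t)) (at t)"
    unfolding L(2)
    using has_vector_derivative_add[OF bounded_linear.has_vector_derivative[OF L(1)
      vder_has_vector_derivative[OF smooth_on_differentiable[OF I(3,5)]]] has_vector_derivative_const[of k]]
    by simp
  moreover have "contact_form (?F (\<gamma> t)) (L (vder \<gamma> t)) = 0"
    unfolding L(3) by (rule contact_along[OF \<alpha> I(1,3,4,5)])
  ultimately have "((\<lambda>s. W r (?F (\<gamma> s))) has_real_derivative (f (?F (\<gamma> t)) - f r) \<bullet> g (L (vder \<gamma> t))) (at t)"
    by (rule W_derivative)
  then have "((\<lambda>s. W r (X (pt G \<alpha> (\<gamma> s)))) has_real_derivative (f (?F (\<gamma> t)) - f r) \<bullet> g (L (vder \<gamma> t))) (at t)"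
    by (rule has_field_derivative_transform_within_open[OF _ I(1,5)]) (simp add: X)
  then show ?thesis by (simp add: X[OF I(5)])
qed

text \<open>Although the models change with time, every order of derivative of
  \<open>f (X (c s))\<close> is the image of the one in the model under an invertible linear map, so
  a single line serves the whole curve. The last conclusion says that arbitrarily short arcs already
  determine the direction of this line.\<close>

lemma straight_curve_direction:
  assumes J: "open J" "is_interval J" "t0 \<in> J" and c: "straight_curve fr P G J c"
  obtains d where "d \<noteq> 0" "\<And>s t. s \<in> J \<Longrightarrow> t \<in> J \<Longrightarrow> f (X (c s)) - f (X (c t)) \<in> span {d}"
    "\<And>I t. open I \<Longrightarrow> t \<in> I \<Longrightarrow> I \<subseteq> J \<Longrightarrow> \<exists>s\<in>I. f (X (c s)) \<noteq> f (X (c t))"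
proof -
  define h where "h s = f (X (c s))" for s
  have loc: "smooth_at h t \<and> (\<exists>k. (vder ^^ k) (vder h) t \<noteq> 0) \<and>
      (\<forall>j k. dependent_pair ((vder ^^ j) (vder h) t) ((vder ^^ k) (vder h) t))" if t: "t \<in> J" for t
  proof -
    obtain \<epsilon> \<alpha> \<gamma> where \<gamma>: "\<epsilon> > 0" "represents G c {t-\<epsilon><..<t+\<epsilon>} \<alpha> \<gamma>" "smooth_on {t-\<epsilon><..<t+\<epsilon>} \<gamma>"
      "straight_at fr P \<gamma> t"
      using c t unfolding straight_curve_def by blast
    let ?I = "{t-\<epsilon><..<t+\<epsilon>}"
    have tI: "t \<in> ?I" using \<gamma>(1) by simp
    have \<alpha>: "\<alpha> \<in> idx G" "\<gamma> ` ?I \<subseteq> mdl G \<alpha>" and c\<gamma>: "\<And>s. s \<in> ?I \<Longrightarrow> c s = pt G \<alpha> (\<gamma> s)"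
      using \<gamma>(2) by (auto simp: represents_def)
    obtain A B L k where A: "linear A" "\<And>v w. A v \<bullet> B w = v \<bullet> w" "\<And>q. D \<alpha> (\<gamma> t) q = L q + k" "\<And>u. f (L u) = A (f u)"
      using affine_legendre_dual[OF D_affine[OF \<alpha>(1)], of "\<gamma> t"] \<alpha>(2) tI by blast
    have blA: "bounded_linear A" using A(1) by (simp add: linear_conv_bounded_linear)
    have h: "h s = A (f (\<gamma> s)) + f k" if "s \<in> ?I" for s
      using X_along[OF \<alpha>(1) _ \<gamma>(3) \<alpha>(2) that tI] c\<gamma>[OF that]
      by (simp add: h_def A linear_add[OF bounded_linear.linear[OF bounded_linear_f]])
    have f\<gamma>: "smooth_on ?I (\<lambda>s. f (\<gamma> s))" by (rule smooth_on_bounded_linear[OF _ bounded_linear_f \<gamma>(3)]) simp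
    have "smooth_on ?I (\<lambda>s. A (f (\<gamma> s)) + f k)"
      by (rule smooth_on_affine[OF _ blA f\<gamma>]) simp
    then have sm: "smooth_on ?I h"
      unfolding smooth_on_def using Ck_on_cong_open[of ?I "\<lambda>s. A (f (\<gamma> s)) + f k" h] h by simp
    have der: "(vder ^^ j) (vder h) t = A ((vder ^^ j) (vder (\<lambda>s. f (\<gamma> s))) t)" for j
    proof -
      have "(vder ^^ Suc j) h t = (vder ^^ Suc j) (\<lambda>s. A (f (\<gamma> s)) + f k) t"
        by (rule vder_iter_cong_open[OF _ tI]) (simp_all add: h)
      then show ?thesis
        using vder_iter_affine[OF _ f\<gamma> blA tI, of j "f k"] by (simp add: funpow_swap1)
    qed
    have contact: "contact_form (\<gamma> s) (vder \<gamma> s) = 0" if "s \<in> ?I" for s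
      by (rule contact_along[OF \<alpha>(1) _ \<gamma>(3) \<alpha>(2) that]) simp
    \<comment> \<open>Injectivity carries a nonvanishing derivative over to \<open>h\<close>;
      linearity carries dependence over.\<close>
    have inj: "inj A" using dual_linear_bij[OF A(1,2)] by (simp add: bij_def)
    have dep: "dependent_pair (A v) (A w)" if "dependent_pair v w" for v w
      using that linear_0[OF A(1)] unfolding dependent_pair_def
      by (metis (no_types, lifting) linear_add[OF A(1)] linear_cmul[OF A(1)])
    show ?thesis
    proof (intro conjI allI)
      show "smooth_at h t" unfolding smooth_at_def using sm tI by (intro exI[of _ ?I]) simp
      obtain k where "(vder ^^ k) (vder (\<lambda>s. f (\<gamma> s))) t \<noteq> 0"
        using straight_at_derivatives(1)[OF _ \<gamma>(3) contact tI \<gamma>(4)] by auto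
      then have "(vder ^^ k) (vder h) t \<noteq> 0"
        unfolding der using injD[OF inj, of _ 0] linear_0[OF A(1)] by force
      then show "\<exists>k. (vder ^^ k) (vder h) t \<noteq> 0" by blast
      show "dependent_pair ((vder ^^ j) (vder h) t) ((vder ^^ k) (vder h) t)" for j k
        unfolding der by (rule dep, rule straight_at_derivatives(2)[OF _ \<gamma>(3) contact tI \<gamma>(4)]) simp
    qed
  qed
  have "smooth_at (vder h) t" if "t \<in> J" for t
    using smooth_at_vder_iter[of h t 1] loc[OF that] by simp
  then obtain d where d: "d \<noteq> 0" "\<And>t k. t \<in> J \<Longrightarrow> (vder ^^ k) (vder h) t \<in> span {d}"
    using dependent_derivatives_direction[OF J(1,2) _ _ _ J(3), of "vder h"] loc by blast
  show thesis
  proof (rule that[OF d(1)])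
    fix s t assume st: "s \<in> J" "t \<in> J"
    show "f (X (c s)) - f (X (c t)) \<in> span {d}"
      unfolding h_def[symmetric]
    proof (rule derivative_in_span_imp_diff_in_span[OF J(2) d(1) _ _ st])
      show "(h has_vector_derivative vder h t) (at t)" if "t \<in> J" for t
        using vder_has_vector_derivative[OF smooth_at_differentiable] loc[OF that] by blast
      show "vder h t \<in> span {d}" if "t \<in> J" for t using d(2)[OF that, of 0] by simp
    qed
  next
    fix I t assume I: "open I" "t \<in> I" "I \<subseteq> J"
    show "\<exists>s\<in>I. f (X (c s)) \<noteq> f (X (c t))"
    proof (rule ccontr)
      assume "\<not> (\<exists>s\<in>I. f (X (c s)) \<noteq> f (X (c t)))"
      \<comment> \<open>Constancy near \<open>t\<close> would annihilate all derivatives at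
        \<open>t\<close>, contrary to \<open>loc\<close>.\<close>
      then have "h s = h t" if "s \<in> I" for s using that by (simp add: h_def)
      then have "(vder ^^ k) (vder h) t = (vder ^^ k) (vder (\<lambda>_. h t)) t" for k
        using vder_iter_cong_open[OF I(1,2), of h "\<lambda>_. h t" "Suc k"] by (simp add: funpow_swap1)
      then show False using loc[of t] I by (auto simp: vder_iter_const)
    qed
  qed
qed

lemma local_part_curve:
  assumes \<alpha>: "\<alpha> \<in> idx G" and \<gamma>: "\<epsilon> > 0" "smooth_on {-\<epsilon><..<\<epsilon>} \<gamma>" "\<gamma> ` {-\<epsilon><..<\<epsilon>} \<subseteq> local_part G S \<alpha>"
  shows "smooth_curve G {-\<epsilon><..<\<epsilon>} (\<lambda>t. pt G \<alpha> (\<gamma> t))" "(\<lambda>t. pt G \<alpha> (\<gamma> t)) ` {-\<epsilon><..<\<epsilon>} \<subseteq> S"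
proof -
  show "(\<lambda>t. pt G \<alpha> (\<gamma> t)) ` {-\<epsilon><..<\<epsilon>} \<subseteq> S" using \<gamma>(3) by (auto simp: local_part_def)
  show "smooth_curve G {-\<epsilon><..<\<epsilon>} (\<lambda>t. pt G \<alpha> (\<gamma> t))"
    unfolding smooth_curve_def
  proof
    fix t assume t: "t \<in> {-\<epsilon><..<\<epsilon>}"
    \<comment> \<open>The distance from \<open>t\<close> to the nearer end of the interval.\<close>
    define \<delta> where "\<delta> = min (t + \<epsilon>) (\<epsilon> - t)"
    have \<delta>: "\<delta> > 0" "{t-\<delta><..<t+\<delta>} \<subseteq> {-\<epsilon><..<\<epsilon>}" using t by (auto simp: \<delta>_def)
    have "represents G (\<lambda>t. pt G \<alpha> (\<gamma> t)) {t-\<delta><..<t+\<delta>} \<alpha> \<gamma>"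
      using \<alpha> \<gamma>(3) \<delta>(2) by (auto simp: represents_def local_part_def image_subset_iff)
    then show "\<exists>\<epsilon>>0. \<exists>\<beta> \<gamma>'. represents G (\<lambda>t. pt G \<alpha> (\<gamma> t)) {t-\<epsilon><..<t+\<epsilon>} \<beta> \<gamma>' \<and> smooth_on {t-\<epsilon><..<t+\<epsilon>} \<gamma>'"
      using \<delta> smooth_on_subset[OF \<gamma>(2) \<delta>(2)] by blast
  qed
qed

text \<open>The common pattern of \<open>orthogonal_m\<close> and \<open>orthogonal_e\<close>, with
  \<open>f\<close> and \<open>g\<close> being p and x in one order or the other.\<close>

definition orthogonal where
  "orthogonal c \<tau> S \<longleftrightarrow>
     (\<exists>\<epsilon>>0. \<exists>\<alpha> \<gamma> m. represents G c ({\<tau>-\<epsilon><..<\<tau>+\<epsilon>} \<inter> {0..1}) \<alpha> \<gamma> \<and>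
        line_direction f \<gamma> ({\<tau>-\<epsilon><..<\<tau>+\<epsilon>} \<inter> {0..1}) m \<and>
        (\<forall>u\<in>tangent_space (local_part G S \<alpha>) (\<gamma> \<tau>). m \<bullet> g u = 0))"

lemma span_singleton_mem: "v \<in> span {w} \<longleftrightarrow> (\<exists>r. v = r *\<^sub>R w)"
  by (auto simp: span_singleton)

text \<open>Orthogonality offers some model, a representation without smoothness on an arc ending at
  time 1, and a direction \<open>m\<close> for that arc. The work lies in showing that
  \<open>A m\<close> spans the line of the whole curve; the velocity of any test curve in
  \<open>S\<close> is then moved into the same model.\<close>

lemma orthogonal_imp_critical:
  assumes J: "open J" "is_interval J" "{0..1} \<subseteq> J" and c': "straight_curve fr P G J c'"
    and c: "\<And>t. t \<in> {0..1} \<Longrightarrow> c t = c' t" "c 1 \<in> S" and orth: "orthogonal c 1 S"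
  shows "critical_point G S (\<lambda>q. W (X (c 0)) (X q)) (c 1)"
proof -
  obtain \<epsilon> \<alpha> \<gamma> m where \<epsilon>: "\<epsilon> > 0" and rep: "represents G c ({1-\<epsilon><..<1+\<epsilon>} \<inter> {0..1}) \<alpha> \<gamma>"
    and line: "line_direction f \<gamma> ({1-\<epsilon><..<1+\<epsilon>} \<inter> {0..1}) m"
    and m: "\<And>u. u \<in> tangent_space (local_part G S \<alpha>) (\<gamma> 1) \<Longrightarrow> m \<bullet> g u = 0"
    using orth unfolding orthogonal_def by blast
  have \<alpha>: "\<alpha> \<in> idx G" using rep by (simp add: represents_def)
  have \<gamma>c: "\<gamma> s \<in> mdl G \<alpha>" "c s = pt G \<alpha> (\<gamma> s)" if "s \<in> {1-\<epsilon><..1}" "0 \<le> s" for s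
    using rep that \<epsilon> by (auto simp: represents_def)
  have \<gamma>1: "\<gamma> 1 \<in> mdl G \<alpha>" "c 1 = pt G \<alpha> (\<gamma> 1)" using \<gamma>c[of 1] \<epsilon> by auto
  have J01: "0 \<in> J" "1 \<in> J" using J(3) by auto
  obtain A B L k where A: "linear A" "\<And>v w. A v \<bullet> B w = v \<bullet> w" and L: "bounded_linear L"
    "\<And>q. D \<alpha> (\<gamma> 1) q = L q + k" "\<And>u. f (L u) = A (f u)" "\<And>u. g (L u) = B (g u)"
    "\<And>q u. contact_form (D \<alpha> (\<gamma> 1) q) (L u) = contact_form q u"
    using affine_legendre_dual[OF D_affine[OF \<alpha> \<gamma>1(1)]] by blast
  obtain d where d: "\<And>s t. s \<in> J \<Longrightarrow> t \<in> J \<Longrightarrow> f (X (c' s)) - f (X (c' t)) \<in> span {d}"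
    "\<And>I t. open I \<Longrightarrow> t \<in> I \<Longrightarrow> I \<subseteq> J \<Longrightarrow> \<exists>s\<in>I. f (X (c' s)) \<noteq> f (X (c' t))"
    using straight_curve_direction[OF J(1,2) J01(1) c'] by metis
  obtain \<epsilon>' \<alpha>' \<gamma>' where \<gamma>': "\<epsilon>' > 0" "represents G c' {1-\<epsilon>'<..<1+\<epsilon>'} \<alpha>' \<gamma>'" "smooth_on {1-\<epsilon>'<..<1+\<epsilon>'} \<gamma>'"
    using c' J01(2) unfolding straight_curve_def by blast
  have \<alpha>': "\<alpha>' \<in> idx G" "\<And>s. s \<in> {1-\<epsilon>'<..<1+\<epsilon>'} \<Longrightarrow> \<gamma>' s \<in> mdl G \<alpha>'"
    "\<And>s. s \<in> {1-\<epsilon>'<..<1+\<epsilon>'} \<Longrightarrow> c' s = pt G \<alpha>' (\<gamma>' s)"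
    using \<gamma>'(2) by (auto simp: represents_def)
  have "pt G \<alpha> (\<gamma> 1) = pt G \<alpha>' (\<gamma>' 1)" using \<alpha>'(3)[of 1] \<gamma>'(1) \<gamma>1(2) c(1)[of 1] by simp
  then obtain \<delta> \<eta> where \<eta>: "\<delta> > 0" "\<delta> \<le> \<epsilon>'" "smooth_on {1-\<delta><..<1+\<delta>} \<eta>"
    "\<And>s. s \<in> {1-\<delta><..<1+\<delta>} \<Longrightarrow> \<eta> s \<in> mdl G \<alpha> \<and> pt G \<alpha> (\<eta> s) = pt G \<alpha>' (\<gamma>' s)"
    using change_model[OF \<alpha> \<alpha>'(1) \<gamma>'(1,3) \<alpha>'(2) \<gamma>1(1)] by blast
  \<comment> \<open>The bound 1 keeps the arc before time 1 inside [0,1], where \<open>c\<close> and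
    \<open>c'\<close> coincide.\<close>
  define e where "e = min (min \<delta> \<epsilon>) 1"
  have e: "e > 0" "e \<le> \<delta>" "e \<le> \<epsilon>" "e \<le> 1" using \<eta>(1) \<epsilon> by (auto simp: e_def)
  have \<eta>c: "c' s = pt G \<alpha> (\<eta> s)" if "s \<in> {1-\<delta><..<1+\<delta>}" for s
    using \<eta>(2,4) \<alpha>'(3)[of s] that by auto
  have \<eta>_mdl: "\<eta> ` {1-\<delta><..<1+\<delta>} \<subseteq> mdl G \<alpha>" using \<eta>(4) by blast
  \<comment> \<open>Points of the glued space have unique coordinates in a given model, so the
    smooth \<open>\<eta>\<close> agrees with the given \<open>\<gamma>\<close> on this arc.\<close>
  have \<eta>\<gamma>: "\<eta> s = \<gamma> s" if s: "s \<in> {1-e<..1}" for s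
  proof -
    have "pt G \<alpha> (\<eta> s) = pt G \<alpha> (\<gamma> s)" using \<eta>c[of s] \<gamma>c(2)[of s] c(1)[of s] s e by auto
    moreover have "\<eta> s \<in> mdl G \<alpha>" "\<gamma> s \<in> mdl G \<alpha>" using \<eta>(4)[of s] \<gamma>c(1)[of s] s e by auto
    ultimately show ?thesis using pt_inj[OF \<alpha>] by blast
  qed
  have fX: "f (X (c' s)) - f (X (c' t)) \<in> span {A m}" if st: "s \<in> {1-e<..1}" "t \<in> {1-e<..1}" for s t
  proof -
    obtain a where a: "\<forall>t\<in>{1-\<epsilon><..<1+\<epsilon>} \<inter> {0..1}. \<exists>r. f (\<gamma> t) = a + r *\<^sub>R m"
      using line unfolding line_direction_def by blast
    obtain r r' where r: "f (\<gamma> s) = a + r *\<^sub>R m" "f (\<gamma> t) = a + r' *\<^sub>R m"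
      using a[rule_format, of s] a[rule_format, of t] st e by auto
    have X: "X (c' s) = D \<alpha> (\<gamma> 1) (\<gamma> s)" if "s \<in> {1-e<..1}" for s
      using X_along[OF \<alpha> connected_Ioo \<eta>(3) \<eta>_mdl, of s 1] \<eta>c[of s] \<eta>\<gamma>[of s] \<eta>\<gamma>[of 1] that e by simp
    have "f (X (c' s)) - f (X (c' t)) = f (L (\<gamma> s)) - f (L (\<gamma> t))"
      unfolding X[OF st(1)] X[OF st(2)] L(2) by (simp add: linear_add[OF bounded_linear.linear[OF bounded_linear_f]])
    also have "\<dots> = A ((r - r') *\<^sub>R m)"
      unfolding L(3) r by (simp add: linear_add[OF A(1)] linear_cmul[OF A(1)] linear_diff[OF A(1)] scaleR_diff_left)
    also have "\<dots> = (r - r') *\<^sub>R A m" by (simp add: linear_cmul[OF A(1)])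
    finally show ?thesis by (auto simp: span_singleton_mem)
  qed
  have sub: "{1-e<..<1} \<subseteq> J" using J(3) e(4) by auto
  \<comment> \<open>Any interior time would do: nonconstancy on the open arc yields a nonzero
    difference lying on both lines, which forces them to coincide.\<close>
  have mid: "1 - e/2 \<in> {1-e<..<1}" using e(1) by simp
  obtain s where s: "s \<in> {1-e<..<1}" "f (X (c' s)) \<noteq> f (X (c' (1 - e/2)))"
    using d(2)[OF open_greaterThanLessThan mid sub] by blast
  have sJ: "s \<in> J" "1 - e/2 \<in> J" using sub mid s(1) by blast+
  let ?v = "f (X (c' s)) - f (X (c' (1 - e/2)))"
  have "?v \<in> span {d}" "?v \<in> span {A m}" "?v \<noteq> 0"
    using d(1)[OF sJ] fX[of s "1 - e/2"] s(1,2) e(1) by auto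
  then have "span {d} = span {A m}"
    using span_singleton_eq[of ?v d] span_singleton_eq[of ?v "A m"] by simp
  then have "f (X (c 1)) - f (X (c 0)) \<in> span {A m}"
    using d(1)[OF J01(2,1)] c(1) by simp
  then obtain r where r: "f (X (c 1)) - f (X (c 0)) = r *\<^sub>R A m" by (auto simp: span_singleton_mem)
  show ?thesis
    unfolding critical_point_def
  proof (intro conjI allI impI; (elim conjE)?)
    show "c 1 \<in> S" by fact
    fix c2 :: "real \<Rightarrow> _" and \<epsilon>2 :: real
    assume \<epsilon>2: "\<epsilon>2 > 0" and c2: "smooth_curve G {-\<epsilon>2<..<\<epsilon>2} c2" "c2 ` {-\<epsilon>2<..<\<epsilon>2} \<subseteq> S" "c2 0 = c 1"
    then obtain \<kappa> \<beta> \<xi> where \<xi>: "\<kappa> > 0" "represents G c2 {0-\<kappa><..<0+\<kappa>} \<beta> \<xi>" "smooth_on {0-\<kappa><..<0+\<kappa>} \<xi>"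
      unfolding smooth_curve_def by (metis greaterThanLessThan_iff neg_less_0_iff_less)
    have \<beta>: "\<beta> \<in> idx G" "\<And>s. s \<in> {0-\<kappa><..<0+\<kappa>} \<Longrightarrow> \<xi> s \<in> mdl G \<beta>"
      "\<And>s. s \<in> {0-\<kappa><..<0+\<kappa>} \<Longrightarrow> c2 s = pt G \<beta> (\<xi> s)"
      using \<xi>(2) by (auto simp: represents_def)
    have "pt G \<alpha> (\<gamma> 1) = pt G \<beta> (\<xi> 0)" using \<beta>(3)[of 0] \<xi>(1) \<gamma>1(2) c2(3) by simp
    then obtain \<mu> \<zeta> where \<zeta>: "\<mu> > 0" "\<mu> \<le> \<kappa>" "smooth_on {0-\<mu><..<0+\<mu>} \<zeta>"
      "\<And>s. s \<in> {0-\<mu><..<0+\<mu>} \<Longrightarrow> \<zeta> s \<in> mdl G \<alpha> \<and> pt G \<alpha> (\<zeta> s) = pt G \<beta> (\<xi> s)"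
      using change_model[OF \<alpha> \<beta>(1) \<xi>(1,3) \<beta>(2) \<gamma>1(1)] by blast
    define I where "I = {- min \<mu> \<epsilon>2<..<min \<mu> \<epsilon>2}"
    have I: "open I" "connected I" "0 \<in> I" "I \<subseteq> {0-\<mu><..<0+\<mu>}" "I \<subseteq> {-\<epsilon>2<..<\<epsilon>2}"
      using \<zeta>(1) \<epsilon>2 by (auto simp: I_def)
    have smooth: "smooth_on I \<zeta>" by (rule smooth_on_subset[OF \<zeta>(3) I(4)])
    have \<zeta>_mdl: "\<zeta> s \<in> mdl G \<alpha>" and \<zeta>c: "c2 s = pt G \<alpha> (\<zeta> s)" if "s \<in> I" for s
      using \<zeta>(4)[of s] \<zeta>(2) \<beta>(3)[of s] subsetD[OF I(4) that] by auto
    have \<zeta>S: "\<zeta> ` I \<subseteq> local_part G S \<alpha>"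
      using \<zeta>_mdl \<zeta>c c2(2) I(5) by (force simp: local_part_def)
    have \<zeta>0: "\<zeta> 0 = \<gamma> 1"
      using pt_inj[OF \<alpha> \<zeta>_mdl[OF I(3)] \<gamma>1(1)] \<zeta>c[OF I(3)] c2(3) \<gamma>1(2) by simp
    have "vder \<zeta> 0 \<in> tangent_space (local_part G S \<alpha>) (\<gamma> 1)"
      using velocity_in_tangent_space[OF I(1) smooth \<zeta>S I(3)] \<zeta>0 by simp
    then have m0: "m \<bullet> g (vder \<zeta> 0) = 0" by (rule m)
    have "\<zeta> ` I \<subseteq> mdl G \<alpha>" using \<zeta>_mdl by blast
    then have "((\<lambda>s. W (X (c 0)) (X (pt G \<alpha> (\<zeta> s)))) has_real_derivative
        (f (X (pt G \<alpha> (\<zeta> 0))) - f (X (c 0))) \<bullet> g (L (vder \<zeta> 0))) (at 0)"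
      using W_derivative_along[OF \<alpha> I(1,2) smooth _ I(3) L(1)] L(2,5) unfolding \<zeta>0 by blast
    \<comment> \<open>The pairing of r A m with B (g u) is r (m . g u), which vanishes by
      orthogonality for every r.\<close>
    also have "(f (X (pt G \<alpha> (\<zeta> 0))) - f (X (c 0))) \<bullet> g (L (vder \<zeta> 0)) = 0"
      using r A(2) m0 unfolding \<zeta>0 \<gamma>1(2)[symmetric] L(4) by simp
    finally show "((\<lambda>t. W (X (c 0)) (X (c2 t))) has_real_derivative 0) (at 0)"
      by (rule has_field_derivative_transform_within_open[OF _ I(1,3)]) (simp add: \<zeta>c)
  qed
qed

text \<open>A nonzero difference of the end values spans the line of the curve. Pulled back to a
  model at time 1 it is a direction vector, and the differential of the divergence is the pairing
  with exactly this vector.\<close>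

lemma critical_imp_orthogonal:
  assumes J: "open J" "is_interval J" "{0..1} \<subseteq> J" and c': "straight_curve fr P G J c'"
    and c: "\<And>t. t \<in> {0..1} \<Longrightarrow> c t = c' t" and ne: "f (X (c 0)) \<noteq> f (X (c 1))"
    and crit: "critical_point G S (\<lambda>q. W (X (c 0)) (X q)) (c 1)"
  shows "orthogonal c 1 S"
proof -
  have J01: "0 \<in> J" "1 \<in> J" using J(3) by auto
  let ?v = "f (X (c 1)) - f (X (c 0))"
  obtain d where d: "\<And>s t. s \<in> J \<Longrightarrow> t \<in> J \<Longrightarrow> f (X (c' s)) - f (X (c' t)) \<in> span {d}"
    using straight_curve_direction[OF J(1,2) J01(1) c'] by metis
  have "?v \<in> span {d}" using d[OF J01(2,1)] c by simp
  then have sp: "span {d} = span {?v}" using span_singleton_eq[of ?v d] ne by simp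
  obtain \<epsilon> \<alpha> \<gamma> where \<gamma>: "\<epsilon> > 0" "represents G c' {1-\<epsilon><..<1+\<epsilon>} \<alpha> \<gamma>" "smooth_on {1-\<epsilon><..<1+\<epsilon>} \<gamma>"
    using c' J01(2) unfolding straight_curve_def by blast
  let ?I = "{1-\<epsilon><..<1+\<epsilon>}"
  have \<alpha>: "\<alpha> \<in> idx G" "\<gamma> ` ?I \<subseteq> mdl G \<alpha>" and \<gamma>c: "\<And>s. s \<in> ?I \<Longrightarrow> c' s = pt G \<alpha> (\<gamma> s)"
    using \<gamma>(2) by (auto simp: represents_def)
  have I1: "1 \<in> ?I" using \<gamma>(1) by simp
  have \<gamma>1: "\<gamma> 1 \<in> mdl G \<alpha>" "c 1 = pt G \<alpha> (\<gamma> 1)" using \<alpha>(2) I1 \<gamma>c[OF I1] c[of 1] by auto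
  obtain A B L k where A: "linear A" "\<And>v w. A v \<bullet> B w = v \<bullet> w" and L: "bounded_linear L"
    "\<And>q. D \<alpha> (\<gamma> 1) q = L q + k" "\<And>u. f (L u) = A (f u)" "\<And>u. g (L u) = B (g u)"
    "\<And>q u. contact_form (D \<alpha> (\<gamma> 1) q) (L u) = contact_form q u"
    using affine_legendre_dual[OF D_affine[OF \<alpha>(1) \<gamma>1(1)]] by blast
  have bijA: "bij A" using dual_linear_bij[OF A(1,2)] .
  \<comment> \<open>With the full difference as \<open>A m\<close>, no scalar remains to be divided
    out: the derivative on \<open>u\<close> equals m . g u.\<close>
  then obtain m where m: "A m = ?v" by (metis bij_def surjD)
  have m0: "m \<noteq> 0" using m ne linear_0[OF A(1)] by auto
  have "line_direction f \<gamma> (?I \<inter> {0..1}) m"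
    unfolding line_direction_def
  proof (intro conjI m0 exI[of _ "f (\<gamma> 1)"] ballI)
    fix t assume t: "t \<in> ?I \<inter> {0..1}"
    have X: "X (c' s) = D \<alpha> (\<gamma> 1) (\<gamma> s)" if "s \<in> ?I" for s
      using X_along[OF \<alpha>(1) _ \<gamma>(3) \<alpha>(2) that I1] \<gamma>c[OF that] by simp
    have "f (X (c' t)) - f (X (c' 1)) = f (L (\<gamma> t)) - f (L (\<gamma> 1))"
      using t I1 by (simp add: X L(2) linear_add[OF bounded_linear.linear[OF bounded_linear_f]])
    then have "f (L (\<gamma> t)) - f (L (\<gamma> 1)) \<in> span {?v}"
      using d[of t 1] t J(3) J01(2) sp by auto
    then obtain r where "A (f (\<gamma> t)) - A (f (\<gamma> 1)) = r *\<^sub>R A m"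
      unfolding L(3) m by (auto simp: span_singleton_mem)
    then have "A (f (\<gamma> t)) = A (f (\<gamma> 1) + r *\<^sub>R m)"
      by (simp add: linear_add[OF A(1)] linear_cmul[OF A(1)] algebra_simps)
    then show "\<exists>r. f (\<gamma> t) = f (\<gamma> 1) + r *\<^sub>R m" using bijA by (auto simp: bij_def dest: injD)
  qed
  moreover have "m \<bullet> g u = 0" if u: "u \<in> tangent_space (local_part G S \<alpha>) (\<gamma> 1)" for u
  proof -
    obtain \<kappa> \<zeta> where \<zeta>: "\<kappa> > 0" "smooth_on {-\<kappa><..<\<kappa>} \<zeta>" "\<zeta> ` {-\<kappa><..<\<kappa>} \<subseteq> local_part G S \<alpha>" "\<zeta> 0 = \<gamma> 1"
      "(\<zeta> has_vector_derivative u) (at 0)"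
      using u unfolding tangent_space_def by blast
    have mdl: "\<zeta> ` {-\<kappa><..<\<kappa>} \<subseteq> mdl G \<alpha>" using \<zeta>(3) by (auto simp: local_part_def)
    have i0: "0 \<in> {-\<kappa><..<\<kappa>}" using \<zeta>(1) by simp
    have "((\<lambda>s. W (X (c 0)) (X (pt G \<alpha> (\<zeta> s)))) has_real_derivative
        (f (X (pt G \<alpha> (\<zeta> 0))) - f (X (c 0))) \<bullet> g (L (vder \<zeta> 0))) (at 0)"
      using W_derivative_along[OF \<alpha>(1) open_greaterThanLessThan connected_Ioo \<zeta>(2) mdl i0 L(1)] L(2,5)
      unfolding \<zeta>(4) by blast
    moreover have "((\<lambda>s. W (X (c 0)) (X (pt G \<alpha> (\<zeta> s)))) has_real_derivative 0) (at 0)"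
      \<comment> \<open>The curve that realises the tangent vector \<open>u\<close> in the model is
        an admissible test curve in \<open>S\<close>.\<close>
      using crit local_part_curve[OF \<alpha>(1) \<zeta>(1-3)] \<zeta>(1,4) \<gamma>1(2) unfolding critical_point_def by auto
    ultimately have "(f (X (pt G \<alpha> (\<zeta> 0))) - f (X (c 0))) \<bullet> g (L (vder \<zeta> 0)) = 0" by (rule DERIV_unique)
    then have "A m \<bullet> B (g (vder \<zeta> 0)) = 0" unfolding \<zeta>(4) \<gamma>1(2)[symmetric] L(4) m .
    then show ?thesis using A(2) vder_eqI[OF \<zeta>(5)] by simp
  qed
  moreover have "represents G c (?I \<inter> {0..1}) \<alpha> \<gamma>"
    using \<gamma>(2) c by (auto simp: represents_def)
  ultimately show ?thesis unfolding orthogonal_def using \<gamma>(1) by blast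
qed

end

section \<open>The instances for m-curves and e-curves\<close>

lemma coordinate_derivatives:
  assumes "(\<gamma> has_vector_derivative u) (at t)"
  shows "((\<lambda>s. xc (\<gamma> s)) has_vector_derivative xc u) (at t)"
    and "((\<lambda>s. pc (\<gamma> s)) has_vector_derivative pc u) (at t)"
    and "((\<lambda>s. zc (\<gamma> s)) has_vector_derivative zc u) (at t)"
  unfolding xc_def pc_def zc_def
  by (intro bounded_linear.has_vector_derivative[OF bounded_linear_fst]
      bounded_linear.has_vector_derivative[OF bounded_linear_snd] assms)+

text \<open>With the second argument fixed, the differential is dz - p(r) . dx, and dz = p . dx on
  contact vectors. The maps acting on x and p enter in exchanged order, which is why symmetry of the
  inner product is invoked.\<close>

lemma dual_coordinates_m: "dual_coordinates (pc :: 'n::finite jet \<Rightarrow> _) xc frame_E' Phi' (\<lambda>r q. divergence q r)"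
proof (rule dual_coordinates.intro)
  show "Phi' q v = (pc v, xc q \<bullet> pc v)" if "contact_form q v = 0" for q v :: "'n jet"
    using that by (simp add: Phi'_eq contact_form_def inner_commute)
  show "bounded_linear (pc :: 'n jet \<Rightarrow> _)"
    unfolding pc_def[abs_def] by (rule bounded_linear_compose[OF bounded_linear_fst bounded_linear_snd])
  fix F :: "'n jet \<Rightarrow> 'n jet" assume "affine_legendre F"
  then show "\<exists>A B L k. linear A \<and> linear B \<and> (\<forall>v w. A v \<bullet> B w = v \<bullet> w) \<and>
      bounded_linear L \<and> (\<forall>q. F q = L q + k) \<and> (\<forall>u. pc (L u) = A (pc u)) \<and> (\<forall>u. xc (L u) = B (xc u)) \<and>
      (\<forall>q u. contact_form (F q) (L u) = contact_form q u)"
    by (rule affine_legendre_differential) (metis inner_commute)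
next
  fix \<gamma> :: "real \<Rightarrow> 'n jet" and u t r
  assume \<gamma>: "(\<gamma> has_vector_derivative u) (at t)" and c: "contact_form (\<gamma> t) u = 0"
  have "((\<lambda>s. zc (\<gamma> s) + zc' r - xc (\<gamma> s) \<bullet> pc r) has_vector_derivative zc u + 0 - xc u \<bullet> pc r) (at t)"
    by (intro has_vector_derivative_add has_vector_derivative_diff has_vector_derivative_const
        bounded_linear.has_vector_derivative[OF bounded_linear_inner_left] coordinate_derivatives \<gamma>)
  moreover have "zc u + 0 - xc u \<bullet> pc r = (pc (\<gamma> t) - pc r) \<bullet> xc u"
    using c by (simp add: contact_form_def inner_diff_left inner_diff_right inner_commute)
  ultimately show "((\<lambda>s. divergence (\<gamma> s) r) has_real_derivative (pc (\<gamma> t) - pc r) \<bullet> xc u) (at t)"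
    by (simp add: divergence_def has_real_derivative_iff_has_vector_derivative)
qed (simp add: frame_E'_def)

text \<open>With the first argument fixed, the differential is dz' - x(r) . dp; the product rule and
  the contact condition give dz' = x . dp.\<close>

lemma dual_coordinates_e: "dual_coordinates (xc :: 'n::finite jet \<Rightarrow> _) pc frame_E Phi divergence"
proof (rule dual_coordinates.intro)
  show "Phi q v = (xc v, pc q \<bullet> xc v)" if "contact_form q v = 0" for q v :: "'n jet"
    using that by (simp add: Phi_eq contact_form_def)
  show "bounded_linear (xc :: 'n jet \<Rightarrow> _)"
    unfolding xc_def[abs_def] by (rule bounded_linear_fst)
  fix F :: "'n jet \<Rightarrow> 'n jet" assume "affine_legendre F"
  then show "\<exists>A B L k. linear A \<and> linear B \<and> (\<forall>v w. A v \<bullet> B w = v \<bullet> w) \<and>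
      bounded_linear L \<and> (\<forall>q. F q = L q + k) \<and> (\<forall>u. xc (L u) = A (xc u)) \<and> (\<forall>u. pc (L u) = B (pc u)) \<and>
      (\<forall>q u. contact_form (F q) (L u) = contact_form q u)"
    by (rule affine_legendre_differential) metis
next
  fix \<gamma> :: "real \<Rightarrow> 'n jet" and u t r
  assume \<gamma>: "(\<gamma> has_vector_derivative u) (at t)" and c: "contact_form (\<gamma> t) u = 0"
  have "((\<lambda>s. zc r + (pc (\<gamma> s) \<bullet> xc (\<gamma> s) - zc (\<gamma> s)) - xc r \<bullet> pc (\<gamma> s)) has_vector_derivative
      0 + (pc (\<gamma> t) \<bullet> xc u + pc u \<bullet> xc (\<gamma> t) - zc u) - xc r \<bullet> pc u) (at t)"
    by (intro has_vector_derivative_add has_vector_derivative_diff has_vector_derivative_const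
        bounded_bilinear.has_vector_derivative[OF bounded_bilinear_inner]
        bounded_linear.has_vector_derivative[OF bounded_linear_inner_right] coordinate_derivatives \<gamma>)
  moreover have "0 + (pc (\<gamma> t) \<bullet> xc u + pc u \<bullet> xc (\<gamma> t) - zc u) - xc r \<bullet> pc u = (xc (\<gamma> t) - xc r) \<bullet> pc u"
    using c by (simp add: contact_form_def inner_diff_left inner_diff_right inner_commute)
  ultimately show "((\<lambda>s. divergence r (\<gamma> s)) has_real_derivative (xc (\<gamma> t) - xc r) \<bullet> pc u) (at t)"
    by (simp add: divergence_def zc'_def has_real_derivative_iff_has_vector_derivative)
qed (simp add: frame_E_def)

text \<open>The conditions on end values are intrinsic: composing \<open>X\<close> with an affine
  Legendre equivalence changes its x and p parts by injective affine maps.\<close>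

theorem theorem4p8:
  fixes M :: "('i, 'n::finite) gluing"
    and X :: "('i \<times> 'n jet) set \<Rightarrow> 'n jet"
    and D :: "('i \<times> 'n jet) set \<Rightarrow> ('i \<times> 'n jet) set \<Rightarrow> real"
    and S :: "('i \<times> 'n jet) set set"
  assumes "with_coordinates M X"
    and "D = canonical_divergence X"
    and "submanifold_of M S"
  shows "(\<forall>c. m_curve M c \<and> c 1 \<in> S \<longrightarrow>
            (orthogonal_m M c 1 S \<longrightarrow> critical_point M S (\<lambda>q. D q (c 0)) (c 1)) \<and>
            (pc (X (c 0)) \<noteq> pc (X (c 1)) \<longrightarrow>
               (orthogonal_m M c 1 S \<longleftrightarrow> critical_point M S (\<lambda>q. D q (c 0)) (c 1)))) \<and>
         (\<forall>c. e_curve M c \<and> c 1 \<in> S \<longrightarrow>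
            (orthogonal_e M c 1 S \<longrightarrow> critical_point M S (\<lambda>q. D (c 0) q) (c 1)) \<and>
            (xc (X (c 0)) \<noteq> xc (X (c 1)) \<longrightarrow>
               (orthogonal_e M c 1 S \<longleftrightarrow> critical_point M S (\<lambda>q. D (c 0) q) (c 1))))"
proof -
  interpret glued M by (rule with_coordinates_glued_development(1)[OF assms(1)])
  obtain B where B: "\<forall>\<alpha>\<in>idx M. \<forall>y\<in>mdl M \<alpha>. affine_legendre (B \<alpha> y) \<and> X (pt M \<alpha> y) = B \<alpha> y y \<and>
      (\<forall>y'\<in>connected_component_set (mdl M \<alpha>) y. B \<alpha> y' = B \<alpha> y)"
    using with_coordinates_glued_development(2)[OF assms(1)] unfolding is_development_def by blast
  interpret m: developed_dual M pc xc frame_E' Phi' "\<lambda>r q. divergence q r" X B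
    by (intro developed_dual.intro glued_axioms dual_coordinates_m developed_dual_axioms.intro) (use B in blast)+
  interpret e: developed_dual M xc pc frame_E Phi divergence X B
    by (intro developed_dual.intro glued_axioms dual_coordinates_e developed_dual_axioms.intro) (use B in blast)+
  have orth: "orthogonal_m M c 1 S \<longleftrightarrow> m.orthogonal c 1 S" "orthogonal_e M c 1 S \<longleftrightarrow> e.orthogonal c 1 S" for c
    by (simp_all only: orthogonal_m_def m.orthogonal_def orthogonal_e_def e.orthogonal_def)
  show ?thesis
    unfolding assms(2) canonical_divergence_def orth
  proof (intro conjI allI impI; (elim conjE)?)
    fix c assume c: "m_curve M c" "c 1 \<in> S"
    then obtain J c' where J: "open J" "is_interval J" "{0..1} \<subseteq> J" "straight_curve frame_E' Phi' M J c'"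
      "\<And>t. t \<in> {0..1} \<Longrightarrow> c t = c' t"
      unfolding m_curve_def by blast
    show "critical_point M S (\<lambda>q. divergence (X q) (X (c 0))) (c 1)" if "m.orthogonal c 1 S"
      using m.orthogonal_imp_critical[OF J(1-5) c(2) that] .
    then show "m.orthogonal c 1 S = critical_point M S (\<lambda>q. divergence (X q) (X (c 0))) (c 1)"
      if "pc (X (c 0)) \<noteq> pc (X (c 1))"
      using m.critical_imp_orthogonal[OF J(1-5) that] by blast
  next
    fix c assume c: "e_curve M c" "c 1 \<in> S"
    then obtain J c' where J: "open J" "is_interval J" "{0..1} \<subseteq> J" "straight_curve frame_E Phi M J c'"
      "\<And>t. t \<in> {0..1} \<Longrightarrow> c t = c' t"
      unfolding e_curve_def by blast
    show "critical_point M S (\<lambda>q. divergence (X (c 0)) (X q)) (c 1)" if "e.orthogonal c 1 S"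
      using e.orthogonal_imp_critical[OF J(1-5) c(2) that] .
    then show "e.orthogonal c 1 S = critical_point M S (\<lambda>q. divergence (X (c 0)) (X q)) (c 1)"
      if "xc (X (c 0)) \<noteq> xc (X (c 1))"
      using e.critical_imp_orthogonal[OF J(1-5) that] by blast
  qed
qed

end
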